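(* Let $a\in\mathbb{R}\setminus\{0\}$. On $L^2(\mathbb{R})$ let $T=-\frac{d^2}{dx^2}+x^2$ with $\mathrm{Dom}(T)=\{f\in W^{2,2}(\mathbb{R}):x^2f\in L^2(\mathbb{R})\}$, let $B$ be multiplication by $2iax$, and let $L=T+B$ with $\mathrm{Dom}(L)=\mathrm{Dom}(T)$. Let $P_k$ denote the spectral projection of $L$ for the eigenvalue $\lambda_k=2k+1+a^2$, $k=0,1,2,\dots$. Then $$\|P_k\|=\frac{1}{2(2k)^{1/4}\sqrt{|a|\pi}}\exp\left(2^{3/2}|a|\sqrt{k}\right)\left(1+\mathcal{O}(k^{-1/2})\right),\qquad k\to\infty,$$ and consequently $$\lim_{k\to\infty}\frac{1}{\sqrt k}\log\|P_k\|=2^{3/2}|a|.$$ All these statements also hold for $\tilde L=T+\tilde B$, $\tilde B=2a\frac{d}{dx}$, $\mathrm{Dom}(\tilde L)=\mathrm{Dom}(T)$, in place of $L$.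
   Context: $\|P_k\|$ is the operator norm on $L^2(\mathbb{R})$. $L$ and $\tilde L$ are closed operators with compact resolvent; their spectrum is $\{2k+1+a^2:k=0,1,2,\dots\}$. For an isolated eigenvalue $\lambda$ of an operator $A$, the spectral projection is $\frac{1}{2\pi i}\int_{|\zeta-\lambda|=\varepsilon}(\zeta-A)^{-1}\,d\zeta$ with $\varepsilon>0$ smaller than the distance from $\lambda$ to the other eigenvalues. *)

theory Defs
  imports "HOL-Complex_Analysis.Complex_Analysis" "HOL-Library.Landau_Symbols"
begin

section \<open>The Hilbert space of square-integrable functions on the line\<close>

definition square_integrable :: "(real \<Rightarrow> complex) \<Rightarrow> bool" where
  "square_integrable f \<longleftrightarrow>
     f \<in> borel_measurable lborel \<and> integrable lborel (\<lambda>x. (cmod (f x))\<^sup>2)"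

lemma borel_measurable_cnj [measurable]: "cnj \<in> borel_measurable borel"
  by (intro borel_measurable_continuous_onI continuous_intros)

lemma square_integrable_mult_cnj:
  assumes "square_integrable f" "square_integrable g"
  shows "integrable lborel (\<lambda>x. f x * cnj (g x))"
proof (rule Bochner_Integration.integrable_bound)
  show "integrable lborel (\<lambda>x. (cmod (f x))\<^sup>2 + (cmod (g x))\<^sup>2)"
    using assms by (auto simp: square_integrable_def)
  have [measurable]: "f \<in> borel_measurable lborel" "g \<in> borel_measurable lborel"
    using assms by (auto simp: square_integrable_def)
  show "(\<lambda>x. f x * cnj (g x)) \<in> borel_measurable lborel"
    by measurable
  have "u * v \<le> u\<^sup>2 + v\<^sup>2" for u v :: real
    using sum_squares_bound[of u v] zero_le_power2[of u] zero_le_power2[of v] by linarith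
  then show "AE x in lborel. norm (f x * cnj (g x)) \<le> norm ((cmod (f x))\<^sup>2 + (cmod (g x))\<^sup>2)"
    by (simp add: norm_mult)
qed

lemma square_integrable_zero: "square_integrable (\<lambda>x. 0)"
  by (simp add: square_integrable_def)

lemma square_integrable_add:
  assumes "square_integrable f" "square_integrable g"
  shows "square_integrable (\<lambda>x. f x + g x)"
proof -
  have [measurable]: "f \<in> borel_measurable lborel" "g \<in> borel_measurable lborel"
    using assms by (auto simp: square_integrable_def)
  have "integrable lborel (\<lambda>x. (cmod (f x + g x))\<^sup>2)"
  proof (rule Bochner_Integration.integrable_bound)
    show "integrable lborel (\<lambda>x. 2 * ((cmod (f x))\<^sup>2 + (cmod (g x))\<^sup>2))"
      using assms by (auto simp: square_integrable_def)
    have "(cmod (f x + g x))\<^sup>2 \<le> 2 * ((cmod (f x))\<^sup>2 + (cmod (g x))\<^sup>2)" for x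
    proof -
      have "(cmod (f x + g x))\<^sup>2 \<le> (cmod (f x) + cmod (g x))\<^sup>2"
        by (intro power_mono norm_triangle_ineq) auto
      also have "\<dots> \<le> 2 * ((cmod (f x))\<^sup>2 + (cmod (g x))\<^sup>2)"
        using sum_squares_bound[of "cmod (f x)" "cmod (g x)"] by (simp add: power2_sum)
      finally show ?thesis .
    qed
    then show "AE x in lborel. norm ((cmod (f x + g x))\<^sup>2)
        \<le> norm (2 * ((cmod (f x))\<^sup>2 + (cmod (g x))\<^sup>2))"
      by auto
  qed measurable
  then show ?thesis
    by (auto simp: square_integrable_def)
qed

lemma square_integrable_cmult:
  assumes "square_integrable f"
  shows "square_integrable (\<lambda>x. c * f x)"
  using assms by (auto simp: square_integrable_def norm_mult power_mult_distrib)

(* Equality almost everywhere; the choice of lborel over lebesgue does not affect the quotient. *)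
definition l2_rel :: "(real \<Rightarrow> complex) \<Rightarrow> (real \<Rightarrow> complex) \<Rightarrow> bool" where
  "l2_rel f g \<longleftrightarrow>
     square_integrable f \<and> square_integrable g \<and> (AE x in lborel. f x = g x)"

quotient_type l2 = "real \<Rightarrow> complex" / partial: l2_rel
proof (rule part_equivpI)
  show "\<exists>f. l2_rel f f"
    by (rule exI[of _ "\<lambda>x. 0"]) (simp add: l2_rel_def square_integrable_zero)
  show "symp l2_rel"
    by (rule sympI) (auto simp: l2_rel_def elim: eventually_mono)
  show "transp l2_rel"
    by (rule transpI) (auto simp: l2_rel_def elim: eventually_elim2)
qed

lift_definition cscale :: "complex \<Rightarrow> l2 \<Rightarrow> l2" is "\<lambda>c f x. c * f x"
  by (auto simp: l2_rel_def square_integrable_cmult elim: eventually_mono)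

instantiation l2 :: real_vector
begin

lift_definition zero_l2 :: l2 is "\<lambda>x. 0"
  by (simp add: l2_rel_def square_integrable_zero)

lift_definition plus_l2 :: "l2 \<Rightarrow> l2 \<Rightarrow> l2" is "\<lambda>f g x. f x + g x"
  by (auto simp: l2_rel_def square_integrable_add elim: eventually_elim2)

definition uminus_l2 :: "l2 \<Rightarrow> l2" where
  "- f = cscale (-1) f"

definition minus_l2 :: "l2 \<Rightarrow> l2 \<Rightarrow> l2" where
  "f - g = f + cscale (-1) g" for f g :: l2

definition scaleR_l2 :: "real \<Rightarrow> l2 \<Rightarrow> l2" where
  "r *\<^sub>R f = cscale (complex_of_real r) f"

instance
proof
  fix f g h :: l2 and r s :: real
  show "f + g + h = f + (g + h)"
    by transfer (auto simp: l2_rel_def add.assoc intro!: square_integrable_add)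
  show "f + g = g + f"
    by transfer (auto simp: l2_rel_def add.commute intro!: square_integrable_add)
  show "0 + f = f"
    by transfer (auto simp: l2_rel_def)
  show "- f + f = 0"
    unfolding uminus_l2_def
    by transfer (auto simp: l2_rel_def square_integrable_zero)
  show "f - g = f + - g"
    by (simp add: minus_l2_def uminus_l2_def)
  show "r *\<^sub>R (f + g) = r *\<^sub>R f + r *\<^sub>R g"
    unfolding scaleR_l2_def
    by transfer
      (auto simp: l2_rel_def distrib_left distrib_right intro!: square_integrable_add square_integrable_cmult)
  show "(r + s) *\<^sub>R f = r *\<^sub>R f + s *\<^sub>R f"
    unfolding scaleR_l2_def
    by transfer
      (auto simp: l2_rel_def distrib_left distrib_right intro!: square_integrable_add square_integrable_cmult)
  show "r *\<^sub>R s *\<^sub>R f = (r * s) *\<^sub>R f"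
    unfolding scaleR_l2_def
    by transfer (auto simp: l2_rel_def mult.assoc intro!: square_integrable_cmult)
  show "1 *\<^sub>R f = f"
    unfolding scaleR_l2_def by transfer (auto simp: l2_rel_def)
qed

end

instantiation l2 :: real_inner
begin

(* The real part of the complex inner product; it induces the usual norm. *)
lift_definition inner_l2 :: "l2 \<Rightarrow> l2 \<Rightarrow> real" is
  "\<lambda>f g. Re (\<integral>x. f x * cnj (g x) \<partial>lborel)"
proof -
  fix f f' g g' assume *: "l2_rel f f'" "l2_rel g g'"
  then have [measurable]: "f \<in> borel_measurable lborel" "g \<in> borel_measurable lborel"
      "f' \<in> borel_measurable lborel" "g' \<in> borel_measurable lborel"
    by (auto simp: l2_rel_def square_integrable_def)
  have ae: "AE x in lborel. f x * cnj (g x) = f' x * cnj (g' x)"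
    using * by (auto simp: l2_rel_def elim: eventually_elim2)
  have "(\<integral>x. f x * cnj (g x) \<partial>lborel) = (\<integral>x. f' x * cnj (g' x) \<partial>lborel)"
    by (intro integral_cong_AE ae) measurable
  then show "Re (\<integral>x. f x * cnj (g x) \<partial>lborel) = Re (\<integral>x. f' x * cnj (g' x) \<partial>lborel)"
    by simp
qed

definition norm_l2 :: "l2 \<Rightarrow> real" where
  "norm f = sqrt (inner f f)" for f :: l2

definition dist_l2 :: "l2 \<Rightarrow> l2 \<Rightarrow> real" where
  "dist f g = norm (f - g)" for f g :: l2

definition sgn_l2 :: "l2 \<Rightarrow> l2" where
  "sgn f = f /\<^sub>R norm f" for f :: l2

definition uniformity_l2 :: "(l2 \<times> l2) filter" where
  "uniformity_l2 = (INF e\<in>{0<..}. principal {(f, g). dist f g < e})"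

definition open_l2 :: "l2 set \<Rightarrow> bool" where
  "open_l2 U = (\<forall>f\<in>U. \<forall>\<^sub>F (f', g) in uniformity. f' = f \<longrightarrow> g \<in> U)"

instance
proof
  fix f g h :: l2 and r :: real
  show "dist f g = norm (f - g)"
    by (rule dist_l2_def)
  show "sgn f = f /\<^sub>R norm f"
    by (rule sgn_l2_def)
  show "uniformity = (INF e\<in>{0<..}. principal {(f, g :: l2). dist f g < e})"
    by (rule uniformity_l2_def)
  show "open U = (\<forall>f\<in>U. \<forall>\<^sub>F (f', g) in uniformity. f' = f \<longrightarrow> g \<in> U)" for U :: "l2 set"
    by (rule open_l2_def)
  show "inner f g = inner g f"
  proof transfer
    fix f g :: "real \<Rightarrow> complex"
    have "(\<integral>x. g x * cnj (f x) \<partial>lborel) = (\<integral>x. cnj (f x * cnj (g x)) \<partial>lborel)"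
      by (intro Bochner_Integration.integral_cong) (auto simp: mult.commute)
    also have "\<dots> = cnj (\<integral>x. f x * cnj (g x) \<partial>lborel)"
      by (rule integral_bounded_linear'[OF bounded_linear_cnj bounded_linear_cnj]) simp
    finally show "Re (\<integral>x. f x * cnj (g x) \<partial>lborel) = Re (\<integral>x. g x * cnj (f x) \<partial>lborel)"
      by simp
  qed
  show "inner (f + g) h = inner f h + inner g h"
    by transfer (auto simp: l2_rel_def distrib_right square_integrable_mult_cnj)
  show "inner (r *\<^sub>R f) g = r * inner f g"
    unfolding scaleR_l2_def by transfer (auto simp: l2_rel_def mult.assoc)
  have self: "(\<integral>x. f x * cnj (f x) \<partial>lborel) = complex_of_real (\<integral>x. (cmod (f x))\<^sup>2 \<partial>lborel)"
    for f
    by (simp add: complex_norm_square[symmetric] flip: integral_complex_of_real)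
  show "0 \<le> inner f f"
    by transfer (simp add: self)
  show "(inner f f = 0) = (f = 0)"
  proof transfer
    fix f assume "l2_rel f f"
    then have "integrable lborel (\<lambda>x. (cmod (f x))\<^sup>2)" "square_integrable f"
      by (auto simp: l2_rel_def square_integrable_def)
    then show "(Re (\<integral>x. f x * cnj (f x) \<partial>lborel) = 0) = l2_rel f (\<lambda>x. 0)"
      by (simp add: self integral_nonneg_eq_0_iff_AE l2_rel_def square_integrable_zero)
  qed
  show "norm f = sqrt (inner f f)"
    by (rule norm_l2_def)
qed

end

lemma bounded_linear_cscale: "bounded_linear (cscale c)"
proof (rule bounded_linear_intro[where K = "cmod c"])
  fix f g :: l2 and r :: real
  show "cscale c (f + g) = cscale c f + cscale c g"
    by transfer
      (auto simp: l2_rel_def distrib_left distrib_right intro!: square_integrable_add square_integrable_cmult)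
  show "cscale c (r *\<^sub>R f) = r *\<^sub>R cscale c f"
    unfolding scaleR_l2_def
    by transfer (auto simp: l2_rel_def mult.left_commute intro!: square_integrable_cmult)
  have "inner (cscale c f) (cscale c f) = (cmod c)\<^sup>2 * inner f f"
  proof transfer
    fix c and f :: "real \<Rightarrow> complex"
    have "(\<integral>x. c * f x * cnj (c * f x) \<partial>lborel)
        = (\<integral>x. complex_of_real ((cmod c)\<^sup>2) * (f x * cnj (f x)) \<partial>lborel)"
      unfolding complex_norm_square
      by (intro Bochner_Integration.integral_cong) (auto simp: mult_ac)
    also have "\<dots> = complex_of_real ((cmod c)\<^sup>2) * (\<integral>x. f x * cnj (f x) \<partial>lborel)"
      by simp
    finally show "Re (\<integral>x. c * f x * cnj (c * f x) \<partial>lborel)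
        = (cmod c)\<^sup>2 * Re (\<integral>x. f x * cnj (f x) \<partial>lborel)"
      by (simp del: of_real_power)
  qed
  then show "norm (cscale c f) \<le> norm f * cmod c"
    by (simp add: norm_l2_def real_sqrt_mult)
qed

lift_definition cscale_op :: "complex \<Rightarrow> l2 \<Rightarrow>\<^sub>L l2" is cscale
  by (rule bounded_linear_cscale)


section \<open>Weak derivatives and Sobolev spaces\<close>

(* Real-valued test functions suffice, since the defining identity is complex-linear in the
   test function. *)
definition test_function :: "(real \<Rightarrow> real) \<Rightarrow> bool" where
  "test_function \<phi> \<longleftrightarrow>
     (\<forall>n x. (deriv ^^ n) \<phi> differentiable at x) \<and> compact (closure {x. \<phi> x \<noteq> 0})"

definition has_weak_derivative :: "nat \<Rightarrow> l2 \<Rightarrow> l2 \<Rightarrow> bool" where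
  "has_weak_derivative n f g \<longleftrightarrow>
     (\<forall>\<phi>. test_function \<phi> \<longrightarrow>
        (\<integral>x. complex_of_real ((deriv ^^ n) \<phi> x) * rep_l2 f x \<partial>lborel)
        = (-1) ^ n * (\<integral>x. complex_of_real (\<phi> x) * rep_l2 g x \<partial>lborel))"

definition weak_derivative :: "nat \<Rightarrow> l2 \<Rightarrow> l2" where
  "weak_derivative n f = (THE g. has_weak_derivative n f g)"

(* The Sobolev space $W^{m,2}$ on the line. *)
definition sobolev :: "nat \<Rightarrow> l2 set" where
  "sobolev m = {f. \<forall>n\<le>m. \<exists>g. has_weak_derivative n f g}"


section \<open>Multiplication operators\<close>

definition in_mult_dom :: "(real \<Rightarrow> complex) \<Rightarrow> l2 \<Rightarrow> bool" where
  "in_mult_dom m f \<longleftrightarrow> square_integrable (\<lambda>x. m x * rep_l2 f x)"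

(* Meaningful only if in_mult_dom m f holds. *)
definition mult_op :: "(real \<Rightarrow> complex) \<Rightarrow> l2 \<Rightarrow> l2" where
  "mult_op m f = abs_l2 (\<lambda>x. m x * rep_l2 f x)"


section \<open>Unbounded operators and their spectral projections\<close>

(* The values of op_app outside op_dom carry no meaning. *)
record l2_operator =
  op_dom :: "l2 set"
  op_app :: "l2 \<Rightarrow> l2"

definition eigenvalues :: "l2_operator \<Rightarrow> complex set" where
  "eigenvalues A = {\<mu>. \<exists>u\<in>op_dom A. u \<noteq> 0 \<and> op_app A u = cscale \<mu> u}"

(* A bounded inverse is required only to be real-linear here; for a complex-linear A
   it is automatically complex-linear. *)
definition is_resolvent :: "l2_operator \<Rightarrow> complex \<Rightarrow> (l2 \<Rightarrow>\<^sub>L l2) \<Rightarrow> bool" where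
  "is_resolvent A \<zeta> R \<longleftrightarrow>
     (\<forall>f. blinfun_apply R f \<in> op_dom A \<and>
          cscale \<zeta> (blinfun_apply R f) - op_app A (blinfun_apply R f) = f) \<and>
     (\<forall>u\<in>op_dom A. blinfun_apply R (cscale \<zeta> u - op_app A u) = u)"

definition resolvent_set :: "l2_operator \<Rightarrow> complex set" where
  "resolvent_set A = {\<zeta>. \<exists>R. is_resolvent A \<zeta> R}"

definition resolvent :: "l2_operator \<Rightarrow> complex \<Rightarrow> (l2 \<Rightarrow>\<^sub>L l2)" where
  "resolvent A \<zeta> = (THE R. is_resolvent A \<zeta> R)"

(* The analogue of has_contour_integral for integrands with values in the bounded operators;
   the integral converges in operator norm. *)
definition has_op_contour_integral ::
    "(complex \<Rightarrow> (l2 \<Rightarrow>\<^sub>L l2)) \<Rightarrow> (l2 \<Rightarrow>\<^sub>L l2) \<Rightarrow> (real \<Rightarrow> complex) \<Rightarrow> bool" where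
  "has_op_contour_integral F I \<gamma> \<longleftrightarrow>
     ((\<lambda>t. cscale_op (vector_derivative \<gamma> (at t within {0..1})) o\<^sub>L F (\<gamma> t))
        has_integral I) {0..1}"

definition is_spectral_projection ::
    "l2_operator \<Rightarrow> complex \<Rightarrow> (l2 \<Rightarrow>\<^sub>L l2) \<Rightarrow> bool" where
  "is_spectral_projection A lam P \<longleftrightarrow>
     (\<exists>\<epsilon>>0. (\<forall>\<mu>\<in>eigenvalues A - {lam}. \<epsilon> < dist lam \<mu>) \<and>
        sphere lam \<epsilon> \<subseteq> resolvent_set A \<and>
        (\<exists>I. has_op_contour_integral (resolvent A) I (circlepath lam \<epsilon>) \<and>
             P = cscale_op (1 / (2 * complex_of_real pi * \<i>)) o\<^sub>L I))"

(* For an isolated eigenvalue the integral does not depend on the admissible radius (Cauchy). *)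
definition spectral_projection :: "l2_operator \<Rightarrow> complex \<Rightarrow> (l2 \<Rightarrow>\<^sub>L l2)" where
  "spectral_projection A lam = (THE P. is_spectral_projection A lam P)"


section \<open>The harmonic oscillator and its perturbations\<close>

definition op_T :: l2_operator where
  "op_T =
     \<lparr> op_dom = {f \<in> sobolev 2. in_mult_dom (\<lambda>x. complex_of_real (x\<^sup>2)) f},
       op_app = (\<lambda>f. - weak_derivative 2 f + mult_op (\<lambda>x. complex_of_real (x\<^sup>2)) f) \<rparr>"

definition op_L :: "real \<Rightarrow> l2_operator" where
  "op_L a =
     \<lparr> op_dom = op_dom op_T,
       op_app = (\<lambda>f. op_app op_T f
                + mult_op (\<lambda>x. 2 * \<i> * complex_of_real a * complex_of_real x) f) \<rparr>"

definition op_L_tilde :: "real \<Rightarrow> l2_operator" where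
  "op_L_tilde a =
     \<lparr> op_dom = op_dom op_T,
       op_app = (\<lambda>f. op_app op_T f + (2 * a) *\<^sub>R weak_derivative 1 f) \<rparr>"

end

theory Submission
  imports Defs "HOL-Probability.Probability" "HOL-Real_Asymp.Real_Asymp"
begin

text \<open>For real $\<alpha>$, $\<beta>$ consider $A = T + 2i\<alpha>x + 2\<beta>\,d/dx
  = -(d/dx - \<beta>)^2 + (x + i\<alpha>)^2 + \<alpha>^2 + \<beta>^2$, which is $L$ for $(\<alpha>,\<beta>) = (a,0)$ and
  $\tilde L$ for $(\<alpha>,\<beta>) = (0,a)$. The shifted Hermite functions $f_j(x) = e^{\<beta>x} h_j(x + i\<alpha>)$ are
  eigenfunctions, those for $(-\<alpha>,-\<beta>)$, say $g_j$, are eigenfunctions of the adjoint, and both systems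
  are complete because a function all of whose moments against a Gaussian vanish is zero.
  Pairing with the $g_j$ therefore determines every vector: it gives $\langle (\<zeta> - A)^{-1}f, g_j\rangle
  = \langle f, g_j\rangle / (\<zeta> - \<lambda>_j)$, and Cauchy's formula turns this into
  $P_k f = \langle f, g_k\rangle f_k / \langle f_k, g_k\rangle$. The resolvent exists since
  $\<zeta> - A$ has dense range and, by compactness, is bounded below.

  Hence $\|P_k\| = \|f_k\| \|g_k\| / |\langle f_k, g_k\rangle|$, and the ladder relations evaluate this to
  $e^{a^2} L_k(-2a^2)$. Writing the Laguerre polynomial as a circle integral through its saddle point,
  Laplace's method gives the asymptotics.\<close>

section \<open>The space of square-integrable functions as a Hilbert space\<close>

text \<open>The norms of the P_k grow faster than any power of k, so the f_j form no basis and the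
  resolvent cannot be written as a convergent eigenfunction series. This shapes the proof:
  identities between vectors and operators are verified after pairing with all g_n, while existence
  of the resolvent is a separate argument resting on an a priori bound. The computations take place
  on polynomials times one fixed Gaussian weight, a space that A maps into itself and on which
  integration by parts becomes algebra. A graph-norm estimate shows that limits taken there stay in
  Dom(T), so that the resolvent really maps into the prescribed domain.

  The two operators are related by the Fourier transform, which exchanges multiplication by x and
  d/dx up to constants. The family in \<alpha> and \<beta> treats both at once instead; accordingly
  the final norm depends only on \<alpha>^2 + \<beta>^2.\<close>

lemma square_integrable_rep: "square_integrable (rep_l2 u)"
  using Quotient3_rel_rep[OF Quotient3_l2, of u u] by (simp add: l2_rel_def)

lemma measurable_rep [measurable]: "rep_l2 u \<in> borel_measurable borel"
  using square_integrable_rep[of u] by (simp add: square_integrable_def)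

lemma integrable_rep: "integrable lborel (\<lambda>x. (cmod (rep_l2 u x))\<^sup>2)"
  using square_integrable_rep[of u] by (simp add: square_integrable_def)

lemma abs_rep [simp]: "abs_l2 (rep_l2 u) = u"
  by (rule Quotient3_abs_rep[OF Quotient3_l2])

lemma abs_eqI: "l2_rel f g \<Longrightarrow> abs_l2 f = abs_l2 g"
  using Quotient3_rel_abs[OF Quotient3_l2] by blast

lemma rep_abs_AE:
  assumes "square_integrable f"
  shows "AE x in lborel. rep_l2 (abs_l2 f) x = f x"
proof -
  have "l2_rel f f" using assms by (simp add: l2_rel_def)
  then have "l2_rel (rep_l2 (abs_l2 f)) f"
    by (metis Quotient3_l2 rep_abs_rsp_left)
  then show ?thesis by (simp add: l2_rel_def)
qed

lemma l2_eqI: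
  assumes "AE x in lborel. rep_l2 u x = rep_l2 v x"
  shows "u = v"
  using abs_eqI[of "rep_l2 u" "rep_l2 v"] assms square_integrable_rep by (simp add: l2_rel_def)

lemma abs_add: "square_integrable f \<Longrightarrow> square_integrable g \<Longrightarrow>
    abs_l2 f + abs_l2 g = abs_l2 (\<lambda>x. f x + g x)"
  by (rule plus_l2.abs_eq) (auto simp: l2_rel_def)

lemma abs_cscale: "square_integrable f \<Longrightarrow> cscale c (abs_l2 f) = abs_l2 (\<lambda>x. c * f x)"
  by (rule cscale.abs_eq) (auto simp: l2_rel_def)

lemma scaleR_eq_cscale: "r *\<^sub>R u = cscale (complex_of_real r) (u::l2)"
  by (rule scaleR_l2_def)

lemma uminus_eq_cscale: "- u = cscale (-1) (u::l2)"
  by (rule uminus_l2_def)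

lemma rep_add: "AE x in lborel. rep_l2 (u + v) x = rep_l2 u x + rep_l2 v x"
  using rep_abs_AE[OF square_integrable_add[OF square_integrable_rep[of u] square_integrable_rep[of v]]]
    abs_add[OF square_integrable_rep[of u] square_integrable_rep[of v]] by simp

lemma rep_cscale: "AE x in lborel. rep_l2 (cscale c u) x = c * rep_l2 u x"
  using rep_abs_AE[OF square_integrable_cmult[OF square_integrable_rep[of u], of c]]
    abs_cscale[OF square_integrable_rep[of u], of c] by simp

lemma rep_diff: "AE x in lborel. rep_l2 (u - v) x = rep_l2 u x - rep_l2 v x"
  using rep_add[of u "cscale (-1) v"] rep_cscale[of "-1" v] unfolding minus_l2_def
  by eventually_elim simp

lemma cscale_add: "cscale c (u + v) = cscale c u + cscale c v"
  and cscale_diff: "cscale c (u - v) = cscale c u - cscale c v"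
  and cscale_zero [simp]: "cscale c 0 = 0"
  and cscale_sum: "cscale c (sum h S) = (\<Sum>i\<in>S. cscale c (h i))"
proof -
  interpret bounded_linear "cscale c" by (rule bounded_linear_cscale)
  show "cscale c (u + v) = cscale c u + cscale c v" "cscale c (u - v) = cscale c u - cscale c v"
    "cscale c 0 = 0" "cscale c (sum h S) = (\<Sum>i\<in>S. cscale c (h i))"
    by (rule add diff zero sum)+
qed

lemma cscale_cscale [simp]: "cscale c (cscale d u) = cscale (c * d) u"
  by (rule l2_eqI, use rep_cscale[of c "cscale d u"] rep_cscale[of d u] rep_cscale[of "c * d" u] in eventually_elim)
     simp

lemma cscale_one [simp]: "cscale 1 u = u"
  using scaleR_eq_cscale[of 1 u] by simp

lemma cscale_zero_left [simp]: "cscale 0 u = 0"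
  using scaleR_eq_cscale[of 0 u] by simp

lemma cscale_add_left: "cscale (c + d) u = cscale c u + cscale d u"
  by (rule l2_eqI, use rep_add[of "cscale c u" "cscale d u"] rep_cscale[of c u] rep_cscale[of d u]
      rep_cscale[of "c + d" u] in eventually_elim) (simp add: algebra_simps)

lemma cscale_diff_left: "cscale (c - d) u = cscale c u - cscale d u"
  using cscale_add_left[of "c - d" d u] by (simp add: algebra_simps)

text \<open>The class instance supplies only the real part of the inner product, for which i u is
  orthogonal to u. Eigenvalue equations and adjoints need the full sesquilinear form.\<close>

definition cinner :: "l2 \<Rightarrow> l2 \<Rightarrow> complex" where
  "cinner u v = (\<integral>x. rep_l2 u x * cnj (rep_l2 v x) \<partial>lborel)"

lemma cinner_cong:
  assumes "AE x in lborel. rep_l2 u x = f x" "AE x in lborel. rep_l2 v x = g x"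
    and [measurable]: "f \<in> borel_measurable borel" "g \<in> borel_measurable borel"
  shows "cinner u v = (\<integral>x. f x * cnj (g x) \<partial>lborel)"
  unfolding cinner_def
  by (rule integral_cong_AE) (use assms(1,2) in \<open>(measurable, eventually_elim, simp)\<close>)

lemma cinner_abs_right:
  assumes "square_integrable g"
  shows "cinner u (abs_l2 g) = (\<integral>x. rep_l2 u x * cnj (g x) \<partial>lborel)"
  by (rule cinner_cong) (use assms rep_abs_AE in \<open>auto simp: square_integrable_def\<close>)

lemma cinner_abs:
  assumes "square_integrable f" "square_integrable g"
  shows "cinner (abs_l2 f) (abs_l2 g) = (\<integral>x. f x * cnj (g x) \<partial>lborel)"
  by (rule cinner_cong) (use assms rep_abs_AE in \<open>auto simp: square_integrable_def\<close>)

lemma integrable_cinner: "integrable lborel (\<lambda>x. rep_l2 u x * cnj (rep_l2 v x))"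
  by (intro square_integrable_mult_cnj square_integrable_rep)

lemma cinner_add_left: "cinner (u + u') v = cinner u v + cinner u' v"
proof -
  have "cinner (u + u') v = (\<integral>x. (rep_l2 u x + rep_l2 u' x) * cnj (rep_l2 v x) \<partial>lborel)"
    by (rule cinner_cong) (use rep_add in auto)
  then show ?thesis unfolding cinner_def by (simp add: distrib_right integrable_cinner)
qed

lemma cinner_cscale_left [simp]: "cinner (cscale c u) v = c * cinner u v"
proof -
  have "cinner (cscale c u) v = (\<integral>x. (c * rep_l2 u x) * cnj (rep_l2 v x) \<partial>lborel)"
    by (rule cinner_cong) (use rep_cscale in auto)
  then show ?thesis unfolding cinner_def by (simp add: mult.assoc)
qed

lemma cnj_cinner: "cnj (cinner u v) = cinner v u"
proof -
  have "cinner v u = (\<integral>x. cnj (rep_l2 u x * cnj (rep_l2 v x)) \<partial>lborel)"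
    unfolding cinner_def by (intro Bochner_Integration.integral_cong) (auto simp: mult.commute)
  also have "\<dots> = cnj (cinner u v)"
    unfolding cinner_def by (rule integral_bounded_linear'[OF bounded_linear_cnj bounded_linear_cnj]) simp
  finally show ?thesis by simp
qed

lemma cinner_add_right: "cinner v (u + u') = cinner v u + cinner v u'"
  using cinner_add_left[of u u' v] by (metis cnj_cinner complex_cnj_add)

lemma cinner_cscale_right [simp]: "cinner v (cscale c u) = cnj c * cinner v u"
  using cinner_cscale_left[of c u v] by (metis cnj_cinner complex_cnj_mult)

lemma inner_eq_cinner: "inner u v = Re (cinner u v)"
  unfolding cinner_def by (simp add: inner_l2.rep_eq)

lemma cinner_scaleR_left: "cinner (r *\<^sub>R u) v = of_real r * cinner u v"
  by (simp add: scaleR_eq_cscale)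

lemma cinner_scaleR_right: "cinner v (r *\<^sub>R u) = of_real r * cinner v u"
  by (simp add: scaleR_eq_cscale)

lemma cinner_minus_left [simp]: "cinner (- u) v = - cinner u v"
  by (simp add: uminus_eq_cscale)

lemma cinner_minus_right [simp]: "cinner v (- u) = - cinner v u"
  by (simp add: uminus_eq_cscale)

lemma cinner_diff_left: "cinner (u - u') v = cinner u v - cinner u' v"
  using cinner_add_left[of u "- u'" v] by simp

lemma cinner_diff_right: "cinner v (u - u') = cinner v u - cinner v u'"
  using cinner_add_right[of v u "- u'"] by simp

lemma cinner_zero_left [simp]: "cinner 0 v = 0" and hin_zero_right [simp]: "cinner v 0 = 0"
  using cinner_scaleR_left[of 0 0 v] cinner_scaleR_right[of v 0 0] by auto

lemma cinner_sum_left: "cinner (sum f S) v = (\<Sum>i\<in>S. cinner (f i) v)"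
  by (induction S rule: infinite_finite_induct) (auto simp: cinner_add_left)

lemma cinner_sum_right: "cinner v (sum f S) = (\<Sum>i\<in>S. cinner v (f i))"
  by (induction S rule: infinite_finite_induct) (auto simp: cinner_add_right)

lemma cinner_self: "cinner u u = complex_of_real ((norm u)\<^sup>2)"
proof -
  have "Im (cinner u u) = 0" using cnj_cinner[of u u] by (simp add: complex_eq_iff)
  moreover have "Re (cinner u u) = (norm u)\<^sup>2"
    by (simp add: power2_norm_eq_inner flip: inner_eq_cinner)
  ultimately show ?thesis by (simp add: complex_eq_iff)
qed

lemma norm_sq_eq: "(norm u)\<^sup>2 = (\<integral>x. (cmod (rep_l2 u x))\<^sup>2 \<partial>lborel)"
proof -
  have "complex_of_real ((norm u)\<^sup>2) = complex_of_real (\<integral>x. (cmod (rep_l2 u x))\<^sup>2 \<partial>lborel)"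
    unfolding cinner_self[symmetric] cinner_def
    by (simp add: complex_norm_square[symmetric] flip: integral_complex_of_real)
  then show ?thesis by (simp only: of_real_eq_iff)
qed

lemma norm_cscale [simp]: "norm (cscale c u) = cmod c * norm u"
proof -
  have "complex_of_real ((norm (cscale c u))\<^sup>2) = complex_of_real ((cmod c * norm u)\<^sup>2)"
    by (simp add: cinner_self[symmetric]  power_mult_distrib complex_norm_square mult_ac  del: of_real_power)
  then have "(norm (cscale c u))\<^sup>2 = (cmod c * norm u)\<^sup>2" by (simp only: of_real_eq_iff)
  then show ?thesis by (simp add: power2_eq_iff_nonneg)
qed

lemma norm_cinner_le: "cmod (cinner u v) \<le> norm u * norm v"
proof (cases "cinner u v = 0")
  case False
  \<comment> \<open>The phase that rotates the pairing onto the positive axis, where the real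
    Cauchy-Schwarz inequality applies.\<close>
  define c where "c = cnj (cinner u v) / cmod (cinner u v)"
  have "cmod c = 1" using False by (simp add: c_def norm_divide)
  have "c * cinner u v = cmod (cinner u v)"
    using False unfolding c_def by (simp add: complex_norm_square[symmetric] mult.commute[of "cnj _"] power2_eq_square)
  then have "cmod (cinner u v) = inner (cscale c u) v" by (simp add: inner_eq_cinner)
  also have "\<dots> \<le> norm (cscale c u) * norm v" by (rule norm_cauchy_schwarz)
  finally show ?thesis using \<open>cmod c = 1\<close> by simp
qed auto

lemma bounded_linear_cinner_left: "bounded_linear (\<lambda>u. cinner u v)"
  by (rule bounded_linear_intro[where K = "norm v"])
     (auto simp: cinner_add_left cinner_scaleR_left norm_cinner_le scaleR_conv_of_real)

lemmas tendsto_cinner_left = bounded_linear.tendsto[OF bounded_linear_cinner_left]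
lemmas tendsto_cscale = bounded_linear.tendsto[OF bounded_linear_cscale]

section \<open>Completeness of L^2\<close>

lemma nn_integral_rep: "(\<integral>\<^sup>+x. ennreal ((cmod (rep_l2 u x))\<^sup>2) \<partial>lborel) = ennreal ((norm u)\<^sup>2)"
  unfolding norm_sq_eq by (rule nn_integral_eq_integral[OF integrable_rep]) auto

lemma nn_integral_rep_diff:
  "(\<integral>\<^sup>+x. ennreal ((cmod (rep_l2 u x - rep_l2 v x))\<^sup>2) \<partial>lborel) = ennreal ((norm (u - v))\<^sup>2)"
  unfolding nn_integral_rep[symmetric]
  by (rule nn_integral_cong_AE, use rep_diff[of u v] in eventually_elim) simp

text \<open>Riesz-Fischer. The squared increments have integrals at most \<open>(1/4)^n\<close>, so
  their series still has finite integral when weighted by \<open>2^n\<close>. Where the weighted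
  series is finite, the increments are of size \<open>(1 / sqrt 2)^n\<close> and hence summable.
  Fatou's lemma then bounds the distance to the pointwise limit.\<close>

lemma fast_Cauchy_l2_converges:
  fixes f :: "nat \<Rightarrow> l2"
  assumes fast: "\<And>n. norm (f (Suc n) - f n) \<le> (1/2) ^ n"
  shows "convergent f"
proof -
  define d where "d n x = cmod (rep_l2 (f (Suc n)) x - rep_l2 (f n) x)" for n x
  have [measurable]: "d n \<in> borel_measurable borel" for n
    unfolding d_def by measurable
  have d_int: "(\<integral>\<^sup>+x. ennreal ((d n x)\<^sup>2) \<partial>lborel) \<le> ennreal ((1/4)^n)" for n
  proof -
    have "(\<integral>\<^sup>+x. ennreal ((d n x)\<^sup>2) \<partial>lborel) = ennreal ((norm (f (Suc n) - f n))\<^sup>2)"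
      unfolding d_def by (rule nn_integral_rep_diff)
    also have "\<dots> \<le> ennreal (((1/2) ^ n)\<^sup>2)" by (intro ennreal_leI power_mono fast) auto
    also have "((1/2::real) ^ n)\<^sup>2 = (1/4)^n" by (simp add: power2_eq_square flip: power_mult_distrib)
    finally show ?thesis .
  qed
  have "(\<integral>\<^sup>+x. (\<Sum>n. ennreal (2^n * (d n x)\<^sup>2)) \<partial>lborel) = (\<Sum>n. \<integral>\<^sup>+x. ennreal (2^n * (d n x)\<^sup>2) \<partial>lborel)"
    by (rule nn_integral_suminf) measurable
  also have "\<dots> \<le> (\<Sum>n. ennreal ((1/2)^n))"
  proof (intro suminf_le allI summableI)
    fix n
    have "(\<integral>\<^sup>+x. ennreal (2^n * (d n x)\<^sup>2) \<partial>lborel) = ennreal (2^n) * (\<integral>\<^sup>+x. ennreal ((d n x)\<^sup>2) \<partial>lborel)"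
      by (subst nn_integral_cmult[symmetric]) (auto simp: ennreal_mult)
    also have "\<dots> \<le> ennreal (2^n) * ennreal ((1/4)^n)" by (intro mult_left_mono d_int) auto
    also have "\<dots> = ennreal ((1/2)^n)" by (simp add: ennreal_mult[symmetric] power_mult_distrib[symmetric])
    finally show "(\<integral>\<^sup>+x. ennreal (2^n * (d n x)\<^sup>2) \<partial>lborel) \<le> ennreal ((1/2)^n)" .
  qed
  also have "\<dots> = ennreal (\<Sum>n. (1/2)^n)" by (rule suminf_ennreal2) (auto intro: summable_geometric)
  also have "\<dots> < \<infinity>" by simp
  finally have "AE x in lborel. (\<Sum>n. ennreal (2^n * (d n x)\<^sup>2)) \<noteq> \<infinity>"
    by (intro nn_integral_PInf_AE) auto
  then have conv: "AE x in lborel. convergent (\<lambda>n. rep_l2 (f n) x)"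
  proof eventually_elim
    fix x assume "(\<Sum>n. ennreal (2^n * (d n x)\<^sup>2)) \<noteq> \<infinity>"
    then have sm: "summable (\<lambda>n. 2^n * (d n x)\<^sup>2)"
      by (intro summable_suminf_not_top) auto
    then obtain C where C: "\<And>n. 2^n * (d n x)\<^sup>2 \<le> C"
      using summable_imp_bounded[OF sm] by (auto simp: Bseq_def bounded_iff)
    have "0 \<le> 2 ^ 0 * (d 0 x)\<^sup>2" by simp
    then have "C \<ge> 0" using C[of 0] by linarith
    have "d n x \<le> sqrt C * (1 / sqrt 2) ^ n" for n
    proof -
      have "(d n x)\<^sup>2 \<le> C * (1/2)^n" using C[of n] by (simp add: field_simps power_divide)
      also have "(1/2::real) ^ n = ((1 / sqrt 2)\<^sup>2) ^ n" by (simp add: power_divide)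
      also have "\<dots> = ((1 / sqrt 2) ^ n)\<^sup>2" by (simp only: power_mult[symmetric] mult.commute)
      also have "C * \<dots> = (sqrt C * (1 / sqrt 2) ^ n)\<^sup>2"
        using \<open>C \<ge> 0\<close> by (simp add: power_mult_distrib)
      finally show ?thesis by (rule power2_le_imp_le) (use \<open>C \<ge> 0\<close> in auto)
    qed
    moreover have geom: "summable (\<lambda>n. sqrt C * (1 / sqrt 2) ^ n)"
      by (intro summable_mult summable_geometric) auto
    ultimately have "summable (\<lambda>n. rep_l2 (f (Suc n)) x - rep_l2 (f n) x)"
      by (intro summable_comparison_test'[OF geom, of 0]) (simp add: d_def)
    then have "convergent (\<lambda>n. \<Sum>i<n. rep_l2 (f (Suc i)) x - rep_l2 (f i) x)"
      by (simp add: summable_iff_convergent)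
    then have "convergent (\<lambda>n. rep_l2 (f n) x - rep_l2 (f 0) x)"
      using sum_lessThan_telescope[of "\<lambda>i. rep_l2 (f i) x"] by simp
    then show "convergent (\<lambda>n. rep_l2 (f n) x)"
      using convergent_add[OF _ convergent_const[of "rep_l2 (f 0) x"], of "\<lambda>n. rep_l2 (f n) x - rep_l2 (f 0) x"] by simp
  qed
  define F where "F x = lim (\<lambda>n. rep_l2 (f n) x)" for x
  have [measurable]: "F \<in> borel_measurable borel"
    unfolding F_def by (rule borel_measurable_lim_metric) auto
  have dist_bound: "norm (f m - f n) \<le> 2 * (1/2)^n" if "n \<le> m" for m n
  proof -
    have "norm (f m - f n) \<le> 2 * (1/2)^n - 2 * (1/2)^m"
      using that
    proof (induction m rule: dec_induct)
      case (step m)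
      then show ?case using norm_triangle_ineq[of "f (Suc m) - f m" "f m - f n"] fast[of m] by simp
    qed auto
    moreover have "0 \<le> 2 * (1/2::real)^m" by simp
    ultimately show ?thesis by linarith
  qed
  let ?e = "\<lambda>h n x. ennreal ((cmod (h x - rep_l2 (f n) x))\<^sup>2)"
  have Fn: "(\<integral>\<^sup>+x. ?e F n x \<partial>lborel) \<le> ennreal ((2 * (1/2)^n)\<^sup>2)" for n
  proof -
    have "(\<integral>\<^sup>+x. ?e F n x \<partial>lborel) = (\<integral>\<^sup>+x. liminf (\<lambda>m. ?e (rep_l2 (f m)) n x) \<partial>lborel)"
    proof (rule nn_integral_cong_AE, use conv in eventually_elim)
      fix x assume "convergent (\<lambda>n. rep_l2 (f n) x)"
      then have "(\<lambda>m. rep_l2 (f m) x) \<longlonglongrightarrow> F x" unfolding F_def by (simp add: convergent_LIMSEQ_iff)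
      then have "(\<lambda>m. ?e (rep_l2 (f m)) n x) \<longlonglongrightarrow> ?e F n x"
        by (intro tendsto_intros)
      then show "?e F n x = liminf (\<lambda>m. ?e (rep_l2 (f m)) n x)"
        by (rule lim_imp_Liminf[OF sequentially_bot, symmetric])
    qed
    also have "\<dots> \<le> liminf (\<lambda>m. \<integral>\<^sup>+x. ?e (rep_l2 (f m)) n x \<partial>lborel)"
      by (rule nn_integral_liminf) measurable
    also have "\<dots> \<le> liminf (\<lambda>m. ennreal ((2 * (1/2)^n)\<^sup>2))"
      unfolding nn_integral_rep_diff
      by (rule Liminf_mono, rule eventually_sequentiallyI[of n]) (intro ennreal_leI power_mono dist_bound; simp)
    also have "\<dots> = ennreal ((2 * (1/2)^n)\<^sup>2)" by (simp add: Liminf_const)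
    finally show ?thesis .
  qed
  have si: "square_integrable (\<lambda>x. F x - rep_l2 (f n) x)" for n
    unfolding square_integrable_def using le_less_trans[OF Fn[of n] ennreal_less_top]
    by (auto intro!: integrableI_bounded)
  have "square_integrable F"
    using square_integrable_add[OF si[of 0] square_integrable_rep[of "f 0"]] by simp
  have "norm (abs_l2 F - f n) \<le> 2 * (1/2)^n" for n
  proof -
    have "ennreal ((norm (abs_l2 F - f n))\<^sup>2) = (\<integral>\<^sup>+x. ?e F n x \<partial>lborel)"
      unfolding nn_integral_rep_diff[symmetric]
      by (rule nn_integral_cong_AE) (use rep_abs_AE[OF \<open>square_integrable F\<close>] in eventually_elim, simp)
    then have "ennreal ((norm (abs_l2 F - f n))\<^sup>2) \<le> ennreal ((2 * (1/2)^n)\<^sup>2)" using Fn[of n] by simp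
    then have "(norm (abs_l2 F - f n))\<^sup>2 \<le> (2 * (1/2)^n)\<^sup>2" by (subst (asm) ennreal_le_iff) auto
    then show ?thesis by (rule power2_le_imp_le) auto
  qed
  moreover have "(\<lambda>n. 2 * (1/2::real)^n) \<longlonglongrightarrow> 0"
    using tendsto_mult_right_zero[OF LIMSEQ_power_zero[of "1/2::real"]] by simp
  ultimately have "(\<lambda>n. f n - abs_l2 F) \<longlonglongrightarrow> 0"
    by (intro Lim_null_comparison[of "\<lambda>n. f n - abs_l2 F" "\<lambda>n. 2 * (1/2)^n"]) (auto simp: norm_minus_commute)
  then have "f \<longlonglongrightarrow> abs_l2 F" by (rule LIM_zero_cancel)
  then show ?thesis by (rule convergentI)
qed

instance l2 :: banach
proof
  fix X :: "nat \<Rightarrow> l2" assume "Cauchy X"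
  have "\<exists>N. \<forall>m\<ge>N. \<forall>n\<ge>N. norm (X m - X n) < (1/2)^k" for k
    using CauchyD[OF \<open>Cauchy X\<close>, of "(1/2)^k"] by auto
  then obtain N where N: "\<And>k m n. m \<ge> N k \<Longrightarrow> n \<ge> N k \<Longrightarrow> norm (X m - X n) < (1/2)^k"
    by metis
  \<comment> \<open>Strictly increasing and beyond every \<open>N k\<close>, so that consecutive
    terms of the subsequence are \<open>(1/2)^k\<close>-close.\<close>
  define r where "r = rec_nat (N 0) (\<lambda>k rk. max (Suc rk) (N (Suc k)))"
  have r_Suc: "r (Suc k) = max (Suc (r k)) (N (Suc k))" for k by (simp add: r_def)
  have r0: "r 0 = N 0" by (simp add: r_def)
  have "strict_mono r" unfolding strict_mono_Suc_iff by (simp add: r_Suc less_max_iff_disj)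
  have rN: "r k \<ge> N k" for k by (cases k) (auto simp: r0 r_Suc)
  have "convergent (X \<circ> r)"
  proof (rule fast_Cauchy_l2_converges)
    fix k
    have "r (Suc k) \<ge> N k" using rN[of k] by (simp add: r_Suc le_max_iff_disj)
    then show "norm ((X \<circ> r) (Suc k) - (X \<circ> r) k) \<le> (1/2)^k"
      using N[of k "r (Suc k)" "r k"] rN[of k] by (simp add: less_imp_le)
  qed
  then obtain l where "(X \<circ> r) \<longlonglongrightarrow> l" by (auto simp: convergent_def)
  then have "X \<longlonglongrightarrow> l"
    by (rule Cauchy_converges_subseq[OF \<open>Cauchy X\<close> \<open>strict_mono r\<close>])
  then show "convergent X" by (auto simp: convergent_def)
qed

text \<open>Multiplication operators act pointwise, so identifying limits of their values needs
  almost everywhere convergence. The squared distances tend to 0 in L^1, which yields such a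
  subsequence.\<close>

lemma tendsto_l2_AE_subseq:
  assumes "u \<longlonglongrightarrow> (v::l2)"
  shows "\<exists>r. strict_mono r \<and> (AE x in lborel. (\<lambda>n. rep_l2 (u (r n)) x) \<longlonglongrightarrow> rep_l2 v x)"
proof -
  have "\<exists>r. strict_mono r \<and> (AE x in lborel. (\<lambda>n. (cmod (rep_l2 (u (r n) - v) x))\<^sup>2) \<longlonglongrightarrow> 0)"
  proof (rule tendsto_L1_AE_subseq)
    show "integrable lborel (\<lambda>x. (cmod (rep_l2 (u n - v) x))\<^sup>2)" for n by (rule integrable_rep)
    have "(\<lambda>n. (norm (u n - v))\<^sup>2) \<longlonglongrightarrow> 0\<^sup>2"
      by (intro tendsto_intros tendsto_norm_zero) (rule LIM_zero[OF assms])
    then show "(\<lambda>n. \<integral>x. norm ((cmod (rep_l2 (u n - v) x))\<^sup>2) \<partial>lborel) \<longlonglongrightarrow> 0"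
      by (simp add: norm_sq_eq)
  qed
  then obtain r where "strict_mono r"
    and r: "AE x in lborel. (\<lambda>n. (cmod (rep_l2 (u (r n) - v) x))\<^sup>2) \<longlonglongrightarrow> 0" by blast
  have "AE x in lborel. \<forall>n. rep_l2 (u (r n) - v) x = rep_l2 (u (r n)) x - rep_l2 v x"
    by (subst AE_all_countable) (use rep_diff in blast)
  with r have "AE x in lborel. (\<lambda>n. rep_l2 (u (r n)) x) \<longlonglongrightarrow> rep_l2 v x"
  proof eventually_elim
    fix x assume a: "(\<lambda>n. (cmod (rep_l2 (u (r n) - v) x))\<^sup>2) \<longlonglongrightarrow> 0"
      and b: "\<forall>n. rep_l2 (u (r n) - v) x = rep_l2 (u (r n)) x - rep_l2 v x"
    have "(\<lambda>n. sqrt ((cmod (rep_l2 (u (r n) - v) x))\<^sup>2)) \<longlonglongrightarrow> sqrt 0" by (intro tendsto_intros a)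
    then have "(\<lambda>n. rep_l2 (u (r n)) x - rep_l2 v x) \<longlonglongrightarrow> 0"
      using b by (simp add: tendsto_norm_zero_iff)
    then show "(\<lambda>n. rep_l2 (u (r n)) x) \<longlonglongrightarrow> rep_l2 v x" by (rule LIM_zero_cancel)
  qed
  with \<open>strict_mono r\<close> show ?thesis by blast
qed

section \<open>Orthogonality and density\<close>

lemma exists_orthogonal_to_closed_subspace:
  fixes S :: "'a::{real_inner, banach} set"
  assumes "subspace S" "closed S" "x \<notin> S"
  shows "\<exists>v. v \<noteq> 0 \<and> (\<forall>s\<in>S. inner v s = 0)"
proof -
  define d where "d = infdist x S"
  have "S \<noteq> {}" using subspace_0[OF assms(1)] by auto
  have dle: "d \<le> norm (x - s)" if "s \<in> S" for s
    unfolding d_def using infdist_le[OF that, of x] by (simp add: dist_norm)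
  have "d \<ge> 0" by (simp add: d_def infdist_nonneg)
  \<comment> \<open>Parallelogram law: the midpoint lies in \<open>S\<close>, hence at distance at
    least \<open>d\<close> from \<open>x\<close>. This makes every minimising sequence
    Cauchy.\<close>
  have para: "(norm (s - t))\<^sup>2 \<le> 2 * (norm (x - s))\<^sup>2 + 2 * (norm (x - t))\<^sup>2 - 4 * d\<^sup>2" if "s \<in> S" "t \<in> S" for s t
  proof -
    have "(1/2) *\<^sub>R (s + t) \<in> S" using that assms(1) by (simp add: subspace_scale subspace_add)
    then have "d\<^sup>2 \<le> (norm (x - (1/2) *\<^sub>R (s + t)))\<^sup>2" using dle \<open>d \<ge> 0\<close> by (intro power_mono) auto
    moreover have "(norm (s - t))\<^sup>2 = 2 * (norm (x - s))\<^sup>2 + 2 * (norm (x - t))\<^sup>2 - 4 * (norm (x - (1/2) *\<^sub>R (s + t)))\<^sup>2"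
      by (simp add: power2_norm_eq_inner inner_diff inner_add inner_commute algebra_simps)
    ultimately show ?thesis by linarith
  qed
  have "\<exists>s\<in>S. (norm (x - s))\<^sup>2 < d\<^sup>2 + 1 / Suc n" for n
  proof -
    have "d < sqrt (d\<^sup>2 + 1 / Suc n)" by (rule real_less_rsqrt) simp
    then obtain s where "s \<in> S" "dist x s < sqrt (d\<^sup>2 + 1 / Suc n)"
      unfolding d_def infdist_notempty[OF \<open>S \<noteq> {}\<close>]
      by (subst (asm) cINF_less_iff) (use \<open>S \<noteq> {}\<close> in \<open>auto intro: bdd_belowI[of _ 0]\<close>)
    then have "(norm (x - s))\<^sup>2 < (sqrt (d\<^sup>2 + 1 / Suc n))\<^sup>2"
      by (intro power_strict_mono) (auto simp: dist_norm)
    then show ?thesis using \<open>s \<in> S\<close> by (auto simp: add_nonneg_nonneg)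
  qed
  then obtain s where s: "\<And>n. s n \<in> S" "\<And>n. (norm (x - s n))\<^sup>2 < d\<^sup>2 + 1 / Suc n" by metis
  have "Cauchy s"
  proof (rule metric_CauchyI)
    fix e :: real assume "e > 0"
    obtain N :: nat where "4 / e\<^sup>2 < N" using reals_Archimedean2 by blast
    moreover have "4 / e\<^sup>2 > 0" using \<open>e > 0\<close> by simp
    ultimately have "real N > 0" by linarith
    then have N: "N > 0" "4 / real N < e\<^sup>2"
      using \<open>4 / e\<^sup>2 < N\<close> \<open>e > 0\<close> by (auto simp: field_simps)
    have "dist (s m) (s n) < e" if "m \<ge> N" "n \<ge> N" for m n
    proof -
      have "1 / Suc m \<le> 1 / N" "1 / Suc n \<le> 1 / N" using that N by (auto intro!: divide_left_mono)
      then have "(norm (s m - s n))\<^sup>2 < 4 / N"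
        using para[OF s(1)[of m] s(1)[of n]] s(2)[of m] s(2)[of n] by linarith
      then have "(norm (s m - s n))\<^sup>2 < e\<^sup>2" using N by linarith
      then show ?thesis using \<open>e > 0\<close> by (auto simp: dist_norm intro: power2_less_imp_less)
    qed
    then show "\<exists>N. \<forall>m\<ge>N. \<forall>n\<ge>N. dist (s m) (s n) < e" by blast
  qed
  then obtain p where p: "s \<longlonglongrightarrow> p" using Cauchy_convergent_iff convergent_def by blast
  have "p \<in> S" using closed_sequentially[OF assms(2) _ p] s(1) by blast
  have "(norm (x - p))\<^sup>2 \<le> d\<^sup>2"
  proof (rule LIMSEQ_le)
    show "(\<lambda>n. (norm (x - s n))\<^sup>2) \<longlonglongrightarrow> (norm (x - p))\<^sup>2" by (intro tendsto_intros p)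
    show "(\<lambda>n. d\<^sup>2 + 1 / Suc n) \<longlonglongrightarrow> d\<^sup>2"
      using tendsto_add[OF tendsto_const LIMSEQ_inverse_real_of_nat, of "d\<^sup>2"] by (simp add: inverse_eq_divide)
  qed (use s(2) less_imp_le in blast)
  define v where "v = x - p"
  have "inner v t = 0" if "t \<in> S" for t
  proof (cases "t = 0")
    case False
    \<comment> \<open>The minimiser of the norm of \<open>v - a *\<^sub>R t\<close>; a non-zero
      inner product would bring the distance to \<open>S\<close> below \<open>d\<close>.\<close>
    define a where "a = inner v t / (norm t)\<^sup>2"
    have "p + a *\<^sub>R t \<in> S" using \<open>p \<in> S\<close> that assms(1) by (simp add: subspace_scale subspace_add)
    then have "d\<^sup>2 \<le> (norm (x - (p + a *\<^sub>R t)))\<^sup>2" using dle \<open>d \<ge> 0\<close> by (intro power_mono) auto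
    also have "x - (p + a *\<^sub>R t) = v - a *\<^sub>R t" by (simp add: v_def)
    also have "(norm (v - a *\<^sub>R t))\<^sup>2 = (norm v)\<^sup>2 - 2 * a * inner v t + a\<^sup>2 * (norm t)\<^sup>2"
      unfolding power2_norm_eq_inner by (simp add: inner_diff inner_commute algebra_simps power2_eq_square[of a])
    also have "\<dots> = (norm v)\<^sup>2 - (inner v t)\<^sup>2 / (norm t)\<^sup>2"
      using False by (simp add: a_def power2_eq_square field_simps)
    finally have "(inner v t)\<^sup>2 / (norm t)\<^sup>2 \<le> 0" using \<open>(norm (x - p))\<^sup>2 \<le> d\<^sup>2\<close> by (simp add: v_def)
    then show ?thesis using False by (simp add: divide_le_0_iff)
  qed simp
  moreover have "v \<noteq> 0" using \<open>p \<in> S\<close> assms(3) by (auto simp: v_def)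
  ultimately show ?thesis by blast
qed

lemma subspace_closure:
  fixes S :: "'a::real_normed_vector set"
  assumes "subspace S"
  shows "subspace (closure S)"
  unfolding subspace_def
proof (intro conjI ballI allI)
  show "0 \<in> closure S" using subspace_0[OF assms] closure_subset by blast
next
  fix x y assume "x \<in> closure S" "y \<in> closure S"
  then obtain f g where "\<And>n. f n \<in> S" "f \<longlonglongrightarrow> x" "\<And>n. g n \<in> S" "g \<longlonglongrightarrow> y"
    unfolding closure_sequential by metis
  then show "x + y \<in> closure S" unfolding closure_sequential
    by (intro exI[of _ "\<lambda>n. f n + g n"]) (auto intro: tendsto_add subspace_add[OF assms])
next
  fix c x assume "x \<in> closure S"
  then obtain f where "\<And>n. f n \<in> S" "f \<longlonglongrightarrow> x" unfolding closure_sequential by metis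
  then show "c *\<^sub>R x \<in> closure S" unfolding closure_sequential
    by (intro exI[of _ "\<lambda>n. c *\<^sub>R f n"]) (auto intro: tendsto_scaleR subspace_scale[OF assms])
qed

text \<open>Span and inner product are the real ones; a complex span is obtained by putting all
  complex multiples into \<open>S\<close>.\<close>

lemma dense_span_if_no_orthogonal:
  fixes S :: "'a::{real_inner, banach} set"
  assumes "\<And>v. (\<And>s. s \<in> S \<Longrightarrow> inner v s = 0) \<Longrightarrow> v = 0"
  shows "closure (span S) = UNIV"
proof (rule ccontr)
  assume "closure (span S) \<noteq> UNIV"
  then obtain x where "x \<notin> closure (span S)" by auto
  then obtain v where "v \<noteq> 0" "\<forall>s\<in>closure (span S). inner v s = 0"
    using exists_orthogonal_to_closed_subspace[of "closure (span S)" x]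
      subspace_closure[OF subspace_span] by auto
  then show False using assms[of v] by (meson closure_subset span_superset subsetD)
qed

section \<open>Functions with vanishing moments\<close>

lemma exp_partial_sum_le:
  fixes y :: real
  assumes "y \<ge> 0" "finite I"
  shows "(\<Sum>i\<in>I. y ^ i /\<^sub>R fact i) \<le> exp y"
  unfolding exp_def using assms by (intro sum_le_suminf summable_exp_generic) auto

text \<open>The Fourier transform of $w$ has a vanishing power series, so the positive and negative parts of $w$
  define, after normalisation, probability measures with the same characteristic function.\<close>

lemma moments_zero_imp_AE_zero:
  fixes w :: "real \<Rightarrow> real"
  assumes exp_int: "\<And>t. integrable lborel (\<lambda>x. exp (t * \<bar>x\<bar>) * w x)"
    and moments: "\<And>n. (\<integral>x. x ^ n * w x \<partial>lborel) = 0"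
  shows "AE x in lborel. w x = 0"
proof -
  have int_w: "integrable lborel w" using exp_int[of 0] by simp
  then have [measurable]: "w \<in> borel_measurable borel" by auto
  define wp where "wp x = max 0 (w x)" for x
  define wm where "wm x = max 0 (- w x)" for x
  have [measurable]: "wp \<in> borel_measurable borel" "wm \<in> borel_measurable borel"
    unfolding wp_def wm_def by measurable
  have ip: "integrable lborel wp" and im: "integrable lborel wm"
    using int_w by (auto simp: wp_def[abs_def] wm_def[abs_def])
  have nn: "wp x \<ge> 0" "wm x \<ge> 0" and w_eq: "w x = wp x - wm x" for x by (auto simp: wp_def wm_def)
  define m where "m = (\<integral>x. wp x \<partial>lborel)"
  have "(\<integral>x. wp x \<partial>lborel) - (\<integral>x. wm x \<partial>lborel) = (\<integral>x. w x \<partial>lborel)"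
    using ip im by (simp add: w_eq)
  then have m': "(\<integral>x. wm x \<partial>lborel) = m" using moments[of 0] by (simp add: m_def)
  show ?thesis
  proof (cases "m = 0")
    \<comment> \<open>Zero mass cannot be normalised, but then both parts vanish almost
      everywhere.\<close>
    case True
    then have "AE x in lborel. wp x = 0" "AE x in lborel. wm x = 0"
      using m' integral_nonneg_eq_0_iff_AE[OF ip] integral_nonneg_eq_0_iff_AE[OF im] nn
      by (simp_all add: m_def)
    then show ?thesis by eventually_elim (simp add: w_eq)
  next
    case False
    then have "m > 0" using nn by (simp add: m_def integral_nonneg_AE less_le)
    have fourier: "(CLINT x|lborel. complex_of_real (w x) * iexp (t * x)) = 0" for t
    proof -
      let ?s = "\<lambda>n x. complex_of_real (w x) * ((\<i> * of_real (t * x)) ^ n /\<^sub>R fact n)"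
      define s where "s N x = complex_of_real (w x) * (\<Sum>n<N. (\<i> * of_real (t * x)) ^ n /\<^sub>R fact n)" for N x
      have term_int: "integrable lborel (?s n)" and term_zero: "(CLINT x|lborel. ?s n x) = 0" for n
      proof -
        have "integrable lborel (\<lambda>x. x ^ n * w x)"
        proof (rule Bochner_Integration.integrable_bound)
          show "integrable lborel (\<lambda>x. fact n * (exp (1 * \<bar>x\<bar>) * w x))" by (intro integrable_mult_right exp_int)
          have "\<bar>x ^ n * w x\<bar> \<le> fact n * (exp \<bar>x\<bar> * \<bar>w x\<bar>)" for x
          proof -
            have "\<bar>x\<bar> ^ n / fact n \<le> exp \<bar>x\<bar>"
              using exp_partial_sum_le[of "\<bar>x\<bar>" "{n}"] by (simp add: divide_inverse mult.commute)
            then have "\<bar>x\<bar> ^ n \<le> fact n * exp \<bar>x\<bar>" by (simp add: field_simps)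
            then have "\<bar>x\<bar> ^ n * \<bar>w x\<bar> \<le> fact n * exp \<bar>x\<bar> * \<bar>w x\<bar>" by (rule mult_right_mono) simp
            then show ?thesis by (simp add: abs_mult power_abs mult.assoc)
          qed
          then show "AE x in lborel. norm (x ^ n * w x) \<le> norm (fact n * (exp (1 * \<bar>x\<bar>) * w x))"
            by (simp add: abs_mult)
        qed measurable
        then have 1: "integrable lborel (\<lambda>x. complex_of_real (x ^ n * w x))" by (rule integrable_of_real)
        have eq: "?s n x
            = ((\<i> * of_real t) ^ n / fact n) * complex_of_real (x ^ n * w x)" for x
          by (simp add: power_mult_distrib scaleR_conv_of_real field_simps)
        show "integrable lborel (?s n)"
          unfolding eq by (intro integrable_mult_right 1)
        show "(CLINT x|lborel. ?s n x) = 0"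
          unfolding eq using moments[of n] by (simp only: integral_mult_right_zero integral_complex_of_real) simp
      qed
      have s_zero: "(CLINT x|lborel. s N x) = 0" for N
        unfolding s_def sum_distrib_left by (simp only: Bochner_Integration.integral_sum[OF term_int] term_zero) simp
      \<comment> \<open>The partial sums of the exponential series are dominated by
        \<open>exp (\<bar>t\<bar> * \<bar>x\<bar>)\<close>; integrability of \<open>w\<close>
        against all such exponentials justifies the exchange of limit and integral.\<close>
      have "(\<lambda>N. CLINT x|lborel. s N x) \<longlonglongrightarrow> (CLINT x|lborel. complex_of_real (w x) * iexp (t * x))"
      proof (rule integral_dominated_convergence)
        show "integrable lborel (\<lambda>x. norm (exp (\<bar>t\<bar> * \<bar>x\<bar>) * w x))" by (intro integrable_norm exp_int)
        show "AE x in lborel. (\<lambda>N. s N x) \<longlonglongrightarrow> complex_of_real (w x) * iexp (t * x)"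
        proof (intro AE_I2)
          fix x
          have "(\<lambda>N. \<Sum>n<N. (\<i> * of_real (t * x)) ^ n /\<^sub>R fact n) \<longlonglongrightarrow> exp (\<i> * of_real (t * x))"
            using exp_converges[of "\<i> * of_real (t * x)"] by (simp add: sums_def)
          then show "(\<lambda>N. s N x) \<longlonglongrightarrow> complex_of_real (w x) * iexp (t * x)"
            unfolding s_def by (intro tendsto_mult tendsto_const) simp
        qed
        show "AE x in lborel. norm (s N x) \<le> norm (exp (\<bar>t\<bar> * \<bar>x\<bar>) * w x)" for N
        proof (intro AE_I2)
          fix x
          have "norm (\<Sum>n<N. (\<i> * of_real (t * x)) ^ n /\<^sub>R fact n) \<le> (\<Sum>n<N. \<bar>t * x\<bar> ^ n /\<^sub>R fact n)"
            by (rule order_trans[OF norm_sum]) (simp add: norm_power norm_mult abs_mult)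
          also have "\<dots> \<le> exp \<bar>t * x\<bar>"
            by (rule exp_partial_sum_le) auto
          finally show "norm (s N x) \<le> norm (exp (\<bar>t\<bar> * \<bar>x\<bar>) * w x)"
            unfolding s_def by (simp add: norm_mult abs_mult mult.commute[of "\<bar>w x\<bar>"] mult_right_mono)
        qed
      qed (auto simp: s_def)
      then show ?thesis using s_zero by (simp add: LIMSEQ_const_iff)
    qed
    let ?D = "\<lambda>h. density lborel (\<lambda>x. ennreal (h x / m))"
    define Mp where "Mp = density lborel (\<lambda>x. ennreal (wp x / m))"
    define Mm where "Mm = density lborel (\<lambda>x. ennreal (wm x / m))"
    have distr: "real_distribution (?D h)"
      if "integrable lborel h" "\<And>x. h x \<ge> 0" "(\<integral>x. h x \<partial>lborel) = m" for h
    proof (rule real_distribution.intro)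
      have [measurable]: "h \<in> borel_measurable borel" using that(1) by auto
      show "prob_space (?D h)"
      proof
        have "emeasure (?D h) UNIV = (\<integral>\<^sup>+x. ennreal (h x / m) \<partial>lborel)"
          by (subst emeasure_density) auto
        also have "\<dots> = ennreal (\<integral>x. h x / m \<partial>lborel)"
          by (rule nn_integral_eq_integral) (use that \<open>m > 0\<close> in auto)
        also have "(\<integral>x. h x / m \<partial>lborel) = 1" using that(3) \<open>m > 0\<close> by simp
        finally show "emeasure (?D h) (space (?D h)) = 1" by simp
      qed
      show "real_distribution_axioms (?D h)"
        by (rule real_distribution_axioms.intro) auto
    qed
    have char_eq: "char (?D h) t = (CLINT x|lborel. complex_of_real (h x) * iexp (t * x)) / m"
      if "integrable lborel h" "\<And>x. h x \<ge> 0" for h t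
    proof -
      have [measurable]: "h \<in> borel_measurable borel" using that(1) by auto
      have "char (?D h) t = (CLINT x|lborel. (h x / m) *\<^sub>R iexp (t * x))"
        unfolding char_def by (rule integral_density) (use that \<open>m > 0\<close> in auto)
      also have "\<dots> = (CLINT x|lborel. (complex_of_real (h x) * iexp (t * x)) / m)"
        by (intro Bochner_Integration.integral_cong) (auto simp: scaleR_conv_of_real)
      finally show ?thesis by simp
    qed
    have int_exp: "integrable lborel (\<lambda>x. complex_of_real (h x) * iexp (t * x))" if "integrable lborel h" for h t
    proof (rule Bochner_Integration.integrable_bound[OF that])
      have [measurable]: "h \<in> borel_measurable borel" using that(1) by auto
      show "(\<lambda>x. complex_of_real (h x) * iexp (t * x)) \<in> borel_measurable lborel" by measurable
    qed (auto simp: norm_mult)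
    have "char Mp = char Mm"
    proof
      fix t
      let ?F = "\<lambda>h. CLINT x|lborel. complex_of_real (h x) * iexp (t * x)"
      have "?F wp - ?F wm
        = ?F w"
        by (subst Bochner_Integration.integral_diff[symmetric]) (use int_exp[OF ip] int_exp[OF im] in \<open>auto simp: w_eq left_diff_distrib\<close>)
      then show "char Mp t = char Mm t"
        unfolding Mp_def Mm_def using char_eq[OF ip nn(1)] char_eq[OF im nn(2)] fourier[of t] by simp
    qed
    then have "Mp = Mm"
      unfolding Mp_def Mm_def by (intro Levy_uniqueness distr ip im nn m') (simp_all add: m_def)
    then have "AE x in lborel. ennreal (wp x / m) = ennreal (wm x / m)"
      unfolding Mp_def Mm_def by (intro sigma_finite_measure.density_unique[OF sigma_finite_lborel]) auto
    then show ?thesis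
    proof eventually_elim
      fix x assume "ennreal (wp x / m) = ennreal (wm x / m)"
      then have "wp x / m = wm x / m" using nn \<open>m > 0\<close> by (subst (asm) ennreal_inj) auto
      then show "w x = 0" using \<open>m > 0\<close> by (simp add: w_eq)
    qed
  qed
qed

section \<open>Polynomials times Gaussians\<close>

definition pgauss :: "complex poly \<Rightarrow> complex \<Rightarrow> real \<Rightarrow> complex" where
  "pgauss p b x = poly p (of_real x) * exp (- (of_real x)\<^sup>2 / 2 + b * of_real x)"

lemma continuous_on_pgauss: "continuous_on A (pgauss p b)"
  unfolding pgauss_def by (intro continuous_intros) auto

lemma measurable_pgauss [measurable]: "pgauss p b \<in> borel_measurable borel"
  by (rule borel_measurable_continuous_onI[OF continuous_on_pgauss])

lemma pgauss_add: "pgauss (p + q) b x = pgauss p b x + pgauss q b x"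
  and pgauss_smult: "pgauss (smult c p) b x = c * pgauss p b x"
  by (simp_all add: pgauss_def algebra_simps)

lemma poly_exp_bound: "\<exists>C k. C \<ge> 0 \<and> k \<ge> 0 \<and> (\<forall>x::real. cmod (poly p (of_real x)) \<le> C * exp (k * \<bar>x\<bar>))"
proof (induction p)
  case 0
  show ?case by (rule exI[of _ 0]) auto
next
  case (pCons a p)
  then obtain C k where Ck: "C \<ge> 0" "k \<ge> 0" "\<And>x::real. cmod (poly p (of_real x)) \<le> C * exp (k * \<bar>x\<bar>)" by blast
  have "cmod (poly (pCons a p) (of_real x)) \<le> (cmod a + C) * exp ((k + 1) * \<bar>x\<bar>)" for x :: real
  proof -
    have "cmod (poly (pCons a p) (of_real x)) \<le> cmod a + \<bar>x\<bar> * cmod (poly p (of_real x))"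
      by (simp add: order_trans[OF norm_triangle_ineq] norm_mult)
    also have "\<dots> \<le> cmod a * exp ((k + 1) * \<bar>x\<bar>) + exp \<bar>x\<bar> * (C * exp (k * \<bar>x\<bar>))"
    proof (intro add_mono mult_mono Ck(3))
      show "cmod a \<le> cmod a * exp ((k + 1) * \<bar>x\<bar>)" using Ck(2) by (simp add: mult_le_cancel_left1)
      show "\<bar>x\<bar> \<le> exp \<bar>x\<bar>" by (rule order_trans[OF _ exp_ge_add_one_self]) simp
    qed auto
    also have "\<dots> = (cmod a + C) * exp ((k + 1) * \<bar>x\<bar>)" by (simp add: algebra_simps flip: exp_add)
    finally show ?thesis .
  qed
  then show ?case using Ck(1,2) by (intro exI[of _ "cmod a + C"] exI[of _ "k + 1"]) auto
qed

text \<open>Half of the exponent \<open>- x\<^sup>2 / 2\<close> absorbs every polynomial and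
  exponential factor, by completing the square; the other half keeps the product integrable. The
  factor \<open>exp (t * \<bar>x\<bar>)\<close> is carried along because the moment criterion asks
  for all exponential moments.\<close>

lemma pgauss_bound:
  "\<exists>C\<ge>0. \<forall>x. exp (t * \<bar>x\<bar>) * cmod (pgauss p b x) \<le> C * exp (- x\<^sup>2 / 4)"
proof -
  obtain C k where Ck: "C \<ge> 0" "k \<ge> 0" "\<And>x::real. cmod (poly p (of_real x)) \<le> C * exp (k * \<bar>x\<bar>)"
    using poly_exp_bound by blast
  \<comment> \<open>All linear rates together: of the polynomial, of the weight and of the
    prescribed exponential.\<close>
  define K where "K = k + \<bar>Re b\<bar> + \<bar>t\<bar>"
  have "exp (t * \<bar>x\<bar>) * cmod (pgauss p b x) \<le> (C * exp (K\<^sup>2)) * exp (- x\<^sup>2 / 4)" for x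
  proof -
    have "exp (t * \<bar>x\<bar>) * cmod (pgauss p b x) = exp (t * \<bar>x\<bar>) * cmod (poly p (of_real x)) * exp (- x\<^sup>2 / 2 + Re b * x)"
      by (simp add: pgauss_def norm_mult mult.assoc)
    also have "\<dots> \<le> exp (t * \<bar>x\<bar>) * (C * exp (k * \<bar>x\<bar>)) * exp (- x\<^sup>2 / 2 + Re b * x)"
      by (intro mult_mono Ck) (use Ck(1) in auto)
    also have "\<dots> = C * exp (t * \<bar>x\<bar> + k * \<bar>x\<bar> - x\<^sup>2 / 2 + Re b * x)"
      unfolding exp_add[symmetric] mult.assoc by (simp add: exp_add[symmetric] mult.left_commute[of _ C] algebra_simps)
    also have "t * \<bar>x\<bar> + k * \<bar>x\<bar> - x\<^sup>2 / 2 + Re b * x \<le> K * \<bar>x\<bar> - x\<^sup>2 / 2"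
    proof -
      have "t * \<bar>x\<bar> \<le> \<bar>t\<bar> * \<bar>x\<bar>" "Re b * x \<le> \<bar>Re b\<bar> * \<bar>x\<bar>"
        using abs_ge_self[of "Re b * x"] by (auto intro: mult_right_mono simp: abs_mult)
      then show ?thesis by (simp add: K_def algebra_simps)
    qed
    also have "K * \<bar>x\<bar> - x\<^sup>2 / 2 \<le> K\<^sup>2 + - x\<^sup>2 / 4"
      using zero_le_power2[of "\<bar>x\<bar> / 2 - K"] by (simp add: power2_diff power_divide field_simps)
    finally have *: "exp (t * \<bar>x\<bar>) * cmod (pgauss p b x) \<le> C * exp (K\<^sup>2 + - x\<^sup>2 / 4)"
      using Ck(1) by (simp add: mult_left_mono)
    then show ?thesis unfolding exp_add by (simp add: mult.assoc)
  qed
  then show ?thesis using Ck(1) by (intro exI[of _ "C * exp (K\<^sup>2)"]) auto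
qed

lemma integrable_gauss:
  assumes "s > 0"
  shows "integrable lborel (\<lambda>x. exp (- s * x\<^sup>2) :: real)"
proof -
  have "integrable lborel (\<lambda>x. sqrt (pi / s) * normal_density 0 (sqrt (1 / (2 * s))) x)"
    using integrable_normal_moment[of "sqrt (1 / (2 * s))" 0 0] assms by (intro integrable_mult_right) auto
  also have "(\<lambda>x. sqrt (pi / s) * normal_density 0 (sqrt (1 / (2 * s))) x) = (\<lambda>x. exp (- s * x\<^sup>2))"
    using assms by (intro ext) (simp add: normal_density_def power_divide real_sqrt_divide field_simps)
  finally show ?thesis .
qed

lemma square_integrable_exp_pgauss: "square_integrable (\<lambda>x. of_real (exp (t * \<bar>x\<bar>)) * pgauss p b x)"
proof -
  obtain C where C: "C \<ge> 0" "\<And>x. exp (t * \<bar>x\<bar>) * cmod (pgauss p b x) \<le> C * exp (- x\<^sup>2 / 4)" using pgauss_bound by blast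
  have "integrable lborel (\<lambda>x. (cmod (of_real (exp (t * \<bar>x\<bar>)) * pgauss p b x))\<^sup>2)"
  proof (rule Bochner_Integration.integrable_bound)
    show "integrable lborel (\<lambda>x. C\<^sup>2 * exp (- (1/2) * x\<^sup>2))" by (intro integrable_mult_right integrable_gauss) auto
    have "(cmod (of_real (exp (t * \<bar>x\<bar>)) * pgauss p b x))\<^sup>2 \<le> C\<^sup>2 * exp (- (1/2) * x\<^sup>2)" for x
    proof -
      have "(exp (t * \<bar>x\<bar>) * cmod (pgauss p b x))\<^sup>2 \<le> (C * exp (- x\<^sup>2 / 4))\<^sup>2" by (rule power_mono[OF C(2)]) simp
      also have "\<dots> = C\<^sup>2 * exp (- (1/2) * x\<^sup>2)" by (simp add: power_mult_distrib flip: exp_double)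
      finally show ?thesis by (simp add: norm_mult)
    qed
    then show "AE x in lborel. norm ((cmod (of_real (exp (t * \<bar>x\<bar>)) * pgauss p b x))\<^sup>2) \<le> norm (C\<^sup>2 * exp (- (1/2) * x\<^sup>2))"
      by simp
  qed measurable
  then show ?thesis unfolding square_integrable_def by simp
qed

lemma square_integrable_pgauss: "square_integrable (pgauss p b)"
  using square_integrable_exp_pgauss[of 0 p b] by simp

lemma pgauss_mult_rep_integrable: "integrable lborel (\<lambda>x. pgauss p b x * rep_l2 u x)"
proof -
  have "square_integrable (\<lambda>x. cnj (rep_l2 u x))"
    using square_integrable_rep[of u] unfolding square_integrable_def by simp
  from square_integrable_mult_cnj[OF square_integrable_pgauss this] show ?thesis by simp
qed

definition PG :: "complex poly \<Rightarrow> complex \<Rightarrow> l2" where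
  "PG p b = abs_l2 (pgauss p b)"

lemma PG_add: "PG (p + q) b = PG p b + PG q b"
  unfolding PG_def by (simp add: abs_add square_integrable_pgauss pgauss_add[abs_def])

lemma PG_smult: "PG (smult c p) b = cscale c (PG p b)"
  unfolding PG_def by (simp add: abs_cscale square_integrable_pgauss pgauss_smult[abs_def])

lemma PG_zero [simp]: "PG 0 b = 0"
  using PG_smult[of 0 0 b] by simp

lemma PG_minus: "PG (- p) b = - PG p b"
  using PG_smult[of "-1" p b] by (simp add: uminus_eq_cscale)

lemma PG_diff: "PG (p - q) b = PG p b - PG q b"
  using PG_add[of p "- q" b] by (simp add: PG_minus)

lemma PG_sum: "PG (sum f A) b = (\<Sum>i\<in>A. PG (f i) b)"
  by (induction A rule: infinite_finite_induct) (auto simp: PG_add)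

lemma rep_PG: "AE x in lborel. rep_l2 (PG p b) x = pgauss p b x"
  unfolding PG_def by (rule rep_abs_AE[OF square_integrable_pgauss])

lemma cinner_PG: "cinner u (PG p b) = (\<integral>x. rep_l2 u x * cnj (pgauss p b x) \<partial>lborel)"
  unfolding PG_def by (rule cinner_abs_right[OF square_integrable_pgauss])

lemma cinner_PG_PG: "cinner (PG p b) (PG q b') = (\<integral>x. pgauss p b x * cnj (pgauss q b' x) \<partial>lborel)"
  unfolding PG_def by (rule cinner_abs[OF square_integrable_pgauss square_integrable_pgauss])

text \<open>Multiplying \<open>v\<close> by the conjugate Gaussian turns orthogonality to all
  polynomials times that Gaussian into vanishing moments. The moment criterion is real, hence the
  separate treatment of real and imaginary part; the Gaussian factor has no zeros and can be divided
  out.\<close>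

lemma PG_complete:
  assumes "\<And>p. cinner v (PG p b) = 0"
  shows "v = 0"
proof -
  define w where "w x = rep_l2 v x * cnj (pgauss 1 b x)" for x
  have [measurable]: "w \<in> borel_measurable borel" unfolding w_def by measurable
  have eint: "integrable lborel (\<lambda>x. of_real (exp (t * \<bar>x\<bar>)) * w x)" for t
    using square_integrable_mult_cnj[OF square_integrable_rep[of v] square_integrable_exp_pgauss[of t 1 b]]
    by (simp add: w_def mult_ac)
  have pint: "integrable lborel (\<lambda>x. of_real x ^ n * w x)"
    and mom: "(\<integral>x. of_real x ^ n * w x \<partial>lborel) = 0" for n
  proof -
    have eq: "rep_l2 v x * cnj (pgauss (monom 1 n) b x) = of_real x ^ n * w x" for x
      by (simp add: w_def pgauss_def poly_monom)
    show "integrable lborel (\<lambda>x. of_real x ^ n * w x)"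
      using square_integrable_mult_cnj[OF square_integrable_rep[of v] square_integrable_pgauss[of "monom 1 n" b]]
      by (simp add: eq)
    show "(\<integral>x. of_real x ^ n * w x \<partial>lborel) = 0"
      using assms[of "monom 1 n"] by (simp add: cinner_PG eq)
  qed
  have "AE x in lborel. Re (w x) = 0"
  proof (rule moments_zero_imp_AE_zero)
    show "integrable lborel (\<lambda>x. exp (t * \<bar>x\<bar>) * Re (w x))" for t
      using integrable_Re[OF eint[of t]] by simp
    show "(\<integral>x. x ^ n * Re (w x) \<partial>lborel) = 0" for n
      using integral_Re[OF pint[of n]] mom[of n] by (simp flip: of_real_power)
  qed
  moreover have "AE x in lborel. Im (w x) = 0"
  proof (rule moments_zero_imp_AE_zero)
    show "integrable lborel (\<lambda>x. exp (t * \<bar>x\<bar>) * Im (w x))" for t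
      using integrable_Im[OF eint[of t]] by simp
    show "(\<integral>x. x ^ n * Im (w x) \<partial>lborel) = 0" for n
      using integral_Im[OF pint[of n]] mom[of n] by (simp flip: of_real_power)
  qed
  ultimately have "AE x in lborel. rep_l2 v x = rep_l2 0 x"
    using rep_abs_AE[OF square_integrable_zero]
  proof eventually_elim
    fix x assume "Re (w x) = 0" "Im (w x) = 0" "rep_l2 (abs_l2 (\<lambda>x. 0)) x = 0"
    then have "w x = 0" by (simp add: complex_eq_iff)
    then show "rep_l2 v x = rep_l2 0 x"
      using \<open>rep_l2 (abs_l2 (\<lambda>x. 0)) x = 0\<close> by (simp add: w_def pgauss_def zero_l2_def)
  qed
  then show ?thesis by (rule l2_eqI)
qed

text \<open>The operators \<open>Dp b\<close>, \<open>Xp\<close> and, further below, \<open>Ap\<close> act on the polynomial factor \<open>p\<close> of \<open>pgauss p b\<close>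
  the way $d/dx$, multiplication by $x$ and $A$ act on the function itself.\<close>

definition Dp :: "complex \<Rightarrow> complex poly \<Rightarrow> complex poly" where
  "Dp b p = pderiv p + [:b, -1:] * p"

definition Xp :: "complex poly \<Rightarrow> complex poly" where
  "Xp p = [:0, 1:] * p"

lemma pgauss_Xp: "pgauss (Xp p) b x = of_real x * pgauss p b x"
  by (simp add: pgauss_def Xp_def)

lemma pgauss_has_derivative: "(pgauss p b has_vector_derivative pgauss (Dp b p) b x) (at x)"
proof -
  have "((\<lambda>z. poly p z * exp (- z\<^sup>2 / 2 + b * z)) has_field_derivative
      (poly p z * ((- z + b) * exp (- z\<^sup>2 / 2 + b * z)) + poly (pderiv p) z * exp (- z\<^sup>2 / 2 + b * z))) (at z)" for z
    by (auto intro!: derivative_eq_intros)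
  from field_vector_diff_chain_at[OF has_vector_derivative_of_real[OF DERIV_ident] this[of "of_real x"]]
  have "((\<lambda>z. poly p z * exp (- z\<^sup>2 / 2 + b * z)) \<circ> of_real has_vector_derivative
      (poly p (of_real x) * ((- of_real x + b) * exp (- (of_real x)\<^sup>2 / 2 + b * of_real x))
        + poly (pderiv p) (of_real x) * exp (- (of_real x)\<^sup>2 / 2 + b * of_real x))) (at x)"
    by simp
  moreover have "(\<lambda>z. poly p z * exp (- z\<^sup>2 / 2 + b * z)) \<circ> complex_of_real = pgauss p b"
    by (auto simp: pgauss_def)
  moreover have "poly p (of_real x) * ((- of_real x + b) * exp (- (of_real x)\<^sup>2 / 2 + b * of_real x))
        + poly (pderiv p) (of_real x) * exp (- (of_real x)\<^sup>2 / 2 + b * of_real x) = pgauss (Dp b p) b x"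
    by (simp add: pgauss_def Dp_def algebra_simps)
  ultimately show ?thesis by simp
qed

text \<open>Applied to products, this is integration by parts on the whole line.\<close>

lemma integral_of_derivative_zero:
  fixes F f :: "real \<Rightarrow> complex"
  assumes "\<And>x. (F has_vector_derivative f x) (at x)" "continuous_on UNIV f" "integrable lborel f"
    and "(F \<longlongrightarrow> 0) at_top" "(F \<longlongrightarrow> 0) at_bot"
  shows "(\<integral>x. f x \<partial>lborel) = 0"
proof -
  have "(LBINT x=-\<infinity>..\<infinity>. f x) = 0 - 0"
  proof (rule interval_integral_FTC_integrable)
    show "isCont f x" for x using assms(2) by (simp add: continuous_on_eq_continuous_at)
    show "set_integrable lborel (einterval (- \<infinity>) \<infinity>) f" using assms(3) by (simp add: set_integrable_def)
    show "((F \<circ> real_of_ereal) \<longlongrightarrow> 0) (at_right (- \<infinity>))"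
      using assms(5) by (simp add: ereal_tendsto_simps)
    show "((F \<circ> real_of_ereal) \<longlongrightarrow> 0) (at_left \<infinity>)"
      using assms(4) by (simp add: ereal_tendsto_simps)
  qed (use assms(1) in auto)
  then show ?thesis by (simp add: interval_lebesgue_integral_def set_lebesgue_integral_def)
qed

lemma pgauss_tendsto_zero: "(pgauss p b \<longlongrightarrow> 0) at_top" "(pgauss p b \<longlongrightarrow> 0) at_bot"
proof -
  obtain C where C: "C \<ge> 0" "\<And>x. exp (0 * \<bar>x\<bar>) * cmod (pgauss p b x) \<le> C * exp (- x\<^sup>2 / 4)" using pgauss_bound by blast
  have "((\<lambda>x. C * exp (- x\<^sup>2 / 4)) \<longlongrightarrow> 0) at_top" "((\<lambda>x. C * exp (- x\<^sup>2 / 4)) \<longlongrightarrow> 0) at_bot"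
    by real_asymp+
  then show "(pgauss p b \<longlongrightarrow> 0) at_top" "(pgauss p b \<longlongrightarrow> 0) at_bot"
    by (auto intro!: Lim_null_comparison[of "pgauss p b" "\<lambda>x. C * exp (- x\<^sup>2 / 4)"] always_eventually) (use C in simp)+
qed

text \<open>The two weights may differ. This lets eigenfunctions of A be paired with those of its
  adjoint and with the unshifted Hermite functions.\<close>

lemma cinner_Dp: "cinner (PG (Dp b p) b) (PG q b') = - cinner (PG p b) (PG (Dp b' q) b')"
proof -
  define F where "F x = pgauss p b x * cnj (pgauss q b' x)" for x
  define f where "f x = pgauss (Dp b p) b x * cnj (pgauss q b' x) + pgauss p b x * cnj (pgauss (Dp b' q) b' x)" for x
  have i1: "integrable lborel (\<lambda>x. pgauss p b x * cnj (pgauss q b' x))" for p q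
    by (intro square_integrable_mult_cnj square_integrable_pgauss)
  have "(\<integral>x. f x \<partial>lborel) = 0"
  proof (rule integral_of_derivative_zero)
    show "(F has_vector_derivative f x) (at x)" for x
      unfolding F_def f_def
      by (rule has_vector_derivative_eq_rhs)
        (rule has_vector_derivative_mult[OF pgauss_has_derivative has_vector_derivative_cnj[OF pgauss_has_derivative]], simp)
    show "continuous_on UNIV f" unfolding f_def by (intro continuous_intros continuous_on_pgauss)
    show "integrable lborel f" unfolding f_def by (intro Bochner_Integration.integrable_add i1)
    have "((\<lambda>x. pgauss p b x * cnj (pgauss q b' x)) \<longlongrightarrow> 0 * cnj 0) at_top"
         "((\<lambda>x. pgauss p b x * cnj (pgauss q b' x)) \<longlongrightarrow> 0 * cnj 0) at_bot"
      by (intro tendsto_intros pgauss_tendsto_zero)+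
    then show "(F \<longlongrightarrow> 0) at_top" "(F \<longlongrightarrow> 0) at_bot" by (simp_all add: F_def[abs_def])
  qed
  then show ?thesis
    unfolding f_def cinner_PG_PG by (simp add: Bochner_Integration.integral_add[OF i1 i1] eq_neg_iff_add_eq_0)
qed

lemma cinner_Xp: "cinner (PG (Xp p) b) (PG q b') = cinner (PG p b) (PG (Xp q) b')"
  unfolding cinner_PG_PG by (intro Bochner_Integration.integral_cong) (auto simp: pgauss_Xp)

section \<open>Test functions and weak derivatives\<close>

text \<open>Allowing a polynomial in \<open>1 / y\<close> as coefficient of
  \<open>exp (- 1 / y)\<close> makes the family closed under differentiation.\<close>

definition bump_fun :: "real poly \<Rightarrow> real \<Rightarrow> real" where
  "bump_fun p y = (if y > 0 then poly p (1 / y) * exp (- 1 / y) else 0)"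

lemma poly_mult_exp_minus_tendsto_0: "((\<lambda>y::real. poly p y * exp (- y)) \<longlongrightarrow> 0) at_top"
proof -
  have "((\<lambda>y. \<Sum>i\<le>degree p. coeff p i * (y ^ i / exp y)) \<longlongrightarrow> (\<Sum>i\<le>degree p. coeff p i * 0)) at_top"
    by (intro tendsto_sum tendsto_mult tendsto_const tendsto_power_div_exp_0)
  moreover have "(\<Sum>i\<le>degree p. coeff p i * (y ^ i / exp y)) = poly p y * exp (- y)" for y
    by (simp add: poly_altdef sum_distrib_right exp_minus divide_inverse mult.assoc)
  ultimately show ?thesis by simp
qed

text \<open>For positive \<open>y\<close> the product and chain rules give the coefficient
  \<open>p - pderiv p\<close> at \<open>1 / y\<close>, times \<open>1 / y\<close> squared, which is
  the factor \<open>[:0, 0, 1:]\<close>. At 0 the difference quotient tends to 0 because the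
  exponential beats every power of \<open>1 / y\<close>.\<close>

lemma bump_fun_has_derivative:
  "(bump_fun p has_field_derivative bump_fun ([:0, 0, 1:] * (p - pderiv p)) y) (at y)"
proof -
  consider "y > 0" | "y < 0" | "y = 0" by linarith
  then show ?thesis
  proof cases
    case 1
    have "((\<lambda>y. poly p (1 / y) * exp (- 1 / y)) has_field_derivative
        bump_fun ([:0, 0, 1:] * (p - pderiv p)) y) (at y)"
      using 1 by (auto intro!: derivative_eq_intros simp: bump_fun_def power2_eq_square field_simps)
    then show ?thesis
      by (rule has_field_derivative_transform_within_open[of _ _ _ "{0<..}"]) (use 1 in \<open>auto simp: bump_fun_def\<close>)
  next
    case 2
    have "((\<lambda>y. 0::real) has_field_derivative bump_fun ([:0, 0, 1:] * (p - pderiv p)) y) (at y)"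
      using 2 by (simp add: bump_fun_def)
    then show ?thesis
      by (rule has_field_derivative_transform_within_open[of _ _ _ "{..<0}"]) (use 2 in \<open>auto simp: bump_fun_def\<close>)
  next
    case 3
    have "((\<lambda>h. bump_fun p h / h) \<longlongrightarrow> 0) (at_right 0)"
    proof -
      \<comment> \<open>Replacing \<open>p\<close> by \<open>pCons 0 p\<close> multiplies by
        \<open>1 / h\<close> and so absorbs the division in the difference quotient.\<close>
      have "((\<lambda>h::real. poly (pCons 0 p) (inverse h) * exp (- inverse h)) \<longlongrightarrow> 0) (at_right 0)"
        by (rule filterlim_compose[OF poly_mult_exp_minus_tendsto_0 filterlim_inverse_at_top_right])
      then show ?thesis
        by (rule Lim_transform_eventually)
          (auto simp: bump_fun_def eventually_at_filter field_simps intro!: always_eventually)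
    qed
    moreover have "((\<lambda>h. bump_fun p h / h) \<longlongrightarrow> 0) (at_left 0)"
      by (rule Lim_transform_eventually[OF tendsto_const])
         (auto simp: bump_fun_def eventually_at_filter intro!: always_eventually)
    ultimately have "((\<lambda>h. bump_fun p h / h) \<longlongrightarrow> 0) (at 0)" by (intro filterlim_split_at)
    then show ?thesis using 3 by (simp add: has_field_derivative_iff bump_fun_def)
  qed
qed

text \<open>Being closed under differentiation, this algebra consists of smooth functions.\<close>

inductive_set smooth_alg :: "(real \<Rightarrow> real) set" where
  bump: "(\<lambda>x. bump_fun p (c * x + d)) \<in> smooth_alg"
| gauss: "(\<lambda>x. Re (pgauss q b x)) \<in> smooth_alg"
| add: "f \<in> smooth_alg \<Longrightarrow> g \<in> smooth_alg \<Longrightarrow> (\<lambda>x. f x + g x) \<in> smooth_alg"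
| mult: "f \<in> smooth_alg \<Longrightarrow> g \<in> smooth_alg \<Longrightarrow> (\<lambda>x. f x * g x) \<in> smooth_alg"

lemma Re_pgauss_has_derivative:
  "((\<lambda>x. Re (pgauss q b x)) has_field_derivative Re (pgauss (Dp b q) b x)) (at x)"
  using bounded_linear.has_vector_derivative[OF bounded_linear_Re pgauss_has_derivative[of q b x]]
  by (simp add: has_real_derivative_iff_has_vector_derivative)

lemma smooth_alg_deriv:
  "f \<in> smooth_alg \<Longrightarrow> \<exists>f'\<in>smooth_alg. \<forall>x. (f has_field_derivative f' x) (at x)"
proof (induction rule: smooth_alg.induct)
  case (bump p c d)
  have "((\<lambda>x. bump_fun p (c * x + d)) has_field_derivative bump_fun ([:0, 0, 1:] * (p - pderiv p)) (c * x + d) * c) (at x)" for x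
    by (rule DERIV_chain2[OF bump_fun_has_derivative]) (auto intro!: derivative_eq_intros)
  moreover have "bump_fun ([:0, 0, 1:] * (p - pderiv p)) y * c = bump_fun (smult c ([:0, 0, 1:] * (p - pderiv p))) y" for y
    by (simp add: bump_fun_def)
  ultimately show ?case by (intro bexI[OF _ smooth_alg.bump[of "smult c ([:0, 0, 1:] * (p - pderiv p))" c d]]) simp
next
  case (gauss q b)
  show ?case by (intro bexI[OF _ smooth_alg.gauss[of "Dp b q" b]]) (simp add: Re_pgauss_has_derivative)
next
  case (add f g)
  then obtain f' g' where "f' \<in> smooth_alg" "g' \<in> smooth_alg" "\<And>x. (f has_field_derivative f' x) (at x)"
      "\<And>x. (g has_field_derivative g' x) (at x)" by blast
  then show ?case by (intro bexI[of _ "\<lambda>x. f' x + g' x"]) (auto intro: smooth_alg.add DERIV_add)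
next
  case (mult f g)
  then obtain f' g' where *: "f' \<in> smooth_alg" "g' \<in> smooth_alg" "\<And>x. (f has_field_derivative f' x) (at x)"
      "\<And>x. (g has_field_derivative g' x) (at x)" by blast
  have "(\<lambda>x. f' x * g x + g' x * f x) \<in> smooth_alg" by (intro smooth_alg.add smooth_alg.mult * mult)
  then show ?case using DERIV_mult[OF *(3,4)] by (intro bexI[of _ "\<lambda>x. f' x * g x + g' x * f x"]) auto
qed

lemma smooth_alg_funpow: "f \<in> smooth_alg \<Longrightarrow> (deriv ^^ n) f \<in> smooth_alg"
proof (induction n)
  case (Suc n)
  then obtain f' where "f' \<in> smooth_alg" "\<And>x. ((deriv ^^ n) f has_field_derivative f' x) (at x)"
    using smooth_alg_deriv[of "(deriv ^^ n) f"] by blast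
  moreover from this(2) have "deriv ((deriv ^^ n) f) = f'" by (intro ext DERIV_imp_deriv)
  ultimately show ?case by simp
qed auto

lemma smooth_alg_test_function:
  assumes "f \<in> smooth_alg" "\<And>x. \<bar>x\<bar> > r \<Longrightarrow> f x = 0"
  shows "test_function f"
  unfolding test_function_def
proof (intro conjI allI)
  fix n x
  obtain f' where "\<And>x. ((deriv ^^ n) f has_field_derivative f' x) (at x)"
    using smooth_alg_deriv[OF smooth_alg_funpow[OF assms(1)]] by blast
  then show "(deriv ^^ n) f differentiable at x" using real_differentiable_def by blast
next
  have "{x. f x \<noteq> 0} \<subseteq> cball 0 r" using assms(2) by (force simp: not_less)
  then have "bounded {x. f x \<noteq> 0}" by (rule bounded_subset[OF bounded_cball])
  then show "compact (closure {x. f x \<noteq> 0})" by (simp add: compact_closure)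
qed

lemma test_function_deriv_at:
  assumes "test_function f"
  shows "((deriv ^^ n) f has_field_derivative (deriv ^^ Suc n) f x) (at x)"
proof -
  obtain D where "((deriv ^^ n) f has_field_derivative D) (at x)"
    using assms unfolding test_function_def by (meson real_differentiable_def)
  then show ?thesis by (simp add: DERIV_imp_deriv)
qed

lemma test_function_deriv:
  assumes "test_function f"
  shows "test_function (deriv f)"
  unfolding test_function_def
proof (intro conjI allI)
  fix n x
  show "(deriv ^^ n) (deriv f) differentiable at x"
    using assms funpow_Suc_right[of n deriv] unfolding test_function_def by (metis comp_apply)
next
  let ?S = "closure {x. f x \<noteq> 0}"
  have "deriv f x = 0" if "x \<notin> ?S" for x
  proof (rule DERIV_imp_deriv)
    have "((\<lambda>x. 0) has_field_derivative 0) (at x)" by simp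
    then show "(f has_field_derivative 0) (at x)"
      by (rule has_field_derivative_transform_within_open[of _ _ _ "- ?S"])
        (use that closure_subset[of "{x. f x \<noteq> 0}"] in auto)
  qed
  then have "{x. deriv f x \<noteq> 0} \<subseteq> ?S" by blast
  then have "closure {x. deriv f x \<noteq> 0} \<subseteq> ?S" by (simp add: closure_minimal)
  moreover have "compact ?S" using assms by (simp add: test_function_def)
  ultimately show "compact (closure {x. deriv f x \<noteq> 0})"
    using compact_Int_closed[OF _ closed_closure, of ?S "{x. deriv f x \<noteq> 0}"] by (simp add: Int_absorb1)
qed

lemma test_function_funpow: "test_function f \<Longrightarrow> test_function ((deriv ^^ n) f)"
  by (induction n) (auto intro: test_function_deriv)

lemma continuous_on_test_function:
  assumes "test_function f"
  shows "continuous_on A f"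
  using test_function_deriv_at[OF assms, of 0]
  by (auto intro!: continuous_at_imp_continuous_on DERIV_isCont)

lemma test_function_support:
  assumes "test_function f"
  obtains r where "r > 0" "\<And>x. \<bar>x\<bar> > r \<Longrightarrow> f x = 0"
proof -
  have "bounded {x. f x \<noteq> 0}"
    using assms closure_subset[of "{x. f x \<noteq> 0}"] unfolding test_function_def
    by (meson bounded_subset compact_imp_bounded)
  then obtain r where "r > 0" "\<forall>x\<in>{x. f x \<noteq> 0}. norm x \<le> r" by (auto simp: bounded_pos)
  then show ?thesis by (intro that[of r]) (auto simp: not_le[symmetric])
qed

lemma square_integrable_test_function:
  assumes "test_function f"
  shows "square_integrable (\<lambda>x. complex_of_real (f x))"
proof -
  obtain r where r: "\<And>x. \<bar>x\<bar> > r \<Longrightarrow> f x = 0" using test_function_support[OF assms] by blast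
  have "integrable lborel (\<lambda>x. indicator {-r..r} x *\<^sub>R (f x)\<^sup>2)"
    by (intro borel_integrable_compact continuous_intros continuous_on_test_function assms) auto
  also have "(\<lambda>x. indicator {-r..r} x *\<^sub>R (f x)\<^sup>2) = (\<lambda>x. (f x)\<^sup>2)"
  proof
    show "indicator {-r..r} x *\<^sub>R (f x)\<^sup>2 = (f x)\<^sup>2" for x
      using r[of x] by (cases "\<bar>x\<bar> > r") (auto simp: indicator_def)
  qed
  finally show ?thesis
    unfolding square_integrable_def
    by (auto intro!: borel_measurable_continuous_onI continuous_intros continuous_on_test_function assms)
qed

section \<open>Weak derivatives as pairings in L^2\<close>

definition test_l2 :: "(real \<Rightarrow> real) \<Rightarrow> l2" where
  "test_l2 f = abs_l2 (\<lambda>x. complex_of_real (f x))"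

lemma cinner_test_l2: "test_function f \<Longrightarrow> cinner u (test_l2 f) = (\<integral>x. complex_of_real (f x) * rep_l2 u x \<partial>lborel)"
  unfolding test_l2_def by (simp add: cinner_abs_right square_integrable_test_function mult.commute)

lemma has_weak_derivative_iff:
  "has_weak_derivative n f g \<longleftrightarrow> (\<forall>\<phi>. test_function \<phi> \<longrightarrow> cinner f (test_l2 ((deriv ^^ n) \<phi>)) = (-1) ^ n * cinner g (test_l2 \<phi>))"
  unfolding has_weak_derivative_def by (auto simp: cinner_test_l2 test_function_funpow)

lemma has_weak_derivative_0: "has_weak_derivative 0 f f"
  by (simp add: has_weak_derivative_iff)

lemma has_weak_derivative_1_iff:
  "has_weak_derivative 1 f g \<longleftrightarrow> (\<forall>\<phi>. test_function \<phi> \<longrightarrow> cinner f (test_l2 (deriv \<phi>)) = - cinner g (test_l2 \<phi>))"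
  by (simp add: has_weak_derivative_iff)

lemma has_weak_derivative_2_iff:
  "has_weak_derivative 2 f g \<longleftrightarrow> (\<forall>\<phi>. test_function \<phi> \<longrightarrow> cinner f (test_l2 (deriv (deriv \<phi>))) = cinner g (test_l2 \<phi>))"
  by (simp add: has_weak_derivative_iff numeral_2_eq_2)

lemma has_weak_derivative_2I:
  assumes "has_weak_derivative 1 f g" "has_weak_derivative 1 g h"
  shows "has_weak_derivative 2 f h"
  using assms unfolding has_weak_derivative_1_iff has_weak_derivative_2_iff
  by (simp add: test_function_deriv)

text \<open>Membership in the Sobolev space gives a first and a second weak derivative independently
  of each other. Testing the first against the derivative of a test function links the two.\<close>

lemma has_weak_derivative_2D:
  assumes "has_weak_derivative 1 f g" "has_weak_derivative 2 f h"
  shows "has_weak_derivative 1 g h"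
  unfolding has_weak_derivative_1_iff
proof (intro allI impI)
  fix \<phi> assume "test_function \<phi>"
  then have "cinner f (test_l2 (deriv (deriv \<phi>))) = - cinner g (test_l2 (deriv \<phi>))" "cinner f (test_l2 (deriv (deriv \<phi>))) = cinner h (test_l2 \<phi>)"
    using assms unfolding has_weak_derivative_1_iff has_weak_derivative_2_iff by (simp_all add: test_function_deriv)
  then show "cinner g (test_l2 (deriv \<phi>)) = - cinner h (test_l2 \<phi>)" by simp
qed

lemma has_weak_derivative_closed:
  assumes "f \<longlonglongrightarrow> u" "g \<longlonglongrightarrow> v" "\<And>i. has_weak_derivative n (f i) (g i)"
  shows "has_weak_derivative n u v"
  unfolding has_weak_derivative_iff
proof (intro allI impI)
  fix \<phi> assume "test_function \<phi>"
  then have eq: "cinner (f i) (test_l2 ((deriv ^^ n) \<phi>)) = (-1) ^ n * cinner (g i) (test_l2 \<phi>)" for i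
    using assms(3) by (simp add: has_weak_derivative_iff)
  have "(\<lambda>i. cinner (f i) (test_l2 ((deriv ^^ n) \<phi>))) \<longlonglongrightarrow> cinner u (test_l2 ((deriv ^^ n) \<phi>))"
    by (rule tendsto_cinner_left[OF assms(1)])
  moreover have "(\<lambda>i. cinner (f i) (test_l2 ((deriv ^^ n) \<phi>))) \<longlonglongrightarrow> (-1) ^ n * cinner v (test_l2 \<phi>)"
    unfolding eq by (intro tendsto_mult tendsto_const tendsto_cinner_left assms)
  ultimately show "cinner u (test_l2 ((deriv ^^ n) \<phi>)) = (-1) ^ n * cinner v (test_l2 \<phi>)"
    by (rule LIMSEQ_unique)
qed

lemma PG_has_weak_derivative: "has_weak_derivative 1 (PG p b) (PG (Dp b p) b)"
  unfolding has_weak_derivative_iff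
proof (intro allI impI)
  fix \<phi> assume test: "test_function \<phi>"
  obtain r where r: "r > 0" "\<And>x. \<bar>x\<bar> > r \<Longrightarrow> \<phi> x = 0" using test_function_support[OF test] by blast
  define f where "f x = pgauss p b x * cnj (of_real (deriv \<phi> x)) + pgauss (Dp b p) b x * cnj (of_real (\<phi> x))" for x
  have i1: "integrable lborel (\<lambda>x. pgauss q b x * cnj (of_real (\<phi> x)))" if "test_function \<phi>" for q \<phi>
    by (intro square_integrable_mult_cnj square_integrable_pgauss square_integrable_test_function that)
  have "(\<integral>x. f x \<partial>lborel) = 0"
  proof (rule integral_of_derivative_zero)
    have "((\<lambda>x. complex_of_real (\<phi> x)) has_vector_derivative of_real (deriv \<phi> x)) (at x)" for x
      using test_function_deriv_at[OF test, of 0 x] by (intro has_vector_derivative_of_real) simp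
    then show "((\<lambda>x. pgauss p b x * of_real (\<phi> x)) has_vector_derivative f x) (at x)" for x
      unfolding f_def
      by (rule has_vector_derivative_eq_rhs[OF has_vector_derivative_mult[OF pgauss_has_derivative]]) simp
    show "continuous_on UNIV f" unfolding f_def
      by (intro continuous_intros continuous_on_pgauss continuous_on_test_function test test_function_deriv)
    show "integrable lborel f" unfolding f_def
      by (intro Bochner_Integration.integrable_add i1 test test_function_deriv)
    show "((\<lambda>x. pgauss p b x * of_real (\<phi> x)) \<longlongrightarrow> 0) at_top"
      by (rule tendsto_eventually) (use r(2) in \<open>auto intro!: eventually_at_top_dense[THEN iffD2] exI[of _ r]\<close>)
    show "((\<lambda>x. pgauss p b x * of_real (\<phi> x)) \<longlongrightarrow> 0) at_bot"
      by (rule tendsto_eventually) (use r(2) in \<open>auto intro!: eventually_at_bot_dense[THEN iffD2] exI[of _ "-r"]\<close>)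
  qed
  then show "cinner (PG p b) (test_l2 ((deriv ^^ 1) \<phi>)) = (- 1) ^ 1 * cinner (PG (Dp b p) b) (test_l2 \<phi>)"
    unfolding f_def PG_def test_l2_def
    by (simp add: cinner_abs square_integrable_pgauss square_integrable_test_function test test_function_deriv
       eq_neg_iff_add_eq_0 Bochner_Integration.integral_add[OF i1 i1, simplified])
qed

text \<open>A product of two one-sided bumps: smooth, supported in [-1, 1] and non-zero at 0. Its
  dilations tend pointwise to the constant \<open>cutoff 0\<close>, a common factor that cancels in
  every limit.\<close>

definition cutoff :: "real \<Rightarrow> real" where
  "cutoff x = bump_fun 1 (x + 1) * bump_fun 1 (- x + 1)"

definition cutoff' :: "real \<Rightarrow> real" where
  "cutoff' x = bump_fun [:0, 0, 1:] (x + 1) * bump_fun 1 (- x + 1) - bump_fun 1 (x + 1) * bump_fun [:0, 0, 1:] (- x + 1)"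

lemma cutoff_has_derivative: "(cutoff has_field_derivative cutoff' x) (at x)"
proof -
  have "((\<lambda>x. bump_fun 1 (c * x + 1)) has_field_derivative bump_fun ([:0, 0, 1:] * (1 - pderiv 1)) (c * x + 1) * c) (at x)" for c
    by (rule DERIV_chain2[OF bump_fun_has_derivative]) (auto intro!: derivative_eq_intros)
  then have "((\<lambda>x. bump_fun 1 (c * x + 1)) has_field_derivative bump_fun [:0, 0, 1:] (c * x + 1) * c) (at x)" for c
    by (simp add: pderiv_1)
  from DERIV_mult[OF this[of 1] this[of "-1"]] show ?thesis
    unfolding cutoff_def[abs_def] cutoff'_def by (simp add: algebra_simps)
qed

lemma continuous_bump_fun: "continuous_on A (bump_fun p)"
  by (auto intro!: continuous_at_imp_continuous_on DERIV_isCont bump_fun_has_derivative)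

lemma continuous_bump_fun_affine: "continuous_on A (\<lambda>x. bump_fun p (c * x + d))"
  by (rule continuous_on_compose2[OF continuous_bump_fun[of UNIV]]) (auto intro!: continuous_intros)

lemma continuous_cutoff: "continuous_on A cutoff" and continuous_cutoff': "continuous_on A cutoff'"
  using continuous_bump_fun_affine[of A _ 1 1] continuous_bump_fun_affine[of A _ "-1" 1]
  unfolding cutoff_def[abs_def] cutoff'_def[abs_def] by (auto intro!: continuous_intros)

lemma cutoff_support: "\<bar>x\<bar> > 1 \<Longrightarrow> cutoff x = 0" and cutoff'_support: "\<bar>x\<bar> > 1 \<Longrightarrow> cutoff' x = 0"
  by (auto simp: cutoff_def cutoff'_def bump_fun_def abs_if split: if_splits)

lemma cutoff_0: "cutoff 0 \<noteq> 0"
  by (simp add: cutoff_def bump_fun_def)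

lemma bounded_of_support:
  fixes h :: "real \<Rightarrow> real"
  assumes "continuous_on UNIV h" "\<And>x. \<bar>x\<bar> > 1 \<Longrightarrow> h x = 0"
  shows "\<exists>C\<ge>0. \<forall>x. \<bar>h x\<bar> \<le> C"
proof -
  have "bounded (h ` {-1..1})"
    by (intro compact_imp_bounded compact_continuous_image continuous_on_subset[OF assms(1)]) auto
  then obtain C where C: "\<And>x. x \<in> {-1..1} \<Longrightarrow> \<bar>h x\<bar> \<le> C"
    unfolding bounded_iff by (metis imageI real_norm_def)
  have "C \<ge> 0" using C[of 0] by auto
  moreover have "\<bar>h x\<bar> \<le> C" for x using C[of x] assms(2)[of x] \<open>C \<ge> 0\<close> by (cases "\<bar>x\<bar> > 1") (auto simp: not_less abs_le_iff)
  ultimately show ?thesis by blast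
qed

lemma cutoff_limit:
  fixes h :: "real \<Rightarrow> real" and k :: "real \<Rightarrow> complex"
  assumes cont: "continuous_on UNIV h" and supp: "\<And>x. \<bar>x\<bar> > 1 \<Longrightarrow> h x = 0"
    and int: "integrable lborel k"
  shows "(\<lambda>n. \<integral>x. of_real (h (x / real (Suc n))) * k x \<partial>lborel) \<longlonglongrightarrow> of_real (h 0) * (\<integral>x. k x \<partial>lborel)"
proof -
  obtain C where C: "C \<ge> 0" "\<And>x. \<bar>h x\<bar> \<le> C" using bounded_of_support[OF cont supp] by blast
  have [measurable]: "h \<in> borel_measurable borel" "k \<in> borel_measurable borel"
    using int cont by (auto intro: borel_measurable_continuous_onI)
  have "(\<lambda>n. \<integral>x. of_real (h (x / real (Suc n))) * k x \<partial>lborel) \<longlonglongrightarrow> (\<integral>x. of_real (h 0) * k x \<partial>lborel)"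
  proof (rule integral_dominated_convergence)
    show "integrable lborel (\<lambda>x. C * norm (k x))" using int by simp
    have "(\<lambda>n. h (x / real (Suc n))) \<longlonglongrightarrow> h 0" for x
    proof -
      have "(\<lambda>n. x / real (Suc n)) \<longlonglongrightarrow> 0"
        using tendsto_mult_right_zero[OF LIMSEQ_inverse_real_of_nat, of x] by (simp add: divide_inverse)
      then show ?thesis using cont by (intro isCont_tendsto_compose[of 0 h]) (auto simp: continuous_on_eq_continuous_at)
    qed
    then show "AE x in lborel. (\<lambda>n. of_real (h (x / real (Suc n))) * k x) \<longlonglongrightarrow> of_real (h 0) * k x"
      by (intro AE_I2 tendsto_intros)
    show "AE x in lborel. norm (of_real (h (x / real (Suc n))) * k x) \<le> C * norm (k x)" for n
      by (intro AE_I2) (auto simp: norm_mult intro!: mult_right_mono C(2))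
  qed measurable
  then show ?thesis by simp
qed

lemma cutoff_test_function: "test_function (\<lambda>x. cutoff (x / real (Suc n)) * Re (pgauss q b x))"
proof (rule smooth_alg_test_function[of _ "real (Suc n)"])
  have "(\<lambda>x. bump_fun 1 (1 / real (Suc n) * x + 1) * bump_fun 1 (- 1 / real (Suc n) * x + 1) * Re (pgauss q b x)) \<in> smooth_alg"
    by (intro smooth_alg.mult smooth_alg.bump smooth_alg.gauss)
  then show "(\<lambda>x. cutoff (x / real (Suc n)) * Re (pgauss q b x)) \<in> smooth_alg"
    by (simp add: cutoff_def[abs_def])
  fix x :: real assume "\<bar>x\<bar> > real (Suc n)"
  then have "\<bar>x / real (Suc n)\<bar> > 1" by (simp add: field_simps)
  then show "cutoff (x / real (Suc n)) * Re (pgauss q b x) = 0" using cutoff_support by simp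
qed

lemma Re_pgauss_rep_integrable: "integrable lborel (\<lambda>x. of_real (Re (pgauss q b x)) * rep_l2 u x)"
proof (rule Bochner_Integration.integrable_bound[OF pgauss_mult_rep_integrable[of q b u]])
  show "AE x in lborel. norm (of_real (Re (pgauss q b x)) * rep_l2 u x) \<le> norm (pgauss q b x * rep_l2 u x)"
    by (auto simp: norm_mult intro!: mult_right_mono abs_Re_le_cmod)
qed measurable

text \<open>Test functions are real-valued, so a pairing with a complex Gaussian is split into two
  real ones; the imaginary part is written as the real part of -i times the function, which stays in
  the same class.\<close>

lemma cinner_PG_Re_Im:
  "cinner u (PG q b) = (\<integral>x. of_real (Re (pgauss q b x)) * rep_l2 u x \<partial>lborel)
     - \<i> * (\<integral>x. of_real (Re (pgauss (smult (- \<i>) q) b x)) * rep_l2 u x \<partial>lborel)"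
proof -
  have "rep_l2 u x * cnj (pgauss q b x) = of_real (Re (pgauss q b x)) * rep_l2 u x
      - \<i> * (of_real (Re (pgauss (smult (- \<i>) q) b x)) * rep_l2 u x)" for x
    by (simp only: pgauss_smult) (simp add: complex_eq_iff algebra_simps)
  then show ?thesis unfolding cinner_PG
    by (simp add: Bochner_Integration.integral_diff[OF Re_pgauss_rep_integrable integrable_mult_right[OF Re_pgauss_rep_integrable]] del: pgauss_smult)
qed

text \<open>Cut-off polynomials times Gaussians are test functions. Removing the cut-off in the
  limit leaves a vector orthogonal to all polynomials times a Gaussian, and completeness takes the
  place of mollification.\<close>

lemma zero_if_test_functions_zero:
  assumes "\<And>\<phi>. test_function \<phi> \<Longrightarrow> cinner u (test_l2 \<phi>) = 0"
  shows "u = 0"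
proof -
  have "(\<integral>x. of_real (Re (pgauss q 0 x)) * rep_l2 u x \<partial>lborel) = 0" for q
  proof -
    have "(\<integral>x. of_real (cutoff (x / real (Suc n))) * (of_real (Re (pgauss q 0 x)) * rep_l2 u x) \<partial>lborel) = 0" for n
      using assms[OF cutoff_test_function[of n q 0]] unfolding cinner_test_l2[OF cutoff_test_function] by (simp add: mult.assoc)
    then have "of_real (cutoff 0) * (\<integral>x. of_real (Re (pgauss q 0 x)) * rep_l2 u x \<partial>lborel) = 0"
      using cutoff_limit[OF continuous_cutoff cutoff_support Re_pgauss_rep_integrable, of q 0 u]
      by (simp add: LIMSEQ_const_iff)
    then show ?thesis using cutoff_0 by simp
  qed
  then show ?thesis by (intro PG_complete[of u 0]) (simp add: cinner_PG_Re_Im)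
qed

lemma weak_derivative_eq:
  assumes "has_weak_derivative n f g"
  shows "weak_derivative n f = g"
  unfolding weak_derivative_def
proof (rule the_equality[where P = "has_weak_derivative n f", OF assms])
  fix g' assume g': "has_weak_derivative n f g'"
  have "g' - g = 0"
  proof (rule zero_if_test_functions_zero)
    fix \<phi> assume "test_function \<phi>"
    then have "(-1) ^ n * cinner g' (test_l2 \<phi>) = (-1) ^ n * cinner g (test_l2 \<phi>)"
      using assms g' by (simp add: has_weak_derivative_iff)
    then show "cinner (g' - g) (test_l2 \<phi>) = 0" by (simp add: cinner_diff_left)
  qed
  then show "g' = g" by simp
qed

lemma cutoff_integrable:
  fixes h :: "real \<Rightarrow> real" and k :: "real \<Rightarrow> complex"
  assumes cont: "continuous_on UNIV h" and supp: "\<And>x. \<bar>x\<bar> > 1 \<Longrightarrow> h x = 0"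
    and int: "integrable lborel k"
  shows "integrable lborel (\<lambda>x. of_real (h (x / real (Suc n))) * k x)"
proof -
  obtain C where C: "C \<ge> 0" "\<And>x. \<bar>h x\<bar> \<le> C" using bounded_of_support[OF cont supp] by blast
  have [measurable]: "h \<in> borel_measurable borel" "k \<in> borel_measurable borel"
    using int cont by (auto intro: borel_measurable_continuous_onI)
  show ?thesis
  proof (rule Bochner_Integration.integrable_bound)
    show "integrable lborel (\<lambda>x. of_real C * k x)" by (intro integrable_mult_right int)
    show "AE x in lborel. norm (of_real (h (x / real (Suc n))) * k x) \<le> norm (of_real C * k x)"
      by (intro AE_I2) (use C in \<open>auto simp: norm_mult intro!: mult_right_mono\<close>)
  qed measurable
qed

lemma cutoff_derivative:
  "deriv (\<lambda>x. cutoff (x / real (Suc n)) * Re (pgauss q b x)) x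
    = (1 / real (Suc n)) * (cutoff' (x / real (Suc n)) * Re (pgauss q b x))
      + cutoff (x / real (Suc n)) * Re (pgauss (Dp b q) b x)"
proof (rule DERIV_imp_deriv)
  have "((\<lambda>x. cutoff (x / real (Suc n))) has_field_derivative cutoff' (x / real (Suc n)) * (1 / real (Suc n))) (at x)"
    by (rule DERIV_chain2[OF cutoff_has_derivative]) (auto intro!: derivative_eq_intros)
  from DERIV_mult[OF this Re_pgauss_has_derivative[of q b x]]
  show "((\<lambda>x. cutoff (x / real (Suc n)) * Re (pgauss q b x)) has_field_derivative
     (1 / real (Suc n)) * (cutoff' (x / real (Suc n)) * Re (pgauss q b x))
      + cutoff (x / real (Suc n)) * Re (pgauss (Dp b q) b x)) (at x)"
    by (rule DERIV_cong) (simp only: ac_simps)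
qed

text \<open>Extends the defining identity of the weak derivative from compactly supported functions
  to Gaussians: the term in which the cut-off is differentiated carries a factor
  \<open>1 / real (Suc n)\<close> and disappears in the limit.\<close>

lemma Re_pgauss_weak_derivative:
  assumes "has_weak_derivative 1 f f'"
  shows "(\<integral>x. of_real (Re (pgauss q b x)) * rep_l2 f' x \<partial>lborel)
      = - (\<integral>x. of_real (Re (pgauss (Dp b q) b x)) * rep_l2 f x \<partial>lborel)"
proof -
  let ?k = "\<lambda>x. complex_of_real (Re (pgauss q b x)) * rep_l2 f x"
  let ?k' = "\<lambda>x. complex_of_real (Re (pgauss (Dp b q) b x)) * rep_l2 f x"
  let ?l = "\<lambda>x. complex_of_real (Re (pgauss q b x)) * rep_l2 f' x"
  define \<phi> where "\<phi> n x = cutoff (x / real (Suc n)) * Re (pgauss q b x)" for n x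
  define A where "A n = (\<integral>x. of_real (cutoff (x / real (Suc n))) * ?l x \<partial>lborel)" for n
  define B where "B n = (\<integral>x. of_real (cutoff' (x / real (Suc n))) * ?k x \<partial>lborel)" for n
  define C where "C n = (\<integral>x. of_real (cutoff (x / real (Suc n))) * ?k' x \<partial>lborel)" for n
  have test: "test_function (\<phi> n)" for n
    unfolding \<phi>_def by (rule cutoff_test_function)
  have A: "A n = - (of_real (1 / real (Suc n)) * B n + C n)" for n
  proof -
    have "cinner f (test_l2 (deriv (\<phi> n))) = - cinner f' (test_l2 (\<phi> n))"
      using assms[unfolded has_weak_derivative_1_iff] test by blast
    moreover have "cinner f' (test_l2 (\<phi> n)) = A n"
      unfolding cinner_test_l2[OF test] A_def \<phi>_def by (simp only: of_real_mult mult.assoc)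
    moreover have "cinner f (test_l2 (deriv (\<phi> n))) = of_real (1 / real (Suc n)) * B n + C n"
    proof -
      have "of_real (deriv (\<phi> n) x) * rep_l2 f x =
          of_real (1 / real (Suc n)) * (of_real (cutoff' (x / real (Suc n))) * ?k x)
           + of_real (cutoff (x / real (Suc n))) * ?k' x" for x
        unfolding \<phi>_def cutoff_derivative by (simp only: of_real_add of_real_mult distrib_right mult.assoc)
      then have "cinner f (test_l2 (deriv (\<phi> n))) =
          (\<integral>x. of_real (1 / real (Suc n)) * (of_real (cutoff' (x / real (Suc n))) * ?k x)
           + of_real (cutoff (x / real (Suc n))) * ?k' x \<partial>lborel)"
        unfolding cinner_test_l2[OF test_function_deriv[OF test]] by (simp only:)
      also have "\<dots> = (\<integral>x. of_real (1 / real (Suc n)) * (of_real (cutoff' (x / real (Suc n))) * ?k x) \<partial>lborel) + C n"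
        unfolding C_def
        by (rule Bochner_Integration.integral_add)
          (intro integrable_mult_right cutoff_integrable continuous_cutoff continuous_cutoff' Re_pgauss_rep_integrable cutoff_support cutoff'_support; assumption)+
      also have "\<dots> = of_real (1 / real (Suc n)) * B n + C n"
        unfolding B_def by (simp only: integral_mult_right_zero)
      finally show ?thesis .
    qed
    ultimately have "- A n = of_real (1 / real (Suc n)) * B n + C n" by (simp only:)
    then show ?thesis by (simp only: minus_equation_iff[of "A n"])
  qed
  let ?r = "\<integral>x. ?l x \<partial>lborel"
  let ?s = "\<integral>x. ?k' x \<partial>lborel"
  have "A \<longlonglongrightarrow> of_real (cutoff 0) * ?r"
    unfolding A_def[abs_def] by (rule cutoff_limit[OF continuous_cutoff cutoff_support Re_pgauss_rep_integrable])
  moreover have "A \<longlonglongrightarrow> - (of_real 0 * (of_real (cutoff' 0) * (\<integral>x. ?k x \<partial>lborel))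
          + of_real (cutoff 0) * ?s)"
  proof -
    have "B \<longlonglongrightarrow> of_real (cutoff' 0) * (\<integral>x. ?k x \<partial>lborel)"
      unfolding B_def[abs_def] by (rule cutoff_limit[OF continuous_cutoff' cutoff'_support Re_pgauss_rep_integrable])
    moreover have "C \<longlonglongrightarrow> of_real (cutoff 0) * ?s"
      unfolding C_def[abs_def] by (rule cutoff_limit[OF continuous_cutoff cutoff_support Re_pgauss_rep_integrable])
    moreover have "(\<lambda>n. complex_of_real (1 / real (Suc n))) \<longlonglongrightarrow> of_real 0"
      using LIMSEQ_inverse_real_of_nat by (intro tendsto_of_real) (simp only: inverse_eq_divide)
    ultimately show ?thesis unfolding A[abs_def] by (intro tendsto_minus tendsto_add tendsto_mult)
  qed
  ultimately have "of_real (cutoff 0) * ?r = - (of_real 0 * (of_real (cutoff' 0) * (\<integral>x. ?k x \<partial>lborel))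
          + of_real (cutoff 0) * ?s)"
    by (rule LIMSEQ_unique)
  then have "of_real (cutoff 0) * ?r = of_real (cutoff 0) * (- ?s)" by (simp only: of_real_0 mult_zero_left add_0_left mult_minus_right)
  then show ?thesis using cutoff_0 by (simp only: mult_left_cancel of_real_eq_0_iff not_False_eq_True)
qed

lemma cinner_weak_derivative:
  assumes "has_weak_derivative 1 f f'"
  shows "cinner f' (PG q b) = - cinner f (PG (Dp b q) b)"
proof -
  have "Dp b (smult (- \<i>) q) = smult (- \<i>) (Dp b q)"
    unfolding Dp_def by (simp only: pderiv_smult smult_add_right mult_smult_right)
  then show ?thesis unfolding cinner_PG_Re_Im Re_pgauss_weak_derivative[OF assms] by (simp only:) (simp add: algebra_simps)
qed

section \<open>Shifted Hermite functions\<close>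

text \<open>\<open>hermite c n\<close> is the physicists' Hermite polynomial $H_n(x + c)$.\<close>

fun hermite :: "complex \<Rightarrow> nat \<Rightarrow> complex poly" where
  "hermite c 0 = 1"
| "hermite c (Suc n) = [:2 * c, 2:] * hermite c n - pderiv (hermite c n)"

text \<open>The lowering relation. Together with the recursion, which raises the index, it gives
  both the Hermite equation and the ladder relations for inner products.\<close>

lemma pderiv_hermite: "pderiv (hermite c (Suc n)) = smult (2 * of_nat (Suc n)) (hermite c n)"
proof (induction n)
  case 0
  show ?case by (simp add: pderiv_pCons)
next
  case (Suc n)
  have q: "pderiv [:2 * c, 2:] = [:2:]" by (simp add: pderiv_pCons)
  have "pderiv (hermite c (Suc (Suc n))) = [:2 * c, 2:] * pderiv (hermite c (Suc n)) + hermite c (Suc n) * [:2:] - pderiv (pderiv (hermite c (Suc n)))"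
    by (simp only: hermite.simps(2)[of c "Suc n"] pderiv_diff pderiv_mult q)
  also have "\<dots> = smult (2 * of_nat (Suc n)) ([:2 * c, 2:] * hermite c n - pderiv (hermite c n)) + smult 2 (hermite c (Suc n))"
  proof -
    have "hermite c (Suc n) * [:2:] = smult 2 (hermite c (Suc n))" by (simp del: hermite.simps(2))
    then show ?thesis unfolding Suc pderiv_smult
      by (simp only: mult_smult_right smult_diff_right diff_add_eq)
  qed
  also have "[:2 * c, 2:] * hermite c n - pderiv (hermite c n) = hermite c (Suc n)" by simp
  also have "smult (2 * of_nat (Suc n)) (hermite c (Suc n)) + smult 2 (hermite c (Suc n)) = smult (2 * of_nat (Suc (Suc n))) (hermite c (Suc n))"
    by (simp only: smult_add_left[symmetric]) (simp add: algebra_simps)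
  finally show ?case .
qed

lemma pderiv_hp': "pderiv (hermite c n) = smult (2 * of_nat n) (hermite c (n - 1))"
  using pderiv_hermite[of c "n - 1"] by (cases n) (auto simp del: hermite.simps(2))

lemma hermite_ode: "pderiv (pderiv (hermite c n)) - [:2 * c, 2:] * pderiv (hermite c n) + smult (2 * of_nat n) (hermite c n) = 0"
proof (cases n)
  case (Suc m)
  have "pderiv (pderiv (hermite c n)) = smult (2 * of_nat n) (pderiv (hermite c m))"
    "pderiv (hermite c n) = smult (2 * of_nat n) (hermite c m)"
    by (simp_all add: Suc pderiv_hermite pderiv_smult del: hermite.simps(2) of_nat_Suc)
  then have "pderiv (pderiv (hermite c n)) - [:2 * c, 2:] * pderiv (hermite c n) + smult (2 * of_nat n) (hermite c n)
    = smult (2 * of_nat n) (pderiv (hermite c m) - [:2 * c, 2:] * hermite c m + hermite c n)"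
    by (simp only: smult_diff_right smult_add_right mult_smult_right)
  also have "pderiv (hermite c m) - [:2 * c, 2:] * hermite c m + hermite c n = 0" by (simp add: Suc)
  finally show ?thesis by simp
qed simp

lemma degree_hermite: "degree (hermite c n) = n \<and> coeff (hermite c n) n = 2 ^ n"
proof (induction n)
  case (Suc n)
  have l: "coeff (hermite c (Suc n)) (Suc n) = 2 ^ Suc n"
    using Suc by (simp add: coeff_pderiv coeff_eq_0 mult_pCons_left)
  have "degree ([:2 * c, 2:] * hermite c n) \<le> Suc n" using degree_mult_le[of "[:2 * c, 2:]" "hermite c n"] Suc by simp
  moreover have "degree (pderiv (hermite c n)) \<le> Suc n" using Suc degree_pderiv[of "hermite c n"] by simp
  ultimately have "degree (hermite c (Suc n)) \<le> Suc n" by (simp only: hermite.simps) (intro degree_diff_le)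
  moreover have "Suc n \<le> degree (hermite c (Suc n))" by (rule le_degree) (simp only: l, simp)
  ultimately show ?case using l by (metis le_antisym)
qed simp

lemma poly_hermite_expansion:
  fixes p :: "complex poly"
  shows "\<exists>a. p = (\<Sum>j\<le>degree p. smult (a j) (hermite c j))"
proof -
  have "degree p \<le> n \<Longrightarrow> \<exists>a. p = (\<Sum>j\<le>n. smult (a j) (hermite c j))" for n and p :: "complex poly"
  proof (induction n arbitrary: p)
    case 0
    then obtain u where "p = [:u:]" using degree_0_id by (metis le_zero_eq)
    then show ?case by (intro exI[of _ "\<lambda>_. u"]) simp
  next
    case (Suc n)
    \<comment> \<open>Cancels the top coefficient, since \<open>hermite c (Suc n)\<close> has
      leading coefficient \<open>2 ^ Suc n\<close>.\<close>
    define b where "b = coeff p (Suc n) / 2 ^ Suc n"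
    define q where "q = p - smult b (hermite c (Suc n))"
    have "degree q \<le> Suc n"
      unfolding q_def using Suc.prems degree_hermite[of c "Suc n"]
      by (intro degree_diff_le) (auto simp del: hermite.simps intro: order_trans[OF degree_smult_le])
    moreover have "coeff q (Suc n) = 0"
      unfolding q_def using degree_hermite[of c "Suc n"] by (simp add: b_def del: hermite.simps)
    ultimately have "degree q \<le> n"
      by (metis degree_0 eq_zero_or_degree_less le0 less_Suc_eq_le order_le_less)
    then obtain a where "q = (\<Sum>j\<le>n. smult (a j) (hermite c j))" using Suc.IH by blast
    then have "p = (\<Sum>j\<le>Suc n. smult ((a(Suc n := b)) j) (hermite c j))"
      by (simp add: q_def diff_eq_eq del: hermite.simps)
    then show ?case by blast
  qed
  then show ?thesis by blast
qed

section \<open>Ladder relations for the shifted Hermite functions\<close>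

lemma Dp_add: "Dp b (p + q) = Dp b p + Dp b q"
  and Dp_diff: "Dp b (p - q) = Dp b p - Dp b q"
  and Dp_smult: "Dp b (smult c p) = smult c (Dp b p)"
  by (simp_all add: Dp_def pderiv_add pderiv_diff pderiv_smult distrib_left right_diff_distrib smult_add_right)

lemma Xp_add: "Xp (p + q) = Xp p + Xp q"
  and Xp_diff: "Xp (p - q) = Xp p - Xp q"
  and Xp_smult: "Xp (smult c p) = smult c (Xp p)"
  by (simp_all add: Xp_def distrib_left right_diff_distrib)

lemma Dp_Xp: "Dp b (Xp p) = Xp (Dp b p) + p"
  by (simp add: Dp_def Xp_def pderiv_mult pderiv_pCons algebra_simps)

lemma Dp_eq: "Dp b p = pderiv p + smult b p - Xp p"
proof -
  have "[:b, -1:] = [:b:] - [:0, 1:]" by simp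
  then show ?thesis by (simp only: Dp_def Xp_def left_diff_distrib) simp
qed

text \<open>The parameter \<open>b\<close> is free because it cancels against the one inside
  \<open>Dp b\<close>. Taking it equal to the weight exhibits the recursion as the creation operator
  x - d/dx, up to a constant, acting on the function itself.\<close>

lemma hermite_Suc_creation: "hermite c (Suc n) = Xp (hermite c n) + smult (2 * c + b) (hermite c n) - Dp b (hermite c n)"
proof -
  have "[:2 * c, 2:] = [:2 * c:] + [:0, 1:] + [:0, 1:]" by simp
  then have "[:2 * c, 2:] * hermite c n = smult (2 * c) (hermite c n) + Xp (hermite c n) + Xp (hermite c n)"
    by (simp only: Xp_def distrib_right) simp
  then show ?thesis by (simp add: Dp_eq smult_add_left)
qed

text \<open>Up to a constant factor, \<open>eigfun al be n\<close> is $e^{\<beta>x} h_n(x + i\<alpha>)$: expanding $-(x + i\<alpha>)^2/2$ moves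
  $-i\<alpha>$ into the weight.\<close>

definition weight :: "real \<Rightarrow> real \<Rightarrow> complex" where
  "weight al be = of_real be - \<i> * of_real al"

definition ishift :: "real \<Rightarrow> complex" where
  "ishift al = \<i> * of_real al"

definition eigfun :: "real \<Rightarrow> real \<Rightarrow> nat \<Rightarrow> l2" where
  "eigfun al be n = PG (hermite (ishift al) n) (weight al be)"

definition Ap :: "real \<Rightarrow> real \<Rightarrow> complex poly \<Rightarrow> complex poly" where
  "Ap al be p = - Dp (weight al be) (Dp (weight al be) p) + Xp (Xp p)
     + smult (2 * \<i> * of_real al) (Xp p) + smult (2 * of_real be) (Dp (weight al be) p)"

definition eigval :: "real \<Rightarrow> real \<Rightarrow> nat \<Rightarrow> real" where
  "eigval al be n = 2 * real n + 1 + al\<^sup>2 + be\<^sup>2"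

lemma Ap_add: "Ap al be (p + q) = Ap al be p + Ap al be q"
  and Ap_diff: "Ap al be (p - q) = Ap al be p - Ap al be q"
  and Ap_smult: "Ap al be (smult c p) = smult c (Ap al be p)"
  by (simp_all add: Ap_def Dp_add Dp_diff Dp_smult Xp_add Xp_diff Xp_smult smult_add_right smult_diff_right mult.commute)

text \<open>A comparison of polynomial values in which the Hermite equation removes the second
  derivative. The weight is such that \<open>of_real be - w\<close> equals \<open>ishift al\<close>:
  this cancels the terms in \<open>pderiv p\<close> and those linear in \<open>x\<close>, and what
  remains of the constant is \<open>1 + al\<^sup>2 + be\<^sup>2\<close>.\<close>

lemma Ap_hermite: "Ap al be (hermite (ishift al) n) = smult (of_real (eigval al be n)) (hermite (ishift al) n)"
proof -
  define p where "p = hermite (ishift al) n"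
  define w where "w = weight al be"
  have "poly (Ap al be p) x = poly (smult (of_real (eigval al be n)) p) x" for x
  proof -
    have ode: "poly (pderiv (pderiv p)) x = (2 * ishift al + 2 * x) * poly (pderiv p) x - 2 * of_nat n * poly p x"
      using arg_cong[OF hermite_ode[of "ishift al" n], of "\<lambda>q. poly q x"] by (simp add: p_def algebra_simps eq_neg_iff_add_eq_0)
    have D: "poly (Dp w q) x = poly (pderiv q) x + (w - x) * poly q x" for q
      by (simp add: Dp_def algebra_simps)
    have pd: "poly (pderiv (Dp w p)) x = poly (pderiv (pderiv p)) x + (w - x) * poly (pderiv p) x - poly p x"
      by (simp only: Dp_def pderiv_add pderiv_mult) (simp add: pderiv_pCons algebra_simps)
    have DD: "poly (Dp w (Dp w p)) x = poly (pderiv (pderiv p)) x + 2 * (w - x) * poly (pderiv p) x + ((w - x)\<^sup>2 - 1) * poly p x"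
      unfolding D pd by (simp add: algebra_simps power2_eq_square)
    have w: "2 * of_real be - 2 * w = 2 * ishift al" by (simp add: w_def weight_def ishift_def)
    have "poly (Ap al be p) x = - poly (Dp w (Dp w p)) x + x\<^sup>2 * poly p x + 2 * ishift al * x * poly p x + 2 * of_real be * poly (Dp w p) x"
      by (simp add: Ap_def w_def[symmetric] Xp_def ishift_def power2_eq_square)
    also have "\<dots> = 2 * of_nat n * poly p x + ((2 * of_real be - 2 * w) - 2 * ishift al) * poly (pderiv p) x
        + (1 - w\<^sup>2 + 2 * of_real be * w + (2 * w + 2 * ishift al - 2 * of_real be) * x) * poly p x"
      unfolding DD D[of p] ode by (simp add: algebra_simps power2_eq_square)
    also have "2 * w + 2 * ishift al - 2 * of_real be = 0" using w by (simp add: algebra_simps)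
    also have "1 - w\<^sup>2 + 2 * of_real be * w = 1 + of_real (al\<^sup>2) + of_real (be\<^sup>2)"
      by (simp add: w_def weight_def power2_eq_square algebra_simps)
    finally show ?thesis unfolding w by (simp add: eigval_def algebra_simps)
  qed
  then show ?thesis unfolding p_def by (intro poly_eqI_degree poly_ext) (simp add: poly_eq_poly_eq_iff[symmetric] fun_eq_iff)
qed

text \<open>Moved to the other side of the inner product, the creation operator becomes d/dx + x,
  which merely differentiates the polynomial factor and adds a constant. All constants are collected
  in \<open>2 * c + w + cnj w'\<close>.\<close>

lemma cinner_hermite_Suc: "cinner (PG (hermite c (Suc j)) w) (PG q w')
  = (2 * c + w + cnj w') * cinner (PG (hermite c j) w) (PG q w') + cinner (PG (hermite c j) w) (PG (pderiv q) w')"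
proof -
  have "cinner (PG (hermite c (Suc j)) w) (PG q w') = cinner (PG (Xp (hermite c j)) w) (PG q w') + (2 * c + w) * cinner (PG (hermite c j) w) (PG q w') - cinner (PG (Dp w (hermite c j)) w) (PG q w')"
    unfolding hermite_Suc_creation[of c j w] by (simp add: PG_add PG_diff PG_smult cinner_add_left cinner_diff_left)
  also have "\<dots> = (2 * c + w) * cinner (PG (hermite c j) w) (PG q w') + cinner (PG (hermite c j) w) (PG (Xp q + Dp w' q) w')"
    unfolding cinner_Xp cinner_Dp by (simp add: PG_add cinner_add_right)
  also have "Xp q + Dp w' q = pderiv q + smult w' q" by (simp add: Dp_eq)
  finally show ?thesis by (simp add: PG_add PG_smult cinner_add_right algebra_simps)
qed

lemma cinner_hermite_Suc_left: "cinner (PG (hermite c (Suc j)) w) (PG (hermite c' k) w')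
  = (2 * c + w + cnj w') * cinner (PG (hermite c j) w) (PG (hermite c' k) w') + 2 * of_nat k * cinner (PG (hermite c j) w) (PG (hermite c' (k - 1)) w')"
  unfolding cinner_hermite_Suc pderiv_hp'[of c' k] by (simp add: PG_smult)

lemma cinner_hermite_Suc_right: "cinner (PG (hermite c j) w) (PG (hermite c' (Suc k)) w')
  = cnj (2 * c' + w' + cnj w) * cinner (PG (hermite c j) w) (PG (hermite c' k) w') + 2 * of_nat j * cinner (PG (hermite c (j - 1)) w) (PG (hermite c' k) w')"
proof -
  have "cnj (cinner (PG (hermite c' (Suc k)) w') (PG (hermite c j) w)) = cnj ((2 * c' + w' + cnj w) * cinner (PG (hermite c' k) w') (PG (hermite c j) w)
     + 2 * of_nat j * cinner (PG (hermite c' k) w') (PG (hermite c (j - 1)) w))"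
    by (simp only: cinner_hermite_Suc_left)
  then show ?thesis by (simp add: cnj_cinner del: hermite.simps)
qed

text \<open>The assumptions say that the constants in both ladder relations vanish, so the two
  indices can only decrease together.\<close>

lemma cinner_hermite_orthogonal:
  assumes "2 * c + w + cnj w' = 0" "2 * c' + w' + cnj w = 0"
  shows "cinner (PG (hermite c j) w) (PG (hermite c' k) w') = (if j = k then 2 ^ k * fact k * cinner (PG 1 w) (PG 1 w') else 0)"
proof (induction j arbitrary: k)
  case 0
  show ?case
  proof (cases k)
    case (Suc m)
    then show ?thesis using cinner_hermite_Suc_right[of c 0 w c' m w'] assms by (simp del: hermite.simps(2))
  qed simp
next
  case (Suc j)
  show ?case
  proof (cases k)
    case 0
    then show ?thesis using cinner_hermite_Suc_left[of c j w c' 0 w'] assms by (simp del: hermite.simps(2))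
  next
    case (Suc m)
    then show ?thesis using cinner_hermite_Suc_left[of c j w c' k w'] assms Suc.IH[of m] by (simp del: hermite.simps(2))
  qed
qed

text \<open>The solution of the recurrence satisfied by the inner products of the \<open>eigfun al be j\<close>.\<close>

text \<open>\<open>laguerre_neg n x\<close> is $L_n(-x)$ for the Laguerre polynomial $L_n$.\<close>

definition laguerre_neg :: "nat \<Rightarrow> real \<Rightarrow> real" where
  "laguerre_neg n x = (\<Sum>j\<le>n. real (n choose j) * x ^ j / fact j)"

definition hermite_sum :: "complex \<Rightarrow> nat \<Rightarrow> nat \<Rightarrow> complex" where
  "hermite_sum \<kappa> j k = (\<Sum>i\<le>j. of_nat ((j choose i) * (k choose i) * fact i) * 2 ^ i * \<kappa> ^ (j - i) * cnj \<kappa> ^ (k - i))"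

text \<open>Pascal's rule splits the sum. In the shifted half, absorbing \<open>Suc i\<close> into
  the binomial coefficient extracts \<open>k\<close> and lowers the upper index to
  \<open>k - 1\<close>; for \<open>k = 0\<close> the factor \<open>k\<close> makes the truncated
  subtraction harmless.\<close>

lemma hermite_sum_Suc: "hermite_sum \<kappa> (Suc j) k = \<kappa> * hermite_sum \<kappa> j k + 2 * of_nat k * hermite_sum \<kappa> j (k - 1)"
proof -
  have 1: "of_nat ((Suc j choose i) * (k choose i) * fact i) * 2 ^ i * \<kappa> ^ (Suc j - i) * cnj \<kappa> ^ (k - i)
     = of_nat ((j choose i) * (k choose i) * fact i) * 2 ^ i * \<kappa> ^ (Suc j - i) * cnj \<kappa> ^ (k - i)
     + (if i = 0 then 0 else of_nat ((j choose (i - 1)) * (k choose i) * fact i) * 2 ^ i * \<kappa> ^ (Suc j - i) * cnj \<kappa> ^ (k - i))" for i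
    by (cases i) (simp_all add: algebra_simps)
  have "hermite_sum \<kappa> (Suc j) k = (\<Sum>i\<le>Suc j. of_nat ((j choose i) * (k choose i) * fact i) * 2 ^ i * \<kappa> ^ (Suc j - i) * cnj \<kappa> ^ (k - i))
    + (\<Sum>i\<le>Suc j. if i = 0 then 0 else of_nat ((j choose (i - 1)) * (k choose i) * fact i) * 2 ^ i * \<kappa> ^ (Suc j - i) * cnj \<kappa> ^ (k - i))"
    unfolding hermite_sum_def 1 sum.distrib ..
  also have "(\<Sum>i\<le>Suc j. of_nat ((j choose i) * (k choose i) * fact i) * 2 ^ i * \<kappa> ^ (Suc j - i) * cnj \<kappa> ^ (k - i)) = \<kappa> * hermite_sum \<kappa> j k"
    unfolding hermite_sum_def sum_distrib_left by (simp add: Suc_diff_le mult_ac)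
  also have "(\<Sum>i\<le>Suc j. if i = 0 then 0 else of_nat ((j choose (i - 1)) * (k choose i) * fact i) * 2 ^ i * \<kappa> ^ (Suc j - i) * cnj \<kappa> ^ (k - i))
    = (\<Sum>i\<le>j. of_nat ((j choose i) * (k choose Suc i) * fact (Suc i)) * 2 ^ Suc i * \<kappa> ^ (j - i) * cnj \<kappa> ^ (k - Suc i))"
    by (subst sum.atMost_Suc_shift) (simp del: fact_Suc binomial_Suc_Suc)
  also have "\<dots> = 2 * of_nat k * hermite_sum \<kappa> j (k - 1)"
  proof -
    have "of_nat ((j choose i) * (k choose Suc i) * fact (Suc i)) * 2 ^ Suc i * \<kappa> ^ (j - i) * cnj \<kappa> ^ (k - Suc i)
      = 2 * of_nat k * (of_nat ((j choose i) * ((k - 1) choose i) * fact i) * 2 ^ i * \<kappa> ^ (j - i) * cnj \<kappa> ^ (k - 1 - i))" for i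
    proof -
      have "(k choose Suc i) * fact (Suc i) = k * ((k - 1) choose i) * fact i"
      proof -
        have "(k choose Suc i) * fact (Suc i) = (Suc i * (k choose Suc i)) * fact i" by (simp add: algebra_simps del: binomial_Suc_Suc)
        then show ?thesis by (simp only: binomial_absorption)
      qed
      then have "(of_nat ((k choose Suc i) * fact (Suc i)) :: complex) = of_nat (k * ((k - 1) choose i) * fact i)" by (rule arg_cong)
      then show ?thesis by (simp add: mult_ac del: fact_Suc)
    qed
    then show ?thesis unfolding hermite_sum_def sum_distrib_left by (simp only:)
  qed
  finally show ?thesis .
qed

lemma cinner_hermite_self:
  assumes "2 * c + w + cnj w = \<kappa>"
  shows "cinner (PG (hermite c j) w) (PG (hermite c k) w) = cinner (PG 1 w) (PG 1 w) * hermite_sum \<kappa> j k"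
proof (induction j arbitrary: k)
  case 0
  show ?case
  proof (induction k)
    case (Suc k)
    then show ?case using cinner_hermite_Suc_right[of c 0 w c k w] assms by (simp add: hermite_sum_def del: hermite.simps(2))
  qed (simp add: hermite_sum_def)
next
  case (Suc j)
  show ?case unfolding cinner_hermite_Suc_left assms Suc.IH hermite_sum_Suc by (simp add: algebra_simps)
qed

text \<open>After reversing the order of summation, \<open>(k choose i) * fact (k - i)\<close> is
  \<open>fact k / fact i\<close>, and the sum takes the explicit form of a Laguerre polynomial at a
  negative argument.\<close>

lemma hermite_sum_diag: "hermite_sum \<kappa> k k = of_real (2 ^ k * fact k * laguerre_neg k ((cmod \<kappa>)\<^sup>2 / 2))"
proof -
  have "hermite_sum \<kappa> k k = (\<Sum>i\<le>k. of_nat ((k choose (k - i)) * (k choose (k - i)) * fact (k - i)) * 2 ^ (k - i) * \<kappa> ^ i * cnj \<kappa> ^ i)"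
    unfolding hermite_sum_def by (rule sum.reindex_bij_witness[of _ "\<lambda>i. k - i" "\<lambda>i. k - i"]) auto
  also have "\<dots> = (\<Sum>i\<le>k. of_real (2 ^ k * fact k * (real (k choose i) * ((cmod \<kappa>)\<^sup>2 / 2) ^ i / fact i)))"
  proof (intro sum.cong refl)
    fix i assume "i \<in> {..k}"
    then have i: "i \<le> k" by simp
    have kk: "\<kappa> ^ i * cnj \<kappa> ^ i = of_real (((cmod \<kappa>)\<^sup>2) ^ i)"
      by (simp only: of_real_power[of "(cmod \<kappa>)\<^sup>2"] complex_norm_square power_mult_distrib)
    have b: "real (k choose i) * fact (k - i) = fact k / fact i"
      using binomial_fact[OF i, where 'a = real] by simp
    have "real ((k choose i) * (k choose i) * fact (k - i)) * 2 ^ (k - i) * ((cmod \<kappa>)\<^sup>2) ^ i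
       = real (k choose i) * (real (k choose i) * fact (k - i)) * (2 ^ k / 2 ^ i) * ((cmod \<kappa>)\<^sup>2) ^ i"
      using i by (simp add: power_diff)
    also have "\<dots> = 2 ^ k * fact k * (real (k choose i) * ((cmod \<kappa>)\<^sup>2 / 2) ^ i / fact i)"
      unfolding b by (simp add: power_divide mult_ac)
    finally have "complex_of_real (real ((k choose i) * (k choose i) * fact (k - i)) * 2 ^ (k - i) * ((cmod \<kappa>)\<^sup>2) ^ i) = of_real (2 ^ k * fact k * (real (k choose i) * ((cmod \<kappa>)\<^sup>2 / 2) ^ i / fact i))"
      by (rule arg_cong)
    then show "of_nat ((k choose (k - i)) * (k choose (k - i)) * fact (k - i)) * 2 ^ (k - i) * \<kappa> ^ i * cnj \<kappa> ^ i
       = complex_of_real (2 ^ k * fact k * (real (k choose i) * ((cmod \<kappa>)\<^sup>2 / 2) ^ i / fact i))"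
      unfolding mult.assoc[of _ "\<kappa> ^ i"] kk using binomial_symmetric[OF i] by simp
  qed
  also have "\<dots> = of_real (2 ^ k * fact k * laguerre_neg k ((cmod \<kappa>)\<^sup>2 / 2))"
    unfolding laguerre_neg_def sum_distrib_left of_real_sum ..
  finally show ?thesis .
qed

section \<open>Gaussian integrals\<close>

lemma cinner_PG_one: "cinner (PG 1 w) (PG 1 w') = (\<integral>x. exp (- (of_real x)\<^sup>2 + (w + cnj w') * of_real x) \<partial>lborel)"
proof -
  have "pgauss 1 w x * cnj (pgauss 1 w' x) = exp (- (of_real x)\<^sup>2 + (w + cnj w') * of_real x)" for x
    by (simp only: pgauss_def poly_1 mult_1 exp_cnj exp_add[symmetric], rule arg_cong[where f = exp]) (simp add: field_simps)
  then show ?thesis by (simp only: cinner_PG_PG)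
qed

lemma gaussian_integral_shift:
  fixes b :: real
  shows "(\<integral>x. exp (- x\<^sup>2 + 2 * b * x) \<partial>lborel) = sqrt pi * exp (b\<^sup>2)"
proof -
  have "(\<integral>x. normal_density b (1 / sqrt 2) x \<partial>lborel) = 1"
    using integral_normal_moment_even[of "1 / sqrt 2" b 0] by simp
  moreover have "exp (- x\<^sup>2 + 2 * b * x) = sqrt pi * exp (b\<^sup>2) * normal_density b (1 / sqrt 2) x" for x
    by (simp add: normal_density_def power_divide power2_diff exp_diff exp_add exp_minus field_simps)
  ultimately show ?thesis by simp
qed

text \<open>Instead of shifting a contour, the integral is rescaled by \<open>sqrt 2\<close> to the
  characteristic function of the standard normal distribution.\<close>

lemma gaussian_integral_fourier: "(\<integral>x. exp (- (of_real x)\<^sup>2 + \<i> * of_real (2 * b) * of_real x) \<partial>lborel) = complex_of_real (sqrt pi * exp (- b\<^sup>2))"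
proof -
  have "(\<integral>x. std_normal_density x *\<^sub>R iexp (sqrt 2 * b * x) \<partial>lborel) = char std_normal_distribution (sqrt 2 * b)"
    unfolding char_def by (rule integral_density[symmetric]) auto
  also have "\<dots> = of_real (exp (- b\<^sup>2))" by (simp add: char_std_normal_distribution power_mult_distrib)
  finally have "(\<integral>x. std_normal_density x *\<^sub>R iexp (sqrt 2 * b * x) \<partial>lborel) = of_real (exp (- b\<^sup>2))" .
  moreover have "(\<integral>x. std_normal_density x *\<^sub>R iexp (sqrt 2 * b * x) \<partial>lborel)
     = \<bar>sqrt 2\<bar> *\<^sub>R (\<integral>x. std_normal_density (0 + sqrt 2 * x) *\<^sub>R iexp (sqrt 2 * b * (0 + sqrt 2 * x)) \<partial>lborel)"
    by (rule lborel_integral_real_affine) simp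
  moreover have "exp (- (of_real x)\<^sup>2 + \<i> * of_real (2 * b) * of_real x)
     = of_real (sqrt pi * sqrt 2) * (std_normal_density (0 + sqrt 2 * x) *\<^sub>R iexp (sqrt 2 * b * (0 + sqrt 2 * x)))" for x
  proof -
    have "sqrt 2 * b * (0 + sqrt 2 * x) = (sqrt 2 * sqrt 2) * (b * x)" by (simp only: add_0_left mult_ac)
    then have "sqrt 2 * b * (0 + sqrt 2 * x) = 2 * b * x" by simp
    then have 1: "iexp (sqrt 2 * b * (0 + sqrt 2 * x)) = exp (\<i> * of_real (2 * b) * of_real x)"
      by (simp only: of_real_mult[symmetric] mult.assoc)
    have 2: "std_normal_density (0 + sqrt 2 * x) = 1 / (sqrt 2 * sqrt pi) * exp (- x\<^sup>2)"
      by (simp add: std_normal_density_def power_mult_distrib real_sqrt_mult)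
    have 3: "complex_of_real (exp (- x\<^sup>2)) = exp (- (of_real x)\<^sup>2)" by (simp flip: exp_of_real)
    show ?thesis unfolding 1 2 exp_add by (simp add: scaleR_conv_of_real 3 del: of_real_exp)
  qed
  ultimately show ?thesis by (simp add: scaleR_conv_of_real)
qed

section \<open>The perturbed oscillators on polynomials times Gaussians\<close>

abbreviation (input) mult_sq :: "real \<Rightarrow> complex" where
  "mult_sq \<equiv> \<lambda>x. complex_of_real (x\<^sup>2)"

abbreviation (input) mult_pot :: "real \<Rightarrow> real \<Rightarrow> complex" where
  "mult_pot al \<equiv> \<lambda>x. 2 * \<i> * complex_of_real al * complex_of_real x"

definition op_gen :: "real \<Rightarrow> real \<Rightarrow> l2_operator" where
  "op_gen al be = \<lparr> op_dom = op_dom op_T,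
     op_app = (\<lambda>f. op_app op_T f + mult_op (mult_pot al) f
        + (2 * be) *\<^sub>R weak_derivative 1 f) \<rparr>"

lemma op_L_eq: "op_L a = op_gen a 0"
  by (simp add: op_L_def op_gen_def)

lemma op_L_tilde_eq: "op_L_tilde a = op_gen 0 a"
proof -
  have "mult_op (\<lambda>x. 0) f = 0" for f by (simp add: mult_op_def zero_l2_def)
  then show ?thesis by (simp add: op_L_tilde_def op_gen_def)
qed

lemma cinner_mult_op:
  assumes "in_mult_dom m f"
  shows "cinner (mult_op m f) (PG q b) = (\<integral>x. m x * rep_l2 f x * cnj (pgauss q b x) \<partial>lborel)"
  using assms unfolding mult_op_def PG_def in_mult_dom_def by (simp add: cinner_abs square_integrable_pgauss)

text \<open>Dom(T) only speaks about x^2 f, whereas the perturbation involves x f; the bridge is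
  that \<open>x\<^sup>2\<close> is at most \<open>1 + (x\<^sup>2)\<^sup>2\<close>.\<close>

lemma in_mult_dom_linear:
  assumes "in_mult_dom mult_sq f"
  shows "in_mult_dom (\<lambda>x. c * complex_of_real x) f"
proof -
  have "square_integrable (\<lambda>x. complex_of_real x * rep_l2 f x)"
    unfolding square_integrable_def
  proof (intro conjI)
    show "integrable lborel (\<lambda>x. (cmod (complex_of_real x * rep_l2 f x))\<^sup>2)"
    proof (rule Bochner_Integration.integrable_bound)
      show "integrable lborel (\<lambda>x. (cmod (rep_l2 f x))\<^sup>2 + (cmod (complex_of_real (x\<^sup>2) * rep_l2 f x))\<^sup>2)"
        using assms unfolding in_mult_dom_def square_integrable_def by (intro Bochner_Integration.integrable_add integrable_rep) auto
      have "(cmod (complex_of_real x * rep_l2 f x))\<^sup>2 \<le> (cmod (rep_l2 f x))\<^sup>2 + (cmod (complex_of_real (x\<^sup>2) * rep_l2 f x))\<^sup>2" for x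
      proof -
        have "2 * x\<^sup>2 \<le> 1 + (x\<^sup>2)\<^sup>2" using sum_squares_bound[of 1 "x\<^sup>2"] by simp
        then have "x\<^sup>2 \<le> 1 + (x\<^sup>2)\<^sup>2" using zero_le_power2[of "x"] by linarith
        then have "x\<^sup>2 * (cmod (rep_l2 f x))\<^sup>2 \<le> (1 + (x\<^sup>2)\<^sup>2) * (cmod (rep_l2 f x))\<^sup>2" by (rule mult_right_mono) simp
        then show ?thesis by (simp add: norm_mult norm_power power_mult_distrib algebra_simps)
      qed
      then show "AE x in lborel. norm ((cmod (complex_of_real x * rep_l2 f x))\<^sup>2)
         \<le> norm ((cmod (rep_l2 f x))\<^sup>2 + (cmod (complex_of_real (x\<^sup>2) * rep_l2 f x))\<^sup>2)" by simp
    qed measurable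
  qed measurable
  from square_integrable_cmult[OF this, of c] show ?thesis by (simp add: in_mult_dom_def mult.assoc)
qed

lemma op_dom_T_iff:
  "f \<in> op_dom op_T \<longleftrightarrow> (\<exists>f1 f2. has_weak_derivative 1 f f1 \<and> has_weak_derivative 2 f f2) \<and> in_mult_dom mult_sq f"
proof -
  have "(\<forall>n\<le>2. \<exists>g. has_weak_derivative n f g) \<longleftrightarrow> (\<exists>f1 f2. has_weak_derivative 1 f f1 \<and> has_weak_derivative 2 f f2)"
    using has_weak_derivative_0 by (auto simp: le_Suc_eq numeral_2_eq_2)
  then show ?thesis by (simp add: op_T_def sobolev_def)
qed

lemma op_gen_app:
  assumes "has_weak_derivative 1 f f1" "has_weak_derivative 2 f f2"
  shows "op_app (op_gen al be) f = - f2 + mult_op mult_sq f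
     + mult_op (mult_pot al) f + (2 * be) *\<^sub>R f1"
  using weak_derivative_eq[OF assms(1)] weak_derivative_eq[OF assms(2)] by (simp add: op_gen_def op_T_def)

lemma op_gen_pairing:
  assumes "f \<in> op_dom (op_gen al be)"
  shows "cinner (op_app (op_gen al be) f) (PG q (weight (- al) (- be))) = cinner f (PG (Ap (- al) (- be) q) (weight (- al) (- be)))"
proof -
  let ?b = "weight (- al) (- be)"
  have dom: "f \<in> op_dom op_T" using assms by (simp add: op_gen_def)
  then obtain f1 f2 where w: "has_weak_derivative 1 f f1" "has_weak_derivative 2 f f2"
    and m: "in_mult_dom mult_sq f" unfolding op_dom_T_iff by blast
  have w': "has_weak_derivative 1 f1 f2" by (rule has_weak_derivative_2D[OF w])
  have 1: "cinner f2 (PG q ?b) = cinner f (PG (Dp ?b (Dp ?b q)) ?b)"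
    unfolding cinner_weak_derivative[OF w'] cinner_weak_derivative[OF w(1)] by simp
  have 2: "cinner (mult_op mult_sq f) (PG q ?b) = cinner f (PG (Xp (Xp q)) ?b)"
    unfolding cinner_mult_op[OF m] unfolding cinner_PG
    by (intro Bochner_Integration.integral_cong refl) (simp add: pgauss_Xp power2_eq_square mult_ac)
  have 3: "cinner (mult_op (mult_pot al) f) (PG q ?b) = 2 * \<i> * of_real al * cinner f (PG (Xp q) ?b)"
  proof -
    have "cinner (mult_op (mult_pot al) f) (PG q ?b)
      = (\<integral>x. 2 * \<i> * of_real al * (rep_l2 f x * cnj (pgauss (Xp q) ?b x)) \<partial>lborel)"
      unfolding cinner_mult_op[OF in_mult_dom_linear[OF m]]
      by (intro Bochner_Integration.integral_cong refl) (simp add: pgauss_Xp mult_ac)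
    then show ?thesis by (simp only: integral_mult_right_zero cinner_PG)
  qed
  show ?thesis
    unfolding op_gen_app[OF w] cinner_add_left cinner_minus_left cinner_scaleR_left 1 2 3 cinner_weak_derivative[OF w(1)]
    by (simp add: Ap_def PG_add PG_minus PG_diff PG_smult cinner_add_right cinner_diff_right)
qed

lemma op_gen_pairing_eigfun:
  assumes "f \<in> op_dom (op_gen al be)"
  shows "cinner (op_app (op_gen al be) f) (eigfun (- al) (- be) n) = of_real (eigval al be n) * cinner f (eigfun (- al) (- be) n)"
  unfolding eigfun_def op_gen_pairing[OF assms] Ap_hermite by (simp add: PG_smult eigval_def)

lemma eigfun_complete:
  assumes "\<And>n. cinner v (eigfun al be n) = 0"
  shows "v = 0"
proof (rule PG_complete)
  fix p
  obtain a where "p = (\<Sum>j\<le>degree p. smult (a j) (hermite (ishift al) j))" using poly_hermite_expansion by blast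
  then have "PG p (weight al be) = (\<Sum>j\<le>degree p. cscale (a j) (eigfun al be j))"
    unfolding eigfun_def PG_smult[symmetric] PG_sum[symmetric] by simp
  then show "cinner v (PG p (weight al be)) = 0" by (simp add: cinner_sum_right assms)
qed

section \<open>Action on polynomials times Gaussians, graph norm and closure\<close>

lemma mult_op_PG:
  assumes [measurable]: "m \<in> borel_measurable borel" and "\<And>x. m x * pgauss p b x = pgauss q b x"
  shows "in_mult_dom m (PG p b)" "mult_op m (PG p b) = PG q b"
proof -
  have ae: "AE x in lborel. m x * rep_l2 (PG p b) x = pgauss q b x"
    using rep_PG[of p b] by eventually_elim (simp add: assms)
  have [measurable]: "(\<lambda>x. m x * rep_l2 (PG p b) x) \<in> borel_measurable borel" by measurable
  have "integrable lborel (\<lambda>x. (cmod (m x * rep_l2 (PG p b) x))\<^sup>2) = integrable lborel (\<lambda>x. (cmod (pgauss q b x))\<^sup>2)"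
    by (rule integrable_cong_AE) (use ae in \<open>measurable, eventually_elim, simp\<close>)
  then have si: "square_integrable (\<lambda>x. m x * rep_l2 (PG p b) x)"
    using square_integrable_pgauss[of q b] by (simp add: square_integrable_def)
  then show "in_mult_dom m (PG p b)" by (simp add: in_mult_dom_def)
  show "mult_op m (PG p b) = PG q b"
    unfolding mult_op_def PG_def[of q] using si ae square_integrable_pgauss[of q b]
    by (intro abs_eqI) (simp add: l2_rel_def)
qed

lemma mult_op_square_PG:
  "in_mult_dom mult_sq (PG p b)" "mult_op mult_sq (PG p b) = PG (Xp (Xp p)) b"
proof -
  have m: "(\<lambda>x. complex_of_real (x\<^sup>2)) \<in> borel_measurable borel" by measurable
  have e: "complex_of_real (x\<^sup>2) * pgauss p b x = pgauss (Xp (Xp p)) b x" for x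
    by (simp add: pgauss_Xp power2_eq_square)
  show "in_mult_dom mult_sq (PG p b)" "mult_op mult_sq (PG p b) = PG (Xp (Xp p)) b"
    by (rule mult_op_PG[OF m e])+
qed

lemma mult_op_linear_PG:
  "in_mult_dom (\<lambda>x. c * complex_of_real x) (PG p b)" "mult_op (\<lambda>x. c * complex_of_real x) (PG p b) = cscale c (PG (Xp p) b)"
proof -
  have m: "(\<lambda>x. c * complex_of_real x) \<in> borel_measurable borel" by measurable
  have e: "c * complex_of_real x * pgauss p b x = pgauss (smult c (Xp p)) b x" for x
    by (simp only: pgauss_smult pgauss_Xp mult.assoc)
  show "in_mult_dom (\<lambda>x. c * complex_of_real x) (PG p b)" "mult_op (\<lambda>x. c * complex_of_real x) (PG p b) = cscale c (PG (Xp p) b)"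
    using mult_op_PG[OF m e] by (auto simp: PG_smult)
qed

text \<open>Closedness of multiplication operators: along a subsequence of a subsequence both the
  arguments and the values converge almost everywhere, where the identity can be read off.\<close>

lemma mult_op_closed:
  assumes [measurable]: "m \<in> borel_measurable borel"
    and f: "f \<longlonglongrightarrow> u" and g: "(\<lambda>n. mult_op m (f n)) \<longlonglongrightarrow> v" and dom: "\<And>n. in_mult_dom m (f n)"
  shows "in_mult_dom m u \<and> mult_op m u = v"
proof -
  have rep: "AE x in lborel. rep_l2 (mult_op m (f n)) x = m x * rep_l2 (f n) x" for n
    unfolding mult_op_def by (rule rep_abs_AE) (use dom in \<open>simp add: in_mult_dom_def\<close>)
  obtain r where r: "strict_mono r" "AE x in lborel. (\<lambda>n. rep_l2 (f (r n)) x) \<longlonglongrightarrow> rep_l2 u x"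
    using tendsto_l2_AE_subseq[OF f] by blast
  have "(\<lambda>n. mult_op m (f (r n))) \<longlonglongrightarrow> v" using LIMSEQ_subseq_LIMSEQ[OF g r(1)] by (simp add: o_def)
  then obtain s where s: "strict_mono s" "AE x in lborel. (\<lambda>n. rep_l2 (mult_op m (f (r (s n)))) x) \<longlonglongrightarrow> rep_l2 v x"
    using tendsto_l2_AE_subseq by blast
  have "AE x in lborel. \<forall>n. rep_l2 (mult_op m (f n)) x = m x * rep_l2 (f n) x"
    by (subst AE_all_countable) (use rep in blast)
  with r(2) s(2) have ae: "AE x in lborel. m x * rep_l2 u x = rep_l2 v x"
  proof eventually_elim
    case (elim x)
    have "(\<lambda>n. rep_l2 (f (r (s n))) x) \<longlonglongrightarrow> rep_l2 u x"
      using LIMSEQ_subseq_LIMSEQ[OF elim(1) s(1)] by (simp add: o_def)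
    then have "(\<lambda>n. m x * rep_l2 (f (r (s n))) x) \<longlonglongrightarrow> m x * rep_l2 u x" by (intro tendsto_intros)
    then have "(\<lambda>n. rep_l2 (mult_op m (f (r (s n)))) x) \<longlonglongrightarrow> m x * rep_l2 u x" using elim(3) by simp
    then show ?case using elim(2) LIMSEQ_unique by blast
  qed
  have "integrable lborel (\<lambda>x. (cmod (m x * rep_l2 u x))\<^sup>2) = integrable lborel (\<lambda>x. (cmod (rep_l2 v x))\<^sup>2)"
    by (rule integrable_cong_AE) (use ae in \<open>measurable, eventually_elim, simp\<close>)
  then have si: "square_integrable (\<lambda>x. m x * rep_l2 u x)"
    unfolding square_integrable_def using integrable_rep[of v] by simp
  moreover have "mult_op m u = v"
    unfolding mult_op_def using abs_eqI[of "\<lambda>x. m x * rep_l2 u x" "rep_l2 v"] si square_integrable_rep[of v] ae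
    by (simp add: l2_rel_def)
  ultimately show ?thesis by (simp add: in_mult_dom_def)
qed

lemma PG_in_dom_and_app:
  shows "PG p (weight al be) \<in> op_dom (op_gen al be)"
    and "op_app (op_gen al be) (PG p (weight al be)) = PG (Ap al be p) (weight al be)"
proof -
  let ?w = "weight al be"
  have w: "has_weak_derivative 1 (PG p ?w) (PG (Dp ?w p) ?w)" by (rule PG_has_weak_derivative)
  have w2: "has_weak_derivative 2 (PG p ?w) (PG (Dp ?w (Dp ?w p)) ?w)"
    by (rule has_weak_derivative_2I[OF PG_has_weak_derivative PG_has_weak_derivative])
  show "PG p ?w \<in> op_dom (op_gen al be)"
    using w w2 mult_op_square_PG(1) by (auto simp: op_gen_def op_dom_T_iff)
  show "op_app (op_gen al be) (PG p ?w) = PG (Ap al be p) ?w"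
    unfolding op_gen_app[OF w w2] mult_op_square_PG mult_op_linear_PG Ap_def PG_add PG_minus
    by (simp add: PG_smult scaleR_eq_cscale)
qed

lemma Re_cinner_le: "Re (cinner u v) \<le> norm u * norm v"
  using order_trans[OF complex_Re_le_cmod norm_cinner_le] .

lemma norm_sq_Re_cinner: "(norm u)\<^sup>2 = Re (cinner u u)"
  by (simp add: cinner_self del: of_real_power)

text \<open>Besides integration by parts this only uses $[D, X] = 1$: moving $D$ across $X^2$ in
  $\langle D^2u, X^2u\rangle$ leaves a term of the favourable sign and $\|u\|^2$.\<close>

lemma graph_bound:
  fixes al be :: real
  defines "w \<equiv> weight al be" and "c \<equiv> 3 + 2 * \<bar>al\<bar> + 2 * \<bar>be\<bar>"
  defines "S p \<equiv> norm (PG (Ap al be p) w) + norm (PG p w)"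
  shows "norm (PG (Dp w p) w) \<le> c * S p" "norm (PG (Xp p) w) \<le> c * S p"
    "norm (PG (Dp w (Dp w p)) w) \<le> c * S p" "norm (PG (Xp (Xp p)) w) \<le> c * S p"
    "norm (PG (- Dp w (Dp w p) + Xp (Xp p)) w) \<le> c * S p"
proof -
  define u0 where "u0 = PG p w"
  define u1 where "u1 = PG (Dp w p) w"
  define u2 where "u2 = PG (Dp w (Dp w p)) w"
  define y1 where "y1 = PG (Xp p) w"
  define y2 where "y2 = PG (Xp (Xp p)) w"
  define A where "A = PG (Ap al be p) w"
  define s where "s = S p"
  have s: "norm A \<le> s" "norm u0 \<le> s" "s \<ge> 0" by (auto simp: s_def S_def A_def u0_def)
  have A: "A = - u2 + y2 + cscale (2 * \<i> * of_real al) y1 + cscale (2 * of_real be) u1"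
    by (simp add: A_def u1_def u2_def y1_def y2_def Ap_def w_def[symmetric] PG_add PG_minus PG_diff PG_smult)
  have h1: "cinner u2 u0 = - cinner u1 u1" unfolding u2_def u0_def u1_def by (rule cinner_Dp)
  have h2: "cinner y2 u0 = cinner y1 y1" unfolding y2_def u0_def y1_def by (rule cinner_Xp)
  have h3: "cnj (cinner y1 u0) = cinner y1 u0" unfolding cnj_cinner unfolding y1_def u0_def by (rule cinner_Xp[symmetric])
  have h4: "cinner u1 u0 = - cnj (cinner u1 u0)" unfolding cnj_cinner unfolding u1_def u0_def by (rule cinner_Dp)
  have "Im (cinner y1 u0) = 0" using h3 by (simp add: complex_eq_iff)
  moreover have "Re (cinner u1 u0) = 0" using h4 by (simp add: complex_eq_iff)
  \<comment> \<open>The perturbation is invisible in the real part: the pairing of x u with u is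
    real but multiplied by 2i\<alpha>, and that of u' with u is purely imaginary.\<close>
  ultimately have "Re (cinner A u0) = (norm u1)\<^sup>2 + (norm y1)\<^sup>2"
    unfolding A norm_sq_Re_cinner by (simp add: cinner_add_left cinner_diff_left h1 h2)
  moreover have "Re (cinner A u0) \<le> s * s"
    by (rule order_trans[OF Re_cinner_le]) (intro mult_mono s; simp add: s)
  ultimately have e1: "(norm u1)\<^sup>2 + (norm y1)\<^sup>2 \<le> s\<^sup>2" by (simp add: power2_eq_square)
  have n1: "norm u1 \<le> s" by (rule power2_le_imp_le[OF _ s(3)]) (use e1 zero_le_power2[of "norm y1"] in linarith)
  have n2: "norm y1 \<le> s" by (rule power2_le_imp_le[OF _ s(3)]) (use e1 zero_le_power2[of "norm u1"] in linarith)
  have cs: "s \<le> c * s" using s(3) by (simp add: c_def mult_le_cancel_right1)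
  have T: "norm (- u2 + y2) \<le> (1 + 2 * \<bar>al\<bar> + 2 * \<bar>be\<bar>) * s"
  proof -
    have "- u2 + y2 = A - cscale (2 * \<i> * of_real al) y1 - cscale (2 * of_real be) u1" by (simp add: A)
    also have "norm \<dots> \<le> norm A + norm (cscale (2 * \<i> * of_real al) y1) + norm (cscale (2 * of_real be) u1)"
      by (intro order_trans[OF norm_triangle_ineq4] add_right_mono norm_triangle_ineq4)
    also have "\<dots> \<le> s + 2 * \<bar>al\<bar> * s + 2 * \<bar>be\<bar> * s"
      using n1 n2 s by (intro add_mono) (auto simp: norm_mult intro!: mult_left_mono)
    finally show ?thesis by (simp add: algebra_simps)
  qed
  define z where "z = PG (Xp (Dp w p)) w"
  have g1: "cinner u1 y1 = - cinner y1 u1 - cinner u0 u0"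
  proof -
    have "cinner u1 y1 = - cinner u0 (PG (Dp w (Xp p)) w)" unfolding u1_def y1_def u0_def by (rule cinner_Dp)
    also have "PG (Dp w (Xp p)) w = z + u0" by (simp add: Dp_Xp PG_add z_def u0_def)
    also have "cinner u0 (z + u0) = cinner y1 u1 + cinner u0 u0"
      unfolding cinner_add_right z_def u0_def y1_def u1_def by (simp add: cinner_Xp)
    finally show ?thesis by simp
  qed
  have "Re (cinner y1 u1) = Re (cinner u1 y1)" using arg_cong[OF cnj_cinner[of u1 y1], of Re] by simp
  then have g2: "2 * Re (cinner u1 y1) = - (norm u0)\<^sup>2" using arg_cong[OF g1, of Re] by (simp add: norm_sq_Re_cinner)
  have "cinner u2 y2 = - cinner u1 (PG (Dp w (Xp (Xp p))) w)" unfolding u2_def y2_def u1_def by (rule cinner_Dp)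
  also have "Dp w (Xp (Xp p)) = Xp (Xp (Dp w p)) + smult 2 (Xp p)"
    unfolding Dp_Xp Xp_add using smult_add_left[of 1 1 "Xp p"] by simp
  also have "cinner u1 (PG \<dots> w) = cinner z z + 2 * cinner u1 y1"
    unfolding PG_add PG_smult cinner_add_right z_def u1_def y1_def by (simp add: cinner_Xp[symmetric])
  finally have "Re (cinner u2 y2) = - (norm z)\<^sup>2 + (norm u0)\<^sup>2" using g2 by (simp add: norm_sq_Re_cinner)
  moreover have "(norm (- u2 + y2))\<^sup>2 = (norm u2)\<^sup>2 + (norm y2)\<^sup>2 - 2 * Re (cinner u2 y2)"
  proof -
    have "Re (cinner y2 u2) = Re (cinner u2 y2)" using arg_cong[OF cnj_cinner[of u2 y2], of Re] by simp
    then show ?thesis unfolding norm_sq_Re_cinner by (simp add: cinner_add_left cinner_add_right cinner_diff_left cinner_diff_right)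
  qed
  ultimately have "(norm u2)\<^sup>2 + (norm y2)\<^sup>2 \<le> (norm (- u2 + y2))\<^sup>2 + 2 * (norm u0)\<^sup>2"
    using zero_le_power2[of "norm z"] by linarith
  also have "\<dots> \<le> ((1 + 2 * \<bar>al\<bar> + 2 * \<bar>be\<bar>) * s)\<^sup>2 + 2 * s\<^sup>2"
    using T s by (intro add_mono mult_left_mono power_mono) auto
  also have "\<dots> \<le> (c * s)\<^sup>2"
  proof -
    \<comment> \<open>The 3 in \<open>c\<close> is chosen to give \<open>c = k + 2\<close>, whose
      square dominates \<open>k\<^sup>2 + 2\<close>: \<open>k\<close> comes from moving the
      perturbation to the other side, the added 2 from the commutator.\<close>
    define k where "k = 1 + 2 * \<bar>al\<bar> + 2 * \<bar>be\<bar>"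
    have "c = k + 2" "k \<ge> 0" by (auto simp: c_def k_def)
    then have "k\<^sup>2 + 2 \<le> c\<^sup>2" by (simp add: power2_sum)
    then have "(k\<^sup>2 + 2) * s\<^sup>2 \<le> c\<^sup>2 * s\<^sup>2" by (rule mult_right_mono) simp
    then show ?thesis unfolding k_def[symmetric] by (simp add: power_mult_distrib algebra_simps)
  qed
  finally have e2: "(norm u2)\<^sup>2 + (norm y2)\<^sup>2 \<le> (c * s)\<^sup>2" .
  have "c * s \<ge> 0" using cs s(3) by linarith
  show "norm (PG (Dp w p) w) \<le> c * S p" "norm (PG (Xp p) w) \<le> c * S p"
    using n1 n2 cs by (simp_all add: u1_def y1_def s_def)
  have "norm u2 \<le> c * s" by (rule power2_le_imp_le[OF _ \<open>c * s \<ge> 0\<close>]) (use e2 zero_le_power2[of "norm y2"] in linarith)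
  moreover have "norm y2 \<le> c * s" by (rule power2_le_imp_le[OF _ \<open>c * s \<ge> 0\<close>]) (use e2 zero_le_power2[of "norm u2"] in linarith)
  moreover have "norm (- u2 + y2) \<le> c * s" by (rule order_trans[OF T mult_right_mono]) (simp_all add: c_def s(3))
  ultimately show "norm (PG (Dp w (Dp w p)) w) \<le> c * S p" "norm (PG (Xp (Xp p)) w) \<le> c * S p"
    "norm (PG (- Dp w (Dp w p) + Xp (Xp p)) w) \<le> c * S p"
    by (simp_all add: u2_def y2_def s_def PG_add PG_minus PG_diff)
qed

lemma Cauchy_if_norm_diff_le:
  fixes f g h :: "nat \<Rightarrow> l2"
  assumes "\<And>m n. norm (f m - f n) \<le> C * (norm (g m - g n) + norm (h m - h n))" "C \<ge> 0" "Cauchy g" "Cauchy h"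
  shows "convergent f"
proof -
  have "Cauchy f"
  proof (rule CauchyI)
    fix e :: real assume "e > 0"
    define d where "d = e / (2 * (C + 1))"
    have "d > 0" using \<open>e > 0\<close> assms(2) by (simp add: d_def)
    obtain M where M: "\<And>m n. m \<ge> M \<Longrightarrow> n \<ge> M \<Longrightarrow> norm (g m - g n) < d" using CauchyD[OF assms(3) \<open>d > 0\<close>] by blast
    obtain N where N: "\<And>m n. m \<ge> N \<Longrightarrow> n \<ge> N \<Longrightarrow> norm (h m - h n) < d" using CauchyD[OF assms(4) \<open>d > 0\<close>] by blast
    have "norm (f m - f n) < e" if "m \<ge> max M N" "n \<ge> max M N" for m n
    proof -
      have "norm (f m - f n) \<le> C * (d + d)"
        using M[of m n] N[of m n] that assms(2) by (intro order_trans[OF assms(1)] mult_left_mono) auto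
      also have "\<dots> < (C + 1) * (d + d)" using \<open>d > 0\<close> by (simp add: algebra_simps)
      also have "\<dots> = 2 * (C + 1) * d" by (simp add: algebra_simps)
      also have "2 * (C + 1) \<noteq> 0" using assms(2) by simp
      then have "2 * (C + 1) * d = e" unfolding d_def times_divide_eq_right by (rule nonzero_mult_div_cancel_left)
      finally show ?thesis .
    qed
    then show "\<exists>M. \<forall>m\<ge>M. \<forall>n\<ge>M. norm (f m - f n) < e" by blast
  qed
  then show ?thesis by (simp add: Cauchy_convergent_iff)
qed

text \<open>Applied to differences, the graph-norm bounds make the images under d/dx, its square, x
  and x^2 convergent one by one. Weak derivatives and multiplication operators are closed, so the
  limit lies in the domain and has the expected image.\<close>

lemma op_gen_closure:
  assumes u: "(\<lambda>n. PG (p n) (weight al be)) \<longlonglongrightarrow> u" and v: "(\<lambda>n. PG (Ap al be (p n)) (weight al be)) \<longlonglongrightarrow> v"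
  shows "u \<in> op_dom (op_gen al be) \<and> op_app (op_gen al be) u = v"
proof -
  let ?w = "weight al be"
  let ?c = "3 + 2 * \<bar>al\<bar> + 2 * \<bar>be\<bar>"
  note C = LIMSEQ_imp_Cauchy[OF v] LIMSEQ_imp_Cauchy[OF u]
  have gb: "norm (PG (L (p m)) ?w - PG (L (p n)) ?w) \<le> ?c * (norm (PG (Ap al be (p m)) ?w - PG (Ap al be (p n)) ?w) + norm (PG (p m) ?w - PG (p n) ?w))"
    if "\<And>p q. L (p - q) = L p - L q" "\<And>p. norm (PG (L p) ?w) \<le> ?c * (norm (PG (Ap al be p) ?w) + norm (PG p ?w))" for L m n
    using that(2)[of "p m - p n"] by (simp add: that(1) Ap_diff PG_diff)
  have cv: "convergent (\<lambda>n. PG (L (p n)) ?w)"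
    if "\<And>p q. L (p - q) = L p - L q" "\<And>p. norm (PG (L p) ?w) \<le> ?c * (norm (PG (Ap al be p) ?w) + norm (PG p ?w))" for L
    by (rule Cauchy_if_norm_diff_le[OF gb[OF that] _ C]) auto
  obtain f1 where f1: "(\<lambda>n. PG (Dp ?w (p n)) ?w) \<longlonglongrightarrow> f1"
    using cv[of "Dp ?w"] graph_bound(1)[where al = al and be = be] by (auto simp: Dp_diff convergent_def)
  obtain f2 where f2: "(\<lambda>n. PG (Dp ?w (Dp ?w (p n))) ?w) \<longlonglongrightarrow> f2"
    using cv[of "\<lambda>p. Dp ?w (Dp ?w p)"] graph_bound(3)[where al = al and be = be] by (auto simp: Dp_diff convergent_def)
  obtain g1 where g1: "(\<lambda>n. PG (Xp (p n)) ?w) \<longlonglongrightarrow> g1"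
    using cv[of Xp] graph_bound(2)[where al = al and be = be] by (auto simp: Xp_diff convergent_def)
  obtain g2 where g2: "(\<lambda>n. PG (Xp (Xp (p n))) ?w) \<longlonglongrightarrow> g2"
    using cv[of "\<lambda>p. Xp (Xp p)"] graph_bound(4)[where al = al and be = be] by (auto simp: Xp_diff convergent_def)
  have w: "has_weak_derivative 1 u f1"
    by (rule has_weak_derivative_closed[OF u f1 PG_has_weak_derivative])
  have w2: "has_weak_derivative 2 u f2"
    by (rule has_weak_derivative_closed[OF u f2 has_weak_derivative_2I[OF PG_has_weak_derivative PG_has_weak_derivative]])
  have m2: "in_mult_dom mult_sq u \<and> mult_op mult_sq u = g2"
    by (rule mult_op_closed[OF _ u]) (use g2 mult_op_square_PG in auto)
  have m1: "in_mult_dom (mult_pot al) u \<and> mult_op (mult_pot al) u = cscale (2 * \<i> * of_real al) g1"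
    by (rule mult_op_closed[OF _ u]) (use tendsto_cscale[OF g1] mult_op_linear_PG in auto)
  have "(\<lambda>n. PG (Ap al be (p n)) ?w) \<longlonglongrightarrow> - f2 + g2 + cscale (2 * \<i> * of_real al) g1 + cscale (2 * of_real be) f1"
    unfolding Ap_def PG_add PG_minus PG_smult by (intro tendsto_add tendsto_minus tendsto_cscale f1 f2 g1 g2)
  then have "v = - f2 + g2 + cscale (2 * \<i> * of_real al) g1 + cscale (2 * of_real be) f1"
    using v LIMSEQ_unique by blast
  moreover have "op_app (op_gen al be) u = - f2 + g2 + cscale (2 * \<i> * of_real al) g1 + cscale (2 * of_real be) f1"
    unfolding op_gen_app[OF w w2] using m1 m2 by (simp add: scaleR_eq_cscale)
  moreover have "u \<in> op_dom (op_gen al be)" using w w2 m2 by (auto simp: op_gen_def op_dom_T_iff)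
  ultimately show ?thesis by simp
qed

section \<open>Norms, biorthogonality and totality of the shifted Hermite functions\<close>

lemma laguerre_neg_pos: "x \<ge> 0 \<Longrightarrow> laguerre_neg k x > 0"
proof -
  assume x: "x \<ge> 0"
  have "(\<Sum>j\<in>{0}. real (k choose j) * x ^ j / fact j) \<le> laguerre_neg k x"
    unfolding laguerre_neg_def by (rule sum_mono2) (use x in auto)
  then show ?thesis by simp
qed

text \<open>Paired with itself, the system has the ladder constant 2\<beta> + 2i\<alpha>, which
  measures how far it is from being orthogonal; half its squared modulus is the argument of the
  Laguerre polynomial.\<close>

lemma norm_eigfun_sq: "(norm (eigfun al be k))\<^sup>2 = sqrt pi * exp (be\<^sup>2) * (2 ^ k * fact k * laguerre_neg k (2 * (al\<^sup>2 + be\<^sup>2)))"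
proof -
  let ?w = "weight al be"
  have \<kappa>: "2 * ishift al + ?w + cnj ?w = Complex (2 * be) (2 * al)"
    by (simp add: ishift_def weight_def complex_eq_iff)
  have "cinner (PG 1 ?w) (PG 1 ?w) = (\<integral>x. complex_of_real (exp (- x\<^sup>2 + 2 * be * x)) \<partial>lborel)"
    unfolding cinner_PG_one
  proof (intro Bochner_Integration.integral_cong refl)
    fix x :: real
    have "- (complex_of_real x)\<^sup>2 + (?w + cnj ?w) * of_real x = of_real (- x\<^sup>2 + 2 * be * x)"
      by (simp add: weight_def)
    then show "exp (- (complex_of_real x)\<^sup>2 + (?w + cnj ?w) * of_real x) = complex_of_real (exp (- x\<^sup>2 + 2 * be * x))"
      by (simp only: exp_of_real)
  qed
  also have "\<dots> = of_real (sqrt pi * exp (be\<^sup>2))" unfolding integral_complex_of_real gaussian_integral_shift ..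
  finally have g: "cinner (PG 1 ?w) (PG 1 ?w) = of_real (sqrt pi * exp (be\<^sup>2))" .
  have c2: "(cmod (Complex (2 * be) (2 * al)))\<^sup>2 / 2 = 2 * (al\<^sup>2 + be\<^sup>2)"
    by (simp add: cmod_power2 power_mult_distrib)
  have "complex_of_real ((norm (eigfun al be k))\<^sup>2) = of_real (sqrt pi * exp (be\<^sup>2) * (2 ^ k * fact k * laguerre_neg k (2 * (al\<^sup>2 + be\<^sup>2))))"
    unfolding cinner_self[symmetric] eigfun_def cinner_hermite_self[OF \<kappa>] hermite_sum_diag g c2 of_real_mult ..
  then show ?thesis by (simp only: of_real_eq_iff)
qed

lemma eigfun_nonzero: "eigfun al be k \<noteq> 0"
  using norm_eigfun_sq[of al be k] laguerre_neg_pos[of "2 * (al\<^sup>2 + be\<^sup>2)" k] by auto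

text \<open>Negating both parameters makes the ladder constants vanish. The real parts of the
  weights cancel as well, which leaves a purely oscillatory Gaussian integral and thus the factor
  \<open>exp (- al\<^sup>2)\<close>.\<close>

lemma cinner_eigfun_dual:
  "cinner (eigfun al be j) (eigfun (- al) (- be) k) = (if j = k then of_real (sqrt pi * exp (- al\<^sup>2) * (2 ^ k * fact k)) else 0)"
proof -
  have 1: "2 * ishift al + weight al be + cnj (weight (- al) (- be)) = 0"
    and 2: "2 * ishift (- al) + weight (- al) (- be) + cnj (weight al be) = 0"
    by (simp_all add: ishift_def weight_def)
  have w: "weight al be + cnj (weight (- al) (- be)) = \<i> * of_real (2 * (- al))" by (simp add: weight_def)
  have "cinner (PG 1 (weight al be)) (PG 1 (weight (- al) (- be))) = of_real (sqrt pi * exp (- al\<^sup>2))"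
    unfolding cinner_PG_one w gaussian_integral_fourier by simp
  then show ?thesis unfolding eigfun_def cinner_hermite_orthogonal[OF 1 2] by simp
qed

text \<open>The generating set contains all complex multiples because the span is real: real
  orthogonality to the multiples by 1 and i is complex orthogonality.\<close>

lemma eigfun_total: "closure (span {cscale c (eigfun al be j) | c j. True}) = UNIV"
proof (rule dense_span_if_no_orthogonal)
  fix v assume *: "\<And>s. s \<in> {cscale c (eigfun al be j) | c j. True} \<Longrightarrow> inner v s = 0"
  have "cinner v (eigfun al be j) = 0" for j
  proof -
    have "inner v (cscale 1 (eigfun al be j)) = 0" "inner v (cscale \<i> (eigfun al be j)) = 0" by (rule *, blast)+
    then show ?thesis by (simp add: inner_eq_cinner complex_eq_iff del: cscale_one)
  qed
  then show "v = 0" by (rule eigfun_complete)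
qed

text \<open>The bound \<open>C\<close> is uniform in \<open>n\<close>, so an approximation from the
  span costs at most e/2 for all \<open>n\<close> simultaneously.\<close>

lemma tendsto_zero_from_dense:
  fixes T :: "nat \<Rightarrow> 'a::real_normed_vector \<Rightarrow> 'b::real_normed_vector"
  assumes lin: "\<And>n. linear (T n)" and bd: "\<And>n v. norm (T n v) \<le> C * norm v"
    and S: "\<And>s. s \<in> S \<Longrightarrow> (\<lambda>n. T n s) \<longlonglongrightarrow> 0" and dense: "closure (span S) = UNIV"
  shows "(\<lambda>n. T n v) \<longlonglongrightarrow> 0"
proof -
  have span: "(\<lambda>n. T n s) \<longlonglongrightarrow> 0" if "s \<in> span S" for s
    using that
  proof (induction rule: span_induct_alt)
    case base
    show ?case using lin by (simp add: linear_0)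
  next
    case (step c x y)
    have "(\<lambda>n. c *\<^sub>R T n x + T n y) \<longlonglongrightarrow> c *\<^sub>R 0 + 0" by (intro tendsto_intros S step)
    then show ?case using lin by (simp add: linear_add linear_scale)
  qed
  define K where "K = \<bar>C\<bar> + 1"
  have K: "K > 0" "C \<le> K" by (auto simp: K_def)
  show ?thesis
  proof (rule LIMSEQ_I)
    fix e :: real assume "e > 0"
    have "e / (2 * K) > 0" using \<open>e > 0\<close> K by simp
    then obtain s where s: "s \<in> span S" "dist s v < e / (2 * K)"
      using dense closure_approachable[of v "span S"] by auto
    obtain N where N: "\<And>n. n \<ge> N \<Longrightarrow> norm (T n s) < e / 2"
      using LIMSEQ_D[OF span[OF s(1)], of "e / 2"] \<open>e > 0\<close> by auto
    have "norm (T n v - 0) < e" if "n \<ge> N" for n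
    proof -
      have "T n v = T n s + T n (v - s)" using linear_diff[OF lin, of n v s] by simp
      then have "norm (T n v) \<le> norm (T n s) + C * norm (v - s)"
        using norm_triangle_ineq[of "T n s" "T n (v - s)"] bd[of n "v - s"] by simp
      also have "C * norm (v - s) \<le> K * norm (v - s)" by (rule mult_right_mono[OF K(2)]) simp
      also have "\<dots> \<le> K * (e / (2 * K))"
        using s(2) K by (intro mult_left_mono) (auto simp: dist_norm norm_minus_commute)
      also have "\<dots> = e / 2" using K by simp
      finally show ?thesis using N[OF that] by simp
    qed
    then show "\<exists>N. \<forall>n\<ge>N. norm (T n v - 0) < e" by blast
  qed
qed

section \<open>Expansions in the orthonormal Hermite functions\<close>

definition hermite_fun :: "nat \<Rightarrow> l2" where
  "hermite_fun k = cscale (of_real (1 / norm (eigfun 0 0 k))) (eigfun 0 0 k)"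

lemma cinner_hermite: "cinner (hermite_fun j) (hermite_fun k) = (if j = k then 1 else 0)"
proof (cases "j = k")
  case True
  then show ?thesis using eigfun_nonzero[of 0 0 k] by (simp add: hermite_fun_def cinner_self power2_eq_square norm_divide)
next
  case False
  then show ?thesis using cinner_eigfun_dual[of 0 0 j k] by (simp add: hermite_fun_def)
qed

definition hermite_proj :: "nat \<Rightarrow> l2 \<Rightarrow> l2" where
  "hermite_proj M u = (\<Sum>k<M. cscale (cinner u (hermite_fun k)) (hermite_fun k))"

lemma cinner_hermite_proj: "cinner (hermite_proj M u) (hermite_fun k) = (if k < M then cinner u (hermite_fun k) else 0)"
  by (simp add: hermite_proj_def cinner_sum_left cinner_hermite sum.delta if_distrib cong: if_cong)

lemma cinner_proj_self: "cinner v (hermite_proj M u) = (\<Sum>k<M. cinner v (hermite_fun k) * cnj (cinner u (hermite_fun k)))"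
  by (simp add: hermite_proj_def cinner_sum_right mult.commute)

lemma hermite_residual: "(norm (u - hermite_proj M u))\<^sup>2 = (norm u)\<^sup>2 - (\<Sum>k<M. (cmod (cinner u (hermite_fun k)))\<^sup>2)"
proof -
  define s where "s = (\<Sum>k<M. (cmod (cinner u (hermite_fun k)))\<^sup>2)"
  have 1: "cinner u (hermite_proj M u) = of_real s"
    unfolding cinner_proj_self s_def of_real_sum complex_norm_square ..
  have 2: "cinner (hermite_proj M u) (hermite_proj M u) = of_real s"
    unfolding cinner_proj_self[of "hermite_proj M u"] s_def of_real_sum complex_norm_square by (simp add: cinner_hermite_proj)
  have 3: "cinner (hermite_proj M u) u = of_real s" using 1 cnj_cinner[of u "hermite_proj M u"] by simp
  show ?thesis unfolding norm_sq_Re_cinner s_def[symmetric]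
    by (simp add: cinner_diff_left cinner_diff_right 1 2 3)
qed

lemma bessel_hermite: "(\<Sum>k<M. (cmod (cinner u (hermite_fun k)))\<^sup>2) \<le> (norm u)\<^sup>2"
  using hermite_residual[of u M] zero_le_power2[of "norm (u - hermite_proj M u)"] by linarith

lemma linear_hermite_proj: "linear (hermite_proj M)"
  unfolding hermite_proj_def
  by (intro linearI) (simp_all add: cinner_add_left cscale_add_left sum.distrib cinner_scaleR_left
      scaleR_eq_cscale cscale_sum)

text \<open>The residual maps are contractions, and on each multiple of a Hermite function they
  vanish from some index on.\<close>

lemma hermite_proj_tendsto: "(\<lambda>M. u - hermite_proj M u) \<longlonglongrightarrow> 0"
proof (rule tendsto_zero_from_dense[where C = 1 and S = "{cscale c (eigfun 0 0 j) | c j. True}"])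
  show "linear (\<lambda>u. u - hermite_proj M u)" for M by (intro linear_compose_sub linear_ident linear_hermite_proj)
  show "norm (v - hermite_proj M v) \<le> 1 * norm v" for M v
  proof -
    have "(norm (v - hermite_proj M v))\<^sup>2 \<le> (norm v)\<^sup>2" using hermite_residual[of v M] by (simp add: sum_nonneg)
    then show ?thesis by (simp add: power2_le_iff_abs_le)
  qed
  fix s assume "s \<in> {cscale c (eigfun 0 0 j) | c j. True}"
  then obtain c j where s: "s = cscale c (eigfun 0 0 j)" by blast
  then have s': "s = cscale (c * of_real (norm (eigfun 0 0 j))) (hermite_fun j)" using eigfun_nonzero[of 0 0 j] by (simp add: hermite_fun_def)
  have "s - hermite_proj M s = 0" if "M > j" for M
  proof -
    have "hermite_proj M s = (\<Sum>k<M. if j = k then s else 0)"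
      unfolding hermite_proj_def by (intro sum.cong refl) (simp add: s' cinner_hermite)
    then show ?thesis using that by (simp add: sum.delta)
  qed
  then show "(\<lambda>M. s - hermite_proj M s) \<longlonglongrightarrow> 0"
    by (intro tendsto_eventually eventually_sequentiallyI[of "Suc j"]) auto
qed (rule eigfun_total)

text \<open>Here \<open>v\<close> plays the role of T u: each coefficient beyond \<open>M\<close> is
  at most 1/(2M + 1) times that of \<open>v\<close>, and Bessel's inequality bounds the latter. This
  uniform tail replaces a compact embedding of Dom(T).\<close>

lemma hermite_tail_bound:
  assumes "\<And>k. cinner v (hermite_fun k) = of_real (2 * real k + 1) * cinner u (hermite_fun k)"
  shows "norm (u - hermite_proj M u) \<le> norm v / (2 * real M + 1)"
proof -
  define S where "S N = (\<Sum>k<N. (cmod (cinner u (hermite_fun k)))\<^sup>2)" for N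
  have lim: "S \<longlonglongrightarrow> (norm u)\<^sup>2"
  proof -
    have "(\<lambda>N. (norm u)\<^sup>2 - (norm (u - hermite_proj N u))\<^sup>2) \<longlonglongrightarrow> (norm u)\<^sup>2 - (norm (0::l2))\<^sup>2"
      by (intro tendsto_intros hermite_proj_tendsto)
    then show ?thesis by (simp add: hermite_residual S_def[abs_def])
  qed
  have "S N - S M \<le> (norm v / (2 * real M + 1))\<^sup>2" if "N \<ge> M" for N
  proof -
    have "S N - S M = (\<Sum>k\<in>{M..<N}. (cmod (cinner u (hermite_fun k)))\<^sup>2)"
      unfolding S_def using sum_diff_nat_ivl[of 0 M N "\<lambda>k. (cmod (cinner u (hermite_fun k)))\<^sup>2"] that by (simp add: lessThan_atLeast0)
    also have "\<dots> \<le> (\<Sum>k\<in>{M..<N}. (cmod (cinner v (hermite_fun k)))\<^sup>2 / (2 * real M + 1)\<^sup>2)"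
    proof (rule sum_mono)
      fix k assume "k \<in> {M..<N}"
      then have "(2 * real M + 1)\<^sup>2 \<le> (2 * real k + 1)\<^sup>2" by (intro power_mono) auto
      then have "(2 * real M + 1)\<^sup>2 * (cmod (cinner u (hermite_fun k)))\<^sup>2 \<le> (2 * real k + 1)\<^sup>2 * (cmod (cinner u (hermite_fun k)))\<^sup>2"
        by (rule mult_right_mono) simp
      also have "\<dots> = (cmod (cinner v (hermite_fun k)))\<^sup>2"
        unfolding assms norm_mult power_mult_distrib by (simp only: norm_of_real power2_abs)
      finally show "(cmod (cinner u (hermite_fun k)))\<^sup>2 \<le> (cmod (cinner v (hermite_fun k)))\<^sup>2 / (2 * real M + 1)\<^sup>2"
        by (subst pos_le_divide_eq) (simp_all add: mult.commute zero_less_power)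
    qed
    also have "\<dots> = (\<Sum>k\<in>{M..<N}. (cmod (cinner v (hermite_fun k)))\<^sup>2) / (2 * real M + 1)\<^sup>2"
      by (rule sum_divide_distrib[symmetric])
    also have "\<dots> \<le> (norm v)\<^sup>2 / (2 * real M + 1)\<^sup>2"
    proof (rule divide_right_mono)
      have "(\<Sum>k\<in>{M..<N}. (cmod (cinner v (hermite_fun k)))\<^sup>2) \<le> (\<Sum>k<N. (cmod (cinner v (hermite_fun k)))\<^sup>2)"
        by (rule sum_mono2) auto
      then show "(\<Sum>k\<in>{M..<N}. (cmod (cinner v (hermite_fun k)))\<^sup>2) \<le> (norm v)\<^sup>2" using bessel_hermite[of v N] by linarith
    qed simp
    finally show ?thesis by (simp add: power_divide)
  qed
  then have "(norm u)\<^sup>2 - S M \<le> (norm v / (2 * real M + 1))\<^sup>2"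
    by (intro LIMSEQ_le_const2[OF tendsto_diff[OF lim tendsto_const]]) blast
  then have "(norm (u - hermite_proj M u))\<^sup>2 \<le> (norm v / (2 * real M + 1))\<^sup>2"
    by (simp add: hermite_residual S_def)
  then show ?thesis by (rule power2_le_imp_le) auto
qed

text \<open>Symmetry of T, with the weight \<open>w\<close> on one side and the unshifted Gaussian
  on the other. It supplies the hypothesis of the tail bound for every polynomial times the weight
  of A.\<close>

lemma oscillator_pairing_hermite:
  "cinner (PG (- Dp w (Dp w p) + Xp (Xp p)) w) (hermite_fun k) = of_real (2 * real k + 1) * cinner (PG p w) (hermite_fun k)"
proof -
  have "cinner (PG (- Dp w (Dp w p) + Xp (Xp p)) w) (PG q 0) = cinner (PG p w) (PG (Ap 0 0 q) 0)" for q
  proof -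
    have "cinner (PG (Dp w (Dp w p)) w) (PG q 0) = cinner (PG p w) (PG (Dp 0 (Dp 0 q)) 0)" by (simp add: cinner_Dp)
    moreover have "cinner (PG (Xp (Xp p)) w) (PG q 0) = cinner (PG p w) (PG (Xp (Xp q)) 0)" by (simp add: cinner_Xp)
    ultimately show ?thesis
      by (simp add: Ap_def weight_def PG_add PG_minus PG_diff cinner_add_left cinner_add_right cinner_diff_left cinner_diff_right)
  qed
  from this[of "hermite (ishift 0) k"] have "cinner (PG (- Dp w (Dp w p) + Xp (Xp p)) w) (eigfun 0 0 k) = of_real (2 * real k + 1) * cinner (PG p w) (eigfun 0 0 k)"
    unfolding Ap_hermite eigfun_def by (simp add: weight_def eigval_def PG_smult)
  then show ?thesis by (simp add: hermite_fun_def)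
qed

text \<open>If $\|u_n\| = 1$ and $(\<zeta> - A)u_n \to 0$, then pairing with the adjoint eigenfunctions shows that $u_n$ is
  weakly null; since the graph norms are bounded, the Hermite expansions of the $u_n$ have uniformly
  small tails, so $u_n \to 0$ in norm.\<close>

lemma core_lower_bound:
  assumes \<zeta>: "\<And>n. \<zeta> \<noteq> of_real (eigval al be n)"
  shows "\<exists>c>0. \<forall>p. c * norm (PG p (weight al be)) \<le> norm (cscale \<zeta> (PG p (weight al be)) - PG (Ap al be p) (weight al be))"
proof (rule ccontr)
  let ?w = "weight al be"
  assume "\<not> ?thesis"
  then have *: "\<exists>p. norm (cscale \<zeta> (PG p ?w) - PG (Ap al be p) ?w) < c * norm (PG p ?w)" if "c > 0" for c
    using that by (metis not_le)
  have "\<exists>p. norm (cscale \<zeta> (PG p ?w) - PG (Ap al be p) ?w) < 1 / real (Suc n) * norm (PG p ?w)" for n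
    by (rule *) simp
  then obtain q where q: "\<And>n. norm (cscale \<zeta> (PG (q n) ?w) - PG (Ap al be (q n)) ?w) < 1 / real (Suc n) * norm (PG (q n) ?w)"
    by metis
  define p where "p n = smult (of_real (1 / norm (PG (q n) ?w))) (q n)" for n
  define u where "u n = PG (p n) ?w" for n
  define r where "r n = cscale \<zeta> (u n) - PG (Ap al be (p n)) ?w" for n
  have pos: "norm (PG (q n) ?w) > 0" for n
    using le_less_trans[OF norm_ge_zero q[of n]] by (simp add: zero_less_divide_iff)
  have u1: "norm (u n) = 1" for n using pos[of n] by (simp add: u_def p_def PG_smult norm_divide)
  have r1: "norm (r n) < 1 / real (Suc n)" for n
  proof -
    have "r n = cscale (of_real (1 / norm (PG (q n) ?w))) (cscale \<zeta> (PG (q n) ?w) - PG (Ap al be (q n)) ?w)"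
      by (simp add: r_def u_def p_def PG_smult Ap_smult cscale_diff mult.commute)
    then have "norm (r n) = norm (cscale \<zeta> (PG (q n) ?w) - PG (Ap al be (q n)) ?w) / norm (PG (q n) ?w)" by (simp add: norm_divide)
    also have "\<dots> < 1 / real (Suc n)" using q[of n] pos[of n] by (subst pos_divide_less_eq) (auto simp: mult.commute)
    finally show ?thesis .
  qed
  have "r \<longlonglongrightarrow> 0"
    by (rule Lim_null_comparison[OF _ LIMSEQ_inverse_real_of_nat]) (use less_imp_le[OF r1] in \<open>auto simp: inverse_eq_divide intro!: always_eventually\<close>)
  have g: "(\<lambda>n. cinner (u n) (eigfun (- al) (- be) j)) \<longlonglongrightarrow> 0" for j
  proof -
    have "cinner (r n) (eigfun (- al) (- be) j) = (\<zeta> - of_real (eigval al be j)) * cinner (u n) (eigfun (- al) (- be) j)" for n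
      using op_gen_pairing_eigfun[OF PG_in_dom_and_app(1)[where p = "p n" and al = al and be = be], where n = j]
      by (simp add: r_def u_def cinner_diff_left PG_in_dom_and_app(2) algebra_simps)
    then have "cinner (u n) (eigfun (- al) (- be) j) = cinner (r n) (eigfun (- al) (- be) j) / (\<zeta> - of_real (eigval al be j))" for n
      using \<zeta>[of j] by simp
    moreover have "(\<lambda>n. cinner (r n) (eigfun (- al) (- be) j) / (\<zeta> - of_real (eigval al be j))) \<longlonglongrightarrow> cinner 0 (eigfun (- al) (- be) j) / (\<zeta> - of_real (eigval al be j))"
      by (intro tendsto_intros tendsto_cinner_left \<open>r \<longlonglongrightarrow> 0\<close>) (use \<zeta>[of j] in auto)
    ultimately show ?thesis by simp
  qed
  have weak: "(\<lambda>n. cinner v (u n)) \<longlonglongrightarrow> 0" for v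
  proof (rule tendsto_zero_from_dense[where C = 1, OF _ _ _ eigfun_total[of "- al" "- be"]])
    show "linear (\<lambda>v. cinner v (u n))" for n using bounded_linear_cinner_left bounded_linear.linear by blast
    show "cmod (cinner v (u n)) \<le> 1 * norm v" for n v using norm_cinner_le[of v "u n"] by (simp add: u1)
    fix s assume "s \<in> {cscale c (eigfun (- al) (- be) j) |c j. True}"
    then obtain c j where s: "s = cscale c (eigfun (- al) (- be) j)" by blast
    have "(\<lambda>n. c * cnj (cinner (u n) (eigfun (- al) (- be) j))) \<longlonglongrightarrow> c * cnj 0" by (intro tendsto_intros g)
    then show "(\<lambda>n. cinner s (u n)) \<longlonglongrightarrow> 0" by (simp add: s cnj_cinner)
  qed
  \<comment> \<open>The graph-norm constant times the bound \<open>cmod \<zeta> + 1\<close> for the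
    norm of A u_n, plus the norm 1 of u_n.\<close>
  define B where "B = (3 + 2 * \<bar>al\<bar> + 2 * \<bar>be\<bar>) * (cmod \<zeta> + 2)"
  have tail: "norm (u n - hermite_proj M (u n)) \<le> B / (2 * real M + 1)" for n M
  proof -
    have "norm (u n - hermite_proj M (u n)) \<le> norm (PG (- Dp ?w (Dp ?w (p n)) + Xp (Xp (p n))) ?w) / (2 * real M + 1)"
      unfolding u_def by (rule hermite_tail_bound[OF oscillator_pairing_hermite])
    also have "\<dots> \<le> B / (2 * real M + 1)"
    proof (rule divide_right_mono)
      have "norm (PG (Ap al be (p n)) ?w) \<le> cmod \<zeta> + 1"
      proof -
        have "PG (Ap al be (p n)) ?w = cscale \<zeta> (u n) - r n" by (simp add: r_def)
        then have "norm (PG (Ap al be (p n)) ?w) \<le> norm (cscale \<zeta> (u n)) + norm (r n)" by (simp only: norm_triangle_ineq4)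
        also have "\<dots> \<le> cmod \<zeta> + 1"
        proof -
          have "1 / real (Suc n) \<le> 1" by simp
          then have "norm (r n) \<le> 1" using r1[of n] by linarith
          then show ?thesis using u1[of n] by simp
        qed
        finally show ?thesis .
      qed
      then have "norm (PG (Ap al be (p n)) ?w) + norm (PG (p n) ?w) \<le> cmod \<zeta> + 2" using u1[of n] by (simp add: u_def)
      then have "(3 + 2 * \<bar>al\<bar> + 2 * \<bar>be\<bar>) * (norm (PG (Ap al be (p n)) ?w) + norm (PG (p n) ?w)) \<le> B"
        unfolding B_def by (rule mult_left_mono) simp
      then show "norm (PG (- Dp ?w (Dp ?w (p n)) + Xp (Xp (p n))) ?w) \<le> B"
        using graph_bound(5)[where al = al and be = be and p = "p n"] by linarith
    qed simp
    finally show ?thesis .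
  qed
  \<comment> \<open>With tails of norm at most 1/2, the first \<open>M\<close> coefficients carry at
    least 3/4 of the unit mass for every \<open>n\<close>; yet each of these finitely many
    coefficients tends to 0.\<close>
  obtain M :: nat where M: "2 * B < real M" using reals_Archimedean2 by blast
  have "B \<ge> 0" by (simp add: B_def)
  then have M2: "(B / (2 * real M + 1))\<^sup>2 \<le> (1/2)\<^sup>2" using M by (intro power_mono) (auto simp: divide_simps)
  have "1 \<le> (1/2)\<^sup>2 + (\<Sum>k<M. (cmod (cinner (u n) (hermite_fun k)))\<^sup>2)" for n
  proof -
    have "(norm (u n - hermite_proj M (u n)))\<^sup>2 \<le> (B / (2 * real M + 1))\<^sup>2" by (intro power_mono tail) simp
    then show ?thesis using hermite_residual[of "u n" M] M2 u1[of n] by simp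
  qed
  moreover have "(\<lambda>n. (1/2)\<^sup>2 + (\<Sum>k<M. (cmod (cinner (u n) (hermite_fun k)))\<^sup>2)) \<longlonglongrightarrow> (1/2)\<^sup>2 + (\<Sum>k<M. (cmod (cnj 0))\<^sup>2)"
  proof (intro tendsto_add tendsto_const tendsto_sum tendsto_power tendsto_norm)
    show "(\<lambda>n. cinner (u n) (hermite_fun k)) \<longlonglongrightarrow> cnj 0" for k
      using tendsto_cnj[OF weak[of "hermite_fun k"]] by (simp add: cnj_cinner)
  qed
  ultimately have "1 \<le> (1/2)\<^sup>2 + (\<Sum>k<M. (cmod (cnj 0))\<^sup>2)" by (intro LIMSEQ_le_const) auto
  then show False by (simp add: power2_eq_square)
qed

section \<open>Resolvents and spectral projections\<close>

abbreviation "off_spectrum al be \<zeta> \<equiv> (\<forall>n. \<zeta> \<noteq> complex_of_real (eigval al be n))"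

lemma resolvent_equation_pairing:
  assumes "u \<in> op_dom (op_gen al be)" "cscale \<zeta> u - op_app (op_gen al be) u = f" "off_spectrum al be \<zeta>"
  shows "cinner u (eigfun (- al) (- be) n) = cinner f (eigfun (- al) (- be) n) / (\<zeta> - of_real (eigval al be n))"
proof -
  have "cinner f (eigfun (- al) (- be) n) = (\<zeta> - of_real (eigval al be n)) * cinner u (eigfun (- al) (- be) n)"
    unfolding assms(2)[symmetric] by (simp add: cinner_diff_left op_gen_pairing_eigfun[OF assms(1)] algebra_simps)
  then show ?thesis using assms(3) by simp
qed

lemma eigfun_eqI:
  assumes "\<And>n. cinner u (eigfun al be n) = cinner v (eigfun al be n)"
  shows "u = v"
  using eigfun_complete[of "u - v" al be] assms by (simp add: cinner_diff_left)

text \<open>On the core, \<zeta> - A multiplies each f_j by a non-zero number, so its range contains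
  their span and is dense. The lower bound makes preimages of a convergent sequence Cauchy, and
  closure turns their limit into a solution. The constant \<open>c\<close> is the same for all
  \<open>f\<close>, which later makes the solution operator bounded.\<close>

lemma resolvent_equation_solvable:
  assumes "off_spectrum al be \<zeta>"
  shows "\<exists>c>0. \<forall>f. \<exists>u\<in>op_dom (op_gen al be). cscale \<zeta> u - op_app (op_gen al be) u = f \<and> c * norm u \<le> norm f"
proof -
  let ?w = "weight al be"
  let ?Z = "\<lambda>p. cscale \<zeta> (PG p ?w) - PG (Ap al be p) ?w"
  obtain c where c: "c > 0" "\<And>p. c * norm (PG p ?w) \<le> norm (?Z p)"
    using core_lower_bound[of \<zeta> al be] assms by blast
  have "\<exists>u\<in>op_dom (op_gen al be). cscale \<zeta> u - op_app (op_gen al be) u = f \<and> c * norm u \<le> norm f" for f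
  proof -
    have range: "\<exists>p. s = ?Z p" if "s \<in> span {cscale d (eigfun al be j) | d j. True}" for s
      using that
    proof (induction rule: span_induct_alt)
      case base
      show ?case by (intro exI[of _ 0]) (simp add: Ap_def Dp_def Xp_def)
    next
      case (step r x y)
      then obtain d j p where x: "x = cscale d (eigfun al be j)" and y: "y = ?Z p" by blast
      define t where "t = d / (\<zeta> - of_real (eigval al be j))"
      define q where "q = smult t (hermite (ishift al) j)"
      have "\<zeta> - of_real (eigval al be j) \<noteq> 0" using assms by simp
      then have "t * (\<zeta> - of_real (eigval al be j)) = d" by (simp add: t_def)
      then have t: "\<zeta> * t - t * of_real (eigval al be j) = d" by (simp add: algebra_simps)
      have "x = ?Z q"
        unfolding x q_def eigfun_def Ap_smult Ap_hermite PG_smult cscale_cscale cscale_diff_left[symmetric] t ..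
      then have "r *\<^sub>R x + y = ?Z (smult (of_real r) q + p)"
        by (simp add: y Ap_add Ap_smult PG_add PG_smult cscale_add scaleR_eq_cscale cscale_diff mult.commute)
      then show ?case by blast
    qed
    have "f \<in> closure (span {cscale d (eigfun al be j) | d j. True})" by (simp only: eigfun_total UNIV_I)
    then obtain s where s: "\<And>n. s n \<in> span {cscale d (eigfun al be j) | d j. True}" "s \<longlonglongrightarrow> f"
      unfolding closure_sequential by blast
    obtain p where p: "\<And>n. s n = ?Z (p n)" using range[OF s(1)] by metis
    have Z: "(\<lambda>n. ?Z (p n)) \<longlonglongrightarrow> f" using s(2) by (simp add: p[abs_def])
    have "convergent (\<lambda>n. PG (p n) ?w)"
    proof (rule Cauchy_if_norm_diff_le[where C = "1 / c" and g = s and h = "\<lambda>_. 0"])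
      show "norm (PG (p m) ?w - PG (p n) ?w) \<le> 1 / c * (norm (s m - s n) + norm (0 - (0::l2)))" for m n
        using c(2)[of "p m - p n"] c(1)
        by (simp add: p PG_diff Ap_diff cscale_diff field_simps)
      show "Cauchy s" by (rule LIMSEQ_imp_Cauchy[OF s(2)])
    qed (use c(1) in \<open>auto simp: Cauchy_def\<close>)
    then obtain u where u: "(\<lambda>n. PG (p n) ?w) \<longlonglongrightarrow> u" by (auto simp: convergent_def)
    have "(\<lambda>n. cscale \<zeta> (PG (p n) ?w) - ?Z (p n)) \<longlonglongrightarrow> cscale \<zeta> u - f"
      by (intro tendsto_diff tendsto_cscale u Z)
    then have "(\<lambda>n. PG (Ap al be (p n)) ?w) \<longlonglongrightarrow> cscale \<zeta> u - f" by simp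
    from op_gen_closure[OF u this] have "u \<in> op_dom (op_gen al be)" "op_app (op_gen al be) u = cscale \<zeta> u - f" by auto
    moreover have "c * norm u \<le> norm f"
      by (rule LIMSEQ_le[OF tendsto_mult[OF tendsto_const tendsto_norm[OF u]] tendsto_norm[OF Z]]) (use c(2) in blast)
    ultimately show ?thesis by (intro bexI[of _ u]) auto
  qed
  then show ?thesis using c(1) by blast
qed

lemma is_resolvent_pairing:
  assumes "is_resolvent (op_gen al be) \<zeta> R" "off_spectrum al be \<zeta>"
  shows "cinner (blinfun_apply R f) (eigfun (- al) (- be) n) = cinner f (eigfun (- al) (- be) n) / (\<zeta> - of_real (eigval al be n))"
  using assms by (intro resolvent_equation_pairing) (auto simp: is_resolvent_def)

text \<open>A solution is chosen for each \<open>f\<close>. Its pairings with the g_n are linear in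
  \<open>f\<close> and determine it, so the choice is automatically linear and also a left
  inverse.\<close>

lemma is_resolvent_exists:
  assumes "off_spectrum al be \<zeta>"
  shows "\<exists>R. is_resolvent (op_gen al be) \<zeta> R"
proof -
  obtain c where c: "c > 0" "\<And>f. \<exists>u\<in>op_dom (op_gen al be). cscale \<zeta> u - op_app (op_gen al be) u = f \<and> c * norm u \<le> norm f"
    using resolvent_equation_solvable[OF assms] by blast
  obtain r where r: "\<And>f. r f \<in> op_dom (op_gen al be)" "\<And>f. cscale \<zeta> (r f) - op_app (op_gen al be) (r f) = f"
    "\<And>f. c * norm (r f) \<le> norm f" using c(2) by metis
  note rp = resolvent_equation_pairing[OF r(1) r(2) assms]
  have "bounded_linear r"
  proof (rule bounded_linear_intro[where K = "1 / c"])
    show "r (f + g) = r f + r g" for f g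
      by (rule eigfun_eqI[of _ "- al" "- be"]) (simp add: cinner_add_left rp add_divide_distrib)
    show "r (t *\<^sub>R f) = t *\<^sub>R r f" for t f
      by (rule eigfun_eqI[of _ "- al" "- be"]) (simp add: cinner_scaleR_left rp)
    show "norm (r f) \<le> norm f * (1 / c)" for f
      using r(3)[of f] c(1) by (simp add: field_simps)
  qed
  then have app: "blinfun_apply (Blinfun r) = r" by (rule bounded_linear_Blinfun_apply)
  have "is_resolvent (op_gen al be) \<zeta> (Blinfun r)"
    unfolding is_resolvent_def app
  proof (intro conjI allI ballI r(1,2))
    fix u assume u: "u \<in> op_dom (op_gen al be)"
    show "r (cscale \<zeta> u - op_app (op_gen al be) u) = u"
      by (rule eigfun_eqI[of _ "- al" "- be"]) (simp only: rp resolvent_equation_pairing[OF u refl assms])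
  qed
  then show ?thesis by blast
qed

lemma is_resolvent_unique:
  assumes "is_resolvent (op_gen al be) \<zeta> R" "is_resolvent (op_gen al be) \<zeta> R'" "off_spectrum al be \<zeta>"
  shows "R = R'"
  by (rule blinfun_eqI, rule eigfun_eqI[of _ "- al" "- be"])
    (simp only: is_resolvent_pairing[OF assms(1,3)] is_resolvent_pairing[OF assms(2,3)])

lemma resolvent_pairing:
  assumes "off_spectrum al be \<zeta>"
  shows "cinner (blinfun_apply (resolvent (op_gen al be) \<zeta>) f) (eigfun (- al) (- be) n)
    = cinner f (eigfun (- al) (- be) n) / (\<zeta> - of_real (eigval al be n))"
proof -
  have "is_resolvent (op_gen al be) \<zeta> (resolvent (op_gen al be) \<zeta>)"
    unfolding resolvent_def
    by (rule theI') (use is_resolvent_exists[OF assms] is_resolvent_unique[OF _ _ assms] in blast)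
  then show ?thesis by (rule is_resolvent_pairing[OF _ assms])
qed

section \<open>The contour integral of the resolvent\<close>

lemma cscale_op_apply [simp]: "blinfun_apply (cscale_op c) = cscale c"
  by (rule cscale_op.rep_eq)

lemma norm_cscale_op_le: "norm (cscale_op c) \<le> cmod c"
  by (rule norm_blinfun_bound) auto

lemma bounded_linear_cscale_op: "bounded_linear cscale_op"
proof (rule bounded_linear_intro[where K = 1])
  show "cscale_op (x + y) = cscale_op x + cscale_op y" for x y
    by (rule blinfun_eqI) (simp add: cscale_add_left blinfun.add_left)
  show "cscale_op (r *\<^sub>R x) = r *\<^sub>R cscale_op x" for r x
    by (rule blinfun_eqI) (simp add: scaleR_eq_cscale blinfun.scaleR_left scaleR_conv_of_real)
qed (use norm_cscale_op_le in auto)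

text \<open>Norm continuity is what makes the operator-valued contour integral exist. It follows
  from the first resolvent identity, itself verified by pairings. The norm of the resolvent near
  \<open>z\<close> is controlled by the same identity: half of it is absorbed into the left-hand
  side.\<close>

lemma continuous_on_resolvent: "continuous_on {\<zeta>. off_spectrum al be \<zeta>} (resolvent (op_gen al be))"
proof (rule continuous_onI)
  let ?R = "resolvent (op_gen al be)"
  fix z and e :: real assume z: "z \<in> {\<zeta>. off_spectrum al be \<zeta>}" and "e > 0"
  define N where "N = norm (?R z)"
  have "N \<ge> 0" by (simp add: N_def)
  define K where "K = N + 1"
  have K: "K > 0" "N \<le> K" using \<open>N \<ge> 0\<close> by (auto simp: K_def)
  \<comment> \<open>The first bound permits the absorption, the second makes the final estimate at
    most \<open>e\<close>; \<open>K\<close> is positive even if \<open>N\<close> is 0.\<close>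
  define d where "d = min (1 / (2 * K)) (e / (2 * K\<^sup>2))"
  have "d > 0" using \<open>e > 0\<close> K by (auto simp: d_def)
  have "dist (?R y) (?R z) \<le> e" if y: "y \<in> {\<zeta>. off_spectrum al be \<zeta>}" "dist y z < d" for y
  proof -
    have id: "?R y - ?R z = cscale_op (z - y) o\<^sub>L (?R y o\<^sub>L ?R z)"
    proof (rule blinfun_eqI, rule eigfun_eqI[of _ "- al" "- be"])
      fix f n
      have ne: "y - of_real (eigval al be n) \<noteq> 0" "z - of_real (eigval al be n) \<noteq> 0" using y z by auto
      have "cinner (blinfun_apply (?R y - ?R z) f) (eigfun (- al) (- be) n)
          = cinner f (eigfun (- al) (- be) n) / (y - of_real (eigval al be n)) - cinner f (eigfun (- al) (- be) n) / (z - of_real (eigval al be n))"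
        using y z by (simp add: blinfun.diff_left cinner_diff_left resolvent_pairing)
      also have "\<dots> = (z - y) * (cinner f (eigfun (- al) (- be) n) / (z - of_real (eigval al be n)) / (y - of_real (eigval al be n)))"
        using ne by (simp add: field_simps)
      also have "\<dots> = cinner (blinfun_apply (cscale_op (z - y) o\<^sub>L (?R y o\<^sub>L ?R z)) f) (eigfun (- al) (- be) n)"
        using y z by (simp add: resolvent_pairing)
      finally show "cinner (blinfun_apply (?R y - ?R z) f) (eigfun (- al) (- be) n)
          = cinner (blinfun_apply (cscale_op (z - y) o\<^sub>L (?R y o\<^sub>L ?R z)) f) (eigfun (- al) (- be) n)" .
    qed
    have b: "norm (?R y - ?R z) \<le> dist y z * (norm (?R y) * N)"
    proof -
      have "norm (?R y - ?R z) \<le> norm (cscale_op (z - y)) * (norm (?R y) * norm (?R z))"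
        unfolding id by (intro order_trans[OF norm_blinfun_compose] mult_left_mono norm_blinfun_compose) auto
      also have "\<dots> \<le> dist y z * (norm (?R y) * N)"
        using norm_cscale_op_le[of "z - y"] by (intro mult_mono) (auto simp: N_def dist_norm norm_minus_commute)
      finally show ?thesis .
    qed
    have half: "dist y z * N \<le> 1 / 2"
    proof -
      have "dist y z * N \<le> 1 / (2 * K) * K"
        using y(2) K \<open>N \<ge> 0\<close> by (intro mult_mono) (auto simp: d_def)
      then show ?thesis using K by simp
    qed
    have "norm (?R y) \<le> 2 * N"
    proof -
      have "norm (?R y) \<le> N + dist y z * N * norm (?R y)"
        using norm_triangle_ineq[of "?R z" "?R y - ?R z"] b by (simp add: N_def mult_ac)
      also have "\<dots> \<le> N + 1 / 2 * norm (?R y)" using half by (intro add_left_mono mult_right_mono) auto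
      finally show ?thesis by simp
    qed
    have "dist (?R y) (?R z) \<le> dist y z * (2 * N * N)"
      unfolding dist_norm[of "?R y"]
      by (rule order_trans[OF b]) (intro mult_left_mono mult_right_mono \<open>norm (?R y) \<le> 2 * N\<close> \<open>N \<ge> 0\<close> zero_le_dist)
    also have "\<dots> \<le> e / (2 * K\<^sup>2) * (2 * K\<^sup>2)"
    proof (rule mult_mono)
      show "2 * N * N \<le> 2 * K\<^sup>2" using K \<open>N \<ge> 0\<close> by (simp add: power2_eq_square mult_mono)
    qed (use y(2) \<open>N \<ge> 0\<close> \<open>e > 0\<close> in \<open>auto simp: d_def\<close>)
    also have "\<dots> = e" using K by simp
    finally show ?thesis .
  qed
  then show "\<exists>d>0. \<forall>x'\<in>{\<zeta>. off_spectrum al be \<zeta>}. dist x' z < d \<longrightarrow> dist (?R x') (?R z) \<le> e"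
    using \<open>d > 0\<close> by blast
qed

lemma dist_eigval: "dist (complex_of_real (eigval al be k)) (of_real (eigval al be n)) = 2 * \<bar>real k - real n\<bar>"
  unfolding dist_of_real dist_real_def by (auto simp: eigval_def abs_if)

lemma dist_eigval_ge:
  assumes "n \<noteq> k"
  shows "2 \<le> dist (complex_of_real (eigval al be k)) (of_real (eigval al be n))"
proof -
  consider "Suc n \<le> k" | "Suc k \<le> n" using assms by linarith
  then have "real (Suc n) \<le> real k \<or> real (Suc k) \<le> real n" by cases (simp_all only: of_nat_le_iff simp_thms)
  then show ?thesis unfolding dist_eigval by auto
qed

lemma sphere_off_spectrum:
  assumes "0 < \<epsilon>" "\<epsilon> < 2" "\<zeta> \<in> sphere (of_real (eigval al be k)) \<epsilon>"
  shows "off_spectrum al be \<zeta>"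
proof (intro allI notI)
  fix n assume "\<zeta> = of_real (eigval al be n)"
  then have "dist (complex_of_real (eigval al be k)) (of_real (eigval al be n)) = \<epsilon>" using assms(3) by simp
  then show False using assms(1,2) dist_eigval_ge[of n k al be] by (cases "n = k") auto
qed

lemma cauchy_kernel_circle_integral:
  assumes "0 < \<epsilon>" "\<epsilon> < 2"
  shows "((\<lambda>\<zeta>. 1 / (\<zeta> - of_real (eigval al be n))) has_contour_integral (if n = k then 2 * of_real pi * \<i> else 0))
     (circlepath (of_real (eigval al be k)) \<epsilon>)"
proof (cases "n = k")
  case True
  have "((\<lambda>u. 1 / (u - of_real (eigval al be k))) has_contour_integral 2 * of_real pi * \<i> * 1) (circlepath (of_real (eigval al be k)) \<epsilon>)"
    using Cauchy_integral_circlepath_simple[of "\<lambda>_. 1" "of_real (eigval al be k)" \<epsilon> "of_real (eigval al be k)"] assms by simp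
  then show ?thesis using True by simp
next
  case False
  have "of_real (eigval al be n) \<notin> ball (complex_of_real (eigval al be k)) 2"
    using dist_eigval_ge[OF False, of al be] by (simp add: not_less)
  then have "(\<lambda>\<zeta>. 1 / (\<zeta> - of_real (eigval al be n))) holomorphic_on ball (of_real (eigval al be k)) 2"
    by (intro holomorphic_intros) auto
  then have "((\<lambda>\<zeta>. 1 / (\<zeta> - of_real (eigval al be n))) has_contour_integral 0) (circlepath (of_real (eigval al be k)) \<epsilon>)"
    by (rule Cauchy_theorem_disc_simple) (use assms in auto)
  then show ?thesis using False by simp
qed

text \<open>Applying an operator to \<open>f\<close> and pairing with a fixed vector is a bounded
  linear functional of the operator, so it passes through the integral and leaves a scalar Cauchy
  kernel.\<close>

lemma op_contour_integral_pairing: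
  assumes "0 < \<epsilon>" "\<epsilon> < 2"
    and I: "has_op_contour_integral (resolvent (op_gen al be)) I (circlepath (of_real (eigval al be k)) \<epsilon>)"
  shows "cinner (blinfun_apply I f) (eigfun (- al) (- be) n) = (if n = k then 2 * of_real pi * \<i> * cinner f (eigfun (- al) (- be) n) else 0)"
proof -
  let ?\<gamma> = "circlepath (complex_of_real (eigval al be k)) \<epsilon>"
  let ?g = "eigfun (- al) (- be) n"
  let ?vd = "\<lambda>t. vector_derivative ?\<gamma> (at t within {0..1})"
  have bl: "bounded_linear (\<lambda>X. cinner (blinfun_apply X f) ?g)"
    by (rule bounded_linear_compose[OF bounded_linear_cinner_left blinfun.bounded_linear_left])
  have int: "((\<lambda>t. cinner (blinfun_apply (cscale_op (?vd t) o\<^sub>L resolvent (op_gen al be) (?\<gamma> t)) f) ?g) has_integral cinner (blinfun_apply I f) ?g) {0..1}"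
    using has_integral_linear[OF I[unfolded has_op_contour_integral_def] bl] by (simp add: o_def)
  have eq: "cinner (blinfun_apply (cscale_op (?vd t) o\<^sub>L resolvent (op_gen al be) (?\<gamma> t)) f) ?g
      = cinner f ?g * (1 / (?\<gamma> t - of_real (eigval al be n)) * ?vd t)" if "t \<in> {0..1}" for t
  proof -
    have "?\<gamma> t \<in> path_image ?\<gamma>" using that by (auto simp: path_image_def)
    then have "off_spectrum al be (?\<gamma> t)"
      using assms by (intro sphere_off_spectrum[of \<epsilon> _ al be k]) auto
    then show ?thesis by (simp add: resolvent_pairing)
  qed
  have 1: "((\<lambda>t. cinner f ?g * (1 / (?\<gamma> t - of_real (eigval al be n)) * ?vd t)) has_integral cinner (blinfun_apply I f) ?g) {0..1}"
    by (rule has_integral_eq[OF eq int])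
  have "((\<lambda>t. cinner f ?g * (1 / (?\<gamma> t - of_real (eigval al be n)) * ?vd t)) has_integral cinner f ?g * (if n = k then 2 * of_real pi * \<i> else 0)) {0..1}"
    by (rule has_integral_mult_right) (use cauchy_kernel_circle_integral[OF assms(1,2), of al be n k] in \<open>simp add: has_contour_integral_def\<close>)
  from has_integral_unique[OF 1 this] show ?thesis by simp
qed

lemma op_contour_integral_exists:
  assumes "0 < \<epsilon>" "\<epsilon> < 2"
  shows "\<exists>I. has_op_contour_integral (resolvent (op_gen al be)) I (circlepath (of_real (eigval al be k)) \<epsilon>)"
proof -
  let ?\<gamma> = "circlepath (complex_of_real (eigval al be k)) \<epsilon>"
  have sub: "?\<gamma> ` {0..1} \<subseteq> {\<zeta>. off_spectrum al be \<zeta>}"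
  proof
    fix z assume "z \<in> ?\<gamma> ` {0..1}"
    then have "z \<in> path_image ?\<gamma>" by (simp add: path_image_def)
    then show "z \<in> {\<zeta>. off_spectrum al be \<zeta>}"
      using assms sphere_off_spectrum[of \<epsilon> z al be k] by auto
  qed
  have "continuous_on {0..1} ?\<gamma>" using path_circlepath by (simp add: path_def)
  then have c1: "continuous_on {0..1} (\<lambda>t. resolvent (op_gen al be) (?\<gamma> t))"
    by (rule continuous_on_compose2[OF continuous_on_resolvent _ sub])
  have c2: "continuous_on {0..1} (\<lambda>t. cscale_op (vector_derivative ?\<gamma> (at t within {0..1})))"
  proof -
    have "continuous_on {0..1} (\<lambda>t. cscale_op (2 * pi * \<i> * \<epsilon> * exp (2 * of_real pi * \<i> * of_real t)))"
      by (intro bounded_linear.continuous_on[OF bounded_linear_cscale_op] continuous_intros)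
    then show ?thesis
      by (rule continuous_on_eq) (simp add: vector_derivative_circlepath01)
  qed
  have "(\<lambda>t. cscale_op (vector_derivative ?\<gamma> (at t within {0..1})) o\<^sub>L resolvent (op_gen al be) (?\<gamma> t)) integrable_on {0..1}"
    by (intro integrable_continuous_real bounded_bilinear.continuous_on[OF bounded_bilinear_blinfun_compose] c1 c2)
  then show ?thesis unfolding has_op_contour_integral_def integrable_on_def by blast
qed

section \<open>Eigenvalues and the norm of the spectral projections\<close>

lemma eigfun_eigenvector:
  "eigfun al be n \<in> op_dom (op_gen al be)" "op_app (op_gen al be) (eigfun al be n) = cscale (of_real (eigval al be n)) (eigfun al be n)"
  unfolding eigfun_def by (simp_all add: PG_in_dom_and_app Ap_hermite PG_smult)

text \<open>Any eigenvector has a non-zero pairing with some g_n by completeness, which fixes its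
  eigenvalue. The exact set matters because the admissible radii of the contour are defined through
  it.\<close>

lemma eigenvalues_op_gen: "eigenvalues (op_gen al be) = range (\<lambda>n. complex_of_real (eigval al be n))"
proof (intro equalityI subsetI)
  fix \<mu> assume "\<mu> \<in> eigenvalues (op_gen al be)"
  then obtain u where u: "u \<in> op_dom (op_gen al be)" "u \<noteq> 0" "op_app (op_gen al be) u = cscale \<mu> u"
    by (auto simp: eigenvalues_def)
  obtain n where n: "cinner u (eigfun (- al) (- be) n) \<noteq> 0" using eigfun_complete[of u "- al" "- be"] u(2) by auto
  have "\<mu> = of_real (eigval al be n)" using op_gen_pairing_eigfun[OF u(1), of n] n by (simp add: u(3))
  then show "\<mu> \<in> range (\<lambda>n. complex_of_real (eigval al be n))" by blast
next
  fix \<mu> assume "\<mu> \<in> range (\<lambda>n. complex_of_real (eigval al be n))"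
  then obtain n where "\<mu> = of_real (eigval al be n)" by auto
  then show "\<mu> \<in> eigenvalues (op_gen al be)"
    unfolding eigenvalues_def by (intro CollectI bexI[of _ "eigfun al be n"]) (simp_all only: eigfun_eigenvector eigfun_nonzero simp_thms not_False_eq_True)
qed

lemma spectral_projection_pairing:
  assumes "is_spectral_projection (op_gen al be) (of_real (eigval al be k)) P"
  shows "cinner (blinfun_apply P f) (eigfun (- al) (- be) n) = (if n = k then cinner f (eigfun (- al) (- be) n) else 0)"
proof -
  obtain \<epsilon> I where e: "\<epsilon> > 0" "\<And>\<mu>. \<mu> \<in> eigenvalues (op_gen al be) - {of_real (eigval al be k)} \<Longrightarrow> \<epsilon> < dist (of_real (eigval al be k)) \<mu>"
    and I: "has_op_contour_integral (resolvent (op_gen al be)) I (circlepath (of_real (eigval al be k)) \<epsilon>)"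
    and P: "P = cscale_op (1 / (2 * complex_of_real pi * \<i>)) o\<^sub>L I"
    using assms unfolding is_spectral_projection_def by blast
  \<comment> \<open>The upper neighbour exists for every \<open>k\<close>, including 0, and its
    distance 2 bounds the radius.\<close>
  have "complex_of_real (eigval al be (Suc k)) \<in> eigenvalues (op_gen al be) - {of_real (eigval al be k)}"
    unfolding eigenvalues_op_gen by (intro DiffI rangeI) (simp add: eigval_def)
  from e(2)[OF this] have "\<epsilon> < 2" unfolding dist_eigval by simp
  then show ?thesis
    unfolding P by (simp add: op_contour_integral_pairing[OF e(1) _ I])
qed

lemma is_spectral_projection_exists:
  "\<exists>P. is_spectral_projection (op_gen al be) (of_real (eigval al be k)) P"
proof -
  obtain I where I: "has_op_contour_integral (resolvent (op_gen al be)) I (circlepath (of_real (eigval al be k)) 1)"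
    using op_contour_integral_exists[of 1 al be k] by auto
  have "1 < dist (complex_of_real (eigval al be k)) \<mu>" if "\<mu> \<in> eigenvalues (op_gen al be) - {of_real (eigval al be k)}" for \<mu>
  proof -
    obtain n where n: "\<mu> = of_real (eigval al be n)" using \<open>\<mu> \<in> _\<close> by (auto simp: eigenvalues_op_gen)
    then have "n \<noteq> k" using that by auto
    then show ?thesis unfolding n using dist_eigval_ge[of n k al be] by linarith
  qed
  moreover have "sphere (complex_of_real (eigval al be k)) 1 \<subseteq> resolvent_set (op_gen al be)"
    unfolding resolvent_set_def using is_resolvent_exists sphere_off_spectrum[of 1 _ al be k] by auto
  ultimately have "is_spectral_projection (op_gen al be) (of_real (eigval al be k)) (cscale_op (1 / (2 * complex_of_real pi * \<i>)) o\<^sub>L I)"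
    unfolding is_spectral_projection_def by (intro exI[of _ 1] conjI ballI exI[of _ I] I refl zero_less_one)
  then show ?thesis by blast
qed

lemma norm_spectral_projection:
  "norm (spectral_projection (op_gen al be) (of_real (eigval al be k))) = exp (al\<^sup>2 + be\<^sup>2) * laguerre_neg k (2 * (al\<^sup>2 + be\<^sup>2))"
proof -
  define P where "P = spectral_projection (op_gen al be) (of_real (eigval al be k))"
  have unique: "P1 = P2" if "is_spectral_projection (op_gen al be) (of_real (eigval al be k)) P1"
    "is_spectral_projection (op_gen al be) (of_real (eigval al be k)) P2" for P1 P2
    by (rule blinfun_eqI, rule eigfun_eqI[of _ "- al" "- be"])
      (simp only: spectral_projection_pairing[OF that(1)] spectral_projection_pairing[OF that(2)])
  have "\<exists>!P. is_spectral_projection (op_gen al be) (of_real (eigval al be k)) P"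
    using is_spectral_projection_exists unique by (rule ex_ex1I)
  then have P: "is_spectral_projection (op_gen al be) (of_real (eigval al be k)) P"
    unfolding P_def spectral_projection_def by (rule theI')
  define f where "f = eigfun al be k"
  define g where "g = eigfun (- al) (- be) k"
  define K where "K = sqrt pi * exp (- al\<^sup>2) * (2 ^ k * fact k)"
  have "K > 0" by (simp add: K_def)
  \<comment> \<open>Rank one: by biorthogonality both sides have the same pairing with every
    g_n.\<close>
  have app: "blinfun_apply P v = cscale (cinner v g / of_real K) f" for v
    by (rule eigfun_eqI[of _ "- al" "- be"])
      (use \<open>K > 0\<close> in \<open>simp add: spectral_projection_pairing[OF P] f_def g_def cinner_eigfun_dual K_def\<close>)
  \<comment> \<open>The norm formula contains only the squares of the parameters, so negating both
    changes nothing.\<close>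
  have ng: "norm f = norm g"
  proof (rule power2_eq_imp_eq)
    show "(norm f)\<^sup>2 = (norm g)\<^sup>2" unfolding f_def g_def norm_eigfun_sq by simp
  qed auto
  have "norm g > 0" by (simp add: g_def eigfun_nonzero)
  have "norm P = (norm f)\<^sup>2 / K"
  proof (rule antisym)
    show "norm P \<le> (norm f)\<^sup>2 / K"
    proof (rule norm_blinfun_bound)
      fix v
      have "norm (blinfun_apply P v) = cmod (cinner v g) / K * norm f" using \<open>K > 0\<close> by (simp add: app norm_divide)
      also have "\<dots> \<le> norm v * norm g / K * norm f"
        using \<open>K > 0\<close> by (intro mult_right_mono divide_right_mono norm_cinner_le) auto
      finally show "norm (blinfun_apply P v) \<le> (norm f)\<^sup>2 / K * norm v" by (simp add: ng power2_eq_square mult_ac)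
    qed (use \<open>K > 0\<close> in auto)
    \<comment> \<open>The Cauchy-Schwarz bound is attained at \<open>g\<close>.\<close>
    have "norm (blinfun_apply P g) = (norm g)\<^sup>2 / K * norm f"
      using \<open>K > 0\<close> by (simp add: app cinner_self norm_divide norm_power del: of_real_power)
    then have "(norm f)\<^sup>2 / K * norm g \<le> norm P * norm g" using norm_blinfun[of P g] by (simp add: ng)
    then show "(norm f)\<^sup>2 / K \<le> norm P" using \<open>norm g > 0\<close> by (simp only: mult_le_cancel_right_pos)
  qed
  also have "\<dots> = exp (al\<^sup>2 + be\<^sup>2) * laguerre_neg k (2 * (al\<^sup>2 + be\<^sup>2))"
  proof -
    have "exp (al\<^sup>2 + be\<^sup>2) * exp (- al\<^sup>2) = exp (be\<^sup>2)" by (simp flip: exp_add)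
    then have "(norm f)\<^sup>2 = exp (al\<^sup>2 + be\<^sup>2) * laguerre_neg k (2 * (al\<^sup>2 + be\<^sup>2)) * K"
      unfolding f_def norm_eigfun_sq K_def by (simp add: mult_ac)
    then show ?thesis using \<open>K > 0\<close> by simp
  qed
  finally show ?thesis by (simp only: P_def)
qed

section \<open>Asymptotics of Laguerre polynomials\<close>

text \<open>Expanding the binomial and integrating over the circle yields $L_n(-sc)$ for all $s$ and $c$. The choice
  $s = \sqrt{x/n}$, $c = \sqrt{xn}$ puts the saddle point at $t = 0$: the exponent is then
  $2\sqrt{xn}\cos t - (x/2)e^{-2it} + O(n^{-1/2})$, uniformly in $t$.\<close>

definition lag_integrand :: "nat \<Rightarrow> real \<Rightarrow> real \<Rightarrow> real \<Rightarrow> complex" where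
  "lag_integrand n s c t = (1 + of_real s * cis (- t)) ^ n * exp (of_real c * cis t)"

lemma exp_div_power_contour_integral:
  "((\<lambda>u. exp (of_real c * u) / u ^ Suc j) has_contour_integral (2 * pi * \<i> * of_real c ^ j / fact j)) (circlepath 0 1)"
proof -
  have der: "(deriv ^^ j) (\<lambda>u. exp (of_real c * u)) = (\<lambda>u. complex_of_real c ^ j * exp (of_real c * u))" for j
  proof (induction j)
    case (Suc j)
    have "deriv (\<lambda>u. complex_of_real c ^ j * exp (of_real c * u)) u = complex_of_real c ^ Suc j * exp (of_real c * u)" for u
      by (rule DERIV_imp_deriv) (auto intro!: derivative_eq_intros)
    then show ?case using Suc by auto
  qed auto
  have "((\<lambda>u. exp (of_real c * u) / (u - 0) ^ Suc j) has_contour_integral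
     (2 * pi * \<i> / fact j * (deriv ^^ j) (\<lambda>u. exp (of_real c * u)) 0)) (circlepath 0 1)"
    by (rule Cauchy_has_contour_integral_higher_derivative_circlepath)
      (auto intro!: continuous_intros holomorphic_intros)
  then show ?thesis unfolding der by simp
qed

lemma laguerre_neg_integral:
  "(lag_integrand n s c has_integral of_real (2 * pi * laguerre_neg n (s * c))) {0..2*pi}"
proof -
  have "((\<lambda>u. \<Sum>j\<le>n. of_nat (n choose j) * of_real s ^ j * (exp (of_real c * u) / u ^ Suc j)) has_contour_integral
     (\<Sum>j\<le>n. of_nat (n choose j) * of_real s ^ j * (2 * pi * \<i> * of_real c ^ j / fact j))) (circlepath 0 1)"
    by (intro has_contour_integral_sum has_contour_integral_lmul exp_div_power_contour_integral) auto
  also have "(\<Sum>j\<le>n. of_nat (n choose j) * of_real s ^ j * (2 * pi * \<i> * of_real c ^ j / fact j))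
      = \<i> * of_real (2 * pi * laguerre_neg n (s * c))"
    unfolding laguerre_neg_def
    by (simp add: sum_distrib_left sum_distrib_right power_mult_distrib mult_ac)
  finally have "((\<lambda>t. (\<Sum>j\<le>n. of_nat (n choose j) * of_real s ^ j * (exp (of_real c * cis t) / cis t ^ Suc j)) * \<i> * cis t)
      has_integral \<i> * of_real (2 * pi * laguerre_neg n (s * c))) {0..2*pi}"
    unfolding circlepath_def by (subst (asm) has_contour_integral_part_circlepath_iff) auto
  \<comment> \<open>Removes the factor i that comes from the derivative of the circle; the
    accompanying \<open>cis t\<close> cancels one power of the denominator.\<close>
  from has_integral_mult_right[OF this, of "- \<i>"]
  have "((\<lambda>t. - \<i> * ((\<Sum>j\<le>n. of_nat (n choose j) * of_real s ^ j * (exp (of_real c * cis t) / cis t ^ Suc j)) * \<i> * cis t))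
      has_integral of_real (2 * pi * laguerre_neg n (s * c))) {0..2*pi}" by simp
  also have "(\<lambda>t. - \<i> * ((\<Sum>j\<le>n. of_nat (n choose j) * of_real s ^ j * (exp (of_real c * cis t) / cis t ^ Suc j)) * \<i> * cis t))
     = lag_integrand n s c"
  proof
    fix t
    have i: "- \<i> * (S * \<i> * w) = S * w" for S w :: complex
      by (simp add: mult_ac)
    have "- \<i> * ((\<Sum>j\<le>n. of_nat (n choose j) * of_real s ^ j * (exp (of_real c * cis t) / cis t ^ Suc j)) * \<i> * cis t)
      = (\<Sum>j\<le>n. of_nat (n choose j) * of_real s ^ j * (exp (of_real c * cis t) / cis t ^ Suc j) * cis t)"
      unfolding i by (rule sum_distrib_right)
    also have "\<dots> = (\<Sum>j\<le>n. of_nat (n choose j) * (of_real s * cis (- t)) ^ j * 1 ^ (n - j)) * exp (of_real c * cis t)"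
      unfolding sum_distrib_right
      by (intro sum.cong refl) (simp add: power_mult_distrib field_simps flip: cis_inverse)
    also have "\<dots> = lag_integrand n s c t"
      unfolding lag_integrand_def by (subst binomial_ring[symmetric]) (simp add: add.commute)
    finally show "- \<i> * ((\<Sum>j\<le>n. of_nat (n choose j) * of_real s ^ j * (exp (of_real c * cis t) / cis t ^ Suc j)) * \<i> * cis t)
      = lag_integrand n s c t" .
  qed
  finally show ?thesis .
qed

lemma lag_integrand_reflect: "lag_integrand n s c (2 * pi - t) = cnj (lag_integrand n s c t)"
proof -
  have "cis (2 * pi - t) = cnj (cis t)" "cis (- (2 * pi - t)) = cnj (cis (- t))"
    by (auto simp: complex_eq_iff cos_diff sin_diff)
  then show ?thesis by (simp add: lag_integrand_def exp_cnj)
qed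

text \<open>The reflection t to 2 pi - t conjugates the integrand. On the half interval the saddle
  point is the left endpoint and the only zero of \<open>1 - cos t\<close>.\<close>

lemma laguerre_neg_integral_half:
  "((\<lambda>t. Re (lag_integrand n s c t)) has_integral pi * laguerre_neg n (s * c)) {0..pi}"
proof -
  let ?h = "\<lambda>t. Re (lag_integrand n s c t)"
  have cont: "continuous_on A ?h" for A unfolding lag_integrand_def by (intro continuous_intros)
  then obtain I where I: "(?h has_integral I) {0..pi}" using integrable_continuous_real by blast
  have "((\<lambda>t. ?h (-1 *\<^sub>R t + 2 * pi)) has_integral (1 / (\<bar>-1\<bar> ^ DIM(real))) *\<^sub>R I)
     ((\<lambda>t. (1 / (-1)) *\<^sub>R t + - ((1 / (-1)) *\<^sub>R (2 * pi))) ` cbox 0 pi)"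
    by (rule has_integral_affinity) (use I in auto)
  moreover have "(\<lambda>t. (1 / (-1)) *\<^sub>R t + - ((1 / (-1)) *\<^sub>R (2 * pi))) ` cbox 0 pi = {pi..2*pi}"
  proof -
    have "(\<lambda>t. (1 / (-1)) *\<^sub>R t + - ((1 / (-1)) *\<^sub>R (2 * pi))) = (\<lambda>t. 2 * pi - t)" by auto
    then show ?thesis by (simp add: image_diff_atLeastAtMost)
  qed
  moreover have "?h (-1 *\<^sub>R t + 2 * pi) = ?h t" for t using lag_integrand_reflect[of n s c t] by (simp add: add.commute)
  ultimately have "(?h has_integral I) {pi..2*pi}" by simp
  with I have "(?h has_integral (I + I)) {0..2*pi}" by (intro has_integral_combine[of 0 pi]) auto
  moreover have "(?h has_integral (2 * pi * laguerre_neg n (s * c))) {0..2*pi}"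
    using has_integral_Re[OF laguerre_neg_integral[of n s c]] by simp
  ultimately have "I + I = 2 * pi * laguerre_neg n (s * c)" by (rule has_integral_unique)
  then show ?thesis using I by simp
qed

section \<open>Uniform approximation of the integrand\<close>

lemma norm_power_diff_le:
  fixes a b :: complex
  assumes "norm a \<le> M" "norm b \<le> M" "M \<ge> 1"
  shows "norm (a ^ n - b ^ n) \<le> n * M ^ n * norm (a - b)"
proof (induction n)
  case (Suc n)
  have "a ^ Suc n - b ^ Suc n = a * (a ^ n - b ^ n) + (a - b) * b ^ n" by (simp add: algebra_simps)
  then have "norm (a ^ Suc n - b ^ Suc n) \<le> norm a * norm (a ^ n - b ^ n) + norm (a - b) * norm b ^ n"
    by (metis norm_triangle_ineq norm_mult norm_power)
  also have "\<dots> \<le> M * (n * M ^ n * norm (a - b)) + norm (a - b) * M ^ Suc n"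
  proof (intro add_mono mult_mono)
    have "norm b ^ n \<le> M ^ n" by (intro power_mono assms) auto
    also have "\<dots> \<le> M ^ Suc n" using assms(3) by (simp add: power_increasing)
    finally show "norm b ^ n \<le> M ^ Suc n" .
  qed (use assms Suc in auto)
  finally show ?case by (simp add: algebra_simps)
qed auto

text \<open>The multiplicative form of log(1 + z) = z - z^2/2 + O(z^3). Avoiding the logarithm keeps
  the estimate valid on the closed unit disc, including z = -1.\<close>

lemma one_plus_mult_exp_minus_bound:
  fixes z :: complex
  assumes "norm z \<le> 1"
  shows "norm ((1 + z) * exp (- z) - exp (- z\<^sup>2 / 2)) \<le> 12 * norm z ^ 3"
proof -
  have e3: "exp (1::real) \<le> 3" by (rule exp_le)
  define E where "E = exp (- z) - (1 - z + z\<^sup>2 / 2)"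
  define F where "F = exp (- z\<^sup>2 / 2) - (1 - z\<^sup>2 / 2)"
  have "norm E \<le> exp (norm (- z)) * norm (- z) ^ Suc 2 / fact 2"
    using Taylor_exp_field[of "- z" 2] by (simp add: E_def numeral_2_eq_2)
  also have "\<dots> \<le> 3 * norm z ^ 3 / 2"
  proof -
    have "exp (norm z) \<le> 3" using assms e3 by (smt (verit) exp_le_cancel_iff)
    then show ?thesis by (simp add: numeral_3_eq_3 mult_right_mono)
  qed
  finally have E: "norm E \<le> 3 * norm z ^ 3 / 2" .
  have nz2: "norm (- z\<^sup>2 / 2) = norm z ^ 2 / 2" by (simp add: norm_divide norm_power)
  have "norm z ^ 2 \<le> 1" using assms by (simp add: power_le_one)
  have "norm F \<le> exp (norm (- z\<^sup>2 / 2)) * norm (- z\<^sup>2 / 2) ^ Suc 1 / fact 1"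
    using Taylor_exp_field[of "- z\<^sup>2 / 2" 1] by (simp add: F_def)
  also have "\<dots> = exp (norm z ^ 2 / 2) * (norm z ^ 2 / 2) ^ 2" unfolding nz2 by (simp add: numeral_2_eq_2)
  also have "\<dots> \<le> 3 * (norm z ^ 3 / 4)"
  proof (rule mult_mono)
    have "norm z ^ 2 / 2 \<le> 1" using \<open>norm z ^ 2 \<le> 1\<close> by linarith
    then have "exp (norm z ^ 2 / 2) \<le> exp 1" by (simp only: exp_le_cancel_iff)
    then show "exp (norm z ^ 2 / 2) \<le> 3" using e3 by linarith
    have "norm z ^ 4 \<le> norm z ^ 3" using assms by (intro power_decreasing) auto
    then show "(norm z ^ 2 / 2) ^ 2 \<le> norm z ^ 3 / 4" by (simp add: power_divide flip: power_mult)
  qed auto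
  finally have F: "norm F \<le> 3 * norm z ^ 3 / 4" by simp
  \<comment> \<open>\<open>E\<close> and \<open>F\<close> are Taylor remainders, and (1 + z)(1 - z +
    z^2/2) = 1 - z^2/2 + z^3/2.\<close>
  have "(1 + z) * exp (- z) - exp (- z\<^sup>2 / 2) = z ^ 3 / 2 + (1 + z) * E - F"
    by (simp add: E_def F_def algebra_simps power2_eq_square power3_eq_cube)
  then have "norm ((1 + z) * exp (- z) - exp (- z\<^sup>2 / 2)) \<le> norm (z ^ 3 / 2) + norm (1 + z) * norm E + norm F"
    by (metis (no_types, lifting) add_mono_thms_linordered_semiring(3) norm_mult norm_triangle_ineq norm_triangle_ineq4 order_trans)
  also have "\<dots> \<le> norm z ^ 3 / 2 + 2 * (3 * norm z ^ 3 / 2) + 3 * norm z ^ 3 / 4"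
  proof (intro add_mono mult_mono E F)
    show "norm (1 + z) \<le> 2" using norm_triangle_ineq[of 1 z] assms by simp
  qed (auto simp: norm_divide norm_power)
  also have "\<dots> \<le> 12 * norm z ^ 3" by simp
  finally show ?thesis .
qed

text \<open>Since n s = c, removing \<open>exp (2 * c * cos t)\<close> leaves the n-th power of (1 +
  z) e^(-z) with z = s e^(-it), and n z^2 = x e^(-2it). A single factor is off by at most 12 s^3, so
  the power is off by a multiple of n s^3 = x s, which is of order n^(-1/2).\<close>

lemma lag_integrand_approx:
  fixes x :: real
  assumes "x > 0"
  shows "\<exists>K\<ge>0. \<forall>n\<ge>1. real n \<ge> x \<longrightarrow> (\<forall>t.
     norm (lag_integrand n (sqrt (x / n)) (sqrt (x * n)) t * exp (- of_real (2 * sqrt (x * n) * cos t)) - exp (- of_real (x / 2) * cis (- 2 * t)))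
       \<le> K / sqrt n)"
proof -
  define K where "K = 12 * exp (13 * x) * x * sqrt x"
  have "K \<ge> 0" using assms by (simp add: K_def)
  moreover have "norm (lag_integrand n (sqrt (x / n)) (sqrt (x * n)) t * exp (- of_real (2 * sqrt (x * n) * cos t)) - exp (- of_real (x / 2) * cis (- 2 * t)))
       \<le> K / sqrt n" if n: "n \<ge> 1" "real n \<ge> x" for n t
  proof -
    define s where "s = sqrt (x / n)"
    define c where "c = sqrt (x * n)"
    define z where "z = complex_of_real s * cis (- t)"
    have s: "s \<ge> 0" "s \<le> 1" "s\<^sup>2 = x / n" using n assms by (auto simp: s_def)
    have ns: "real n * s = c"
    proof -
      have "real n * s = sqrt (real n * real n) * sqrt (x / n)" by (simp add: s_def)
      also have "\<dots> = sqrt (x * n)" unfolding real_sqrt_mult[symmetric] using n by simp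
      finally show ?thesis by (simp add: c_def)
    qed
    have nz: "norm z = s" using s by (simp add: z_def norm_mult)
    have lhs: "lag_integrand n s c t * exp (- of_real (2 * c * cos t)) = ((1 + z) * exp (- z)) ^ n"
    proof -
      have "of_nat n * z = of_real c * cis (- t)" by (simp add: z_def ns[symmetric])
      moreover have "of_real c * cis t - of_real (2 * c * cos t) = - (of_real c * cis (- t))"
        by (simp add: complex_eq_iff)
      ultimately have e: "of_real c * cis t - of_real (2 * c * cos t) = of_nat n * (- z)" by simp
      have "exp (of_real c * cis t) * exp (- of_real (2 * c * cos t)) = exp (of_real c * cis t - of_real (2 * c * cos t))"
        by (simp add: exp_diff exp_minus divide_inverse)
      also have "\<dots> = exp (- z) ^ n" unfolding e exp_of_nat_mult ..
      finally have e2: "exp (of_real c * cis t) * exp (- of_real (2 * c * cos t)) = exp (- z) ^ n" .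
      show ?thesis
        by (simp only: lag_integrand_def z_def[symmetric] power_mult_distrib mult.assoc[of "(1 + z) ^ n"] e2)
    qed
    have rhs: "exp (- of_real (x / 2) * cis (- 2 * t)) = exp (- z\<^sup>2 / 2) ^ n"
    proof -
      have "z\<^sup>2 = of_real (x / n) * cis (- 2 * t)"
        unfolding z_def power_mult_distrib of_real_power[symmetric] s(3)
        by (simp add: power2_eq_square cis_mult)
      then have "of_nat n * (- z\<^sup>2 / 2) = - of_real (x / 2) * cis (- 2 * t)" using n by (simp add: field_simps)
      then show ?thesis by (metis exp_of_nat_mult)
    qed
    \<comment> \<open>Dominates both bases: one \<open>s\<^sup>2\<close> bounds the Gaussian factor
      and twelve bound the error of the approximation. Its n-th power is
      \<open>exp (13 * x)\<close>, independent of \<open>n\<close>.\<close>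
    define M where "M = exp (13 * s\<^sup>2)"
    have "M \<ge> 1" by (simp add: M_def)
    have b1: "norm (exp (- z\<^sup>2 / 2)) \<le> exp (s\<^sup>2)"
    proof -
      have "norm (exp (- z\<^sup>2 / 2)) \<le> exp (norm (- z\<^sup>2 / 2))" by (rule norm_exp)
      also have "\<dots> \<le> exp (s\<^sup>2)" by (simp add: norm_divide norm_power nz)
      finally show ?thesis .
    qed
    also have "exp (s\<^sup>2) \<le> M" by (simp add: M_def)
    finally have bM: "norm (exp (- z\<^sup>2 / 2)) \<le> M" .
    have diff: "norm ((1 + z) * exp (- z) - exp (- z\<^sup>2 / 2)) \<le> 12 * s ^ 3"
      using one_plus_mult_exp_minus_bound[of z] s nz by simp
    have aM: "norm ((1 + z) * exp (- z)) \<le> M"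
    proof -
      have "norm ((1 + z) * exp (- z)) \<le> norm (exp (- z\<^sup>2 / 2)) + norm ((1 + z) * exp (- z) - exp (- z\<^sup>2 / 2))"
        by (metis norm_triangle_sub)
      also have "\<dots> \<le> exp (s\<^sup>2) + 12 * s ^ 3" by (intro add_mono b1 diff)
      also have "\<dots> \<le> exp (s\<^sup>2) + exp (s\<^sup>2) * (12 * s\<^sup>2)"
      proof -
        have "s ^ 3 \<le> s\<^sup>2" using s by (intro power_decreasing) auto
        also have "s\<^sup>2 \<le> exp (s\<^sup>2) * s\<^sup>2" by (simp add: mult_le_cancel_right1)
        finally show ?thesis by simp
      qed
      also have "\<dots> = exp (s\<^sup>2) * (1 + 12 * s\<^sup>2)" by (simp add: algebra_simps)
      also have "\<dots> \<le> exp (s\<^sup>2) * exp (12 * s\<^sup>2)" by (intro mult_left_mono exp_ge_add_one_self) auto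
      also have "\<dots> = M" by (simp add: M_def flip: exp_add)
      finally show ?thesis .
    qed
    have "norm (((1 + z) * exp (- z)) ^ n - exp (- z\<^sup>2 / 2) ^ n) \<le> n * M ^ n * norm ((1 + z) * exp (- z) - exp (- z\<^sup>2 / 2))"
      by (rule norm_power_diff_le[OF aM bM \<open>M \<ge> 1\<close>])
    also have "\<dots> \<le> n * M ^ n * (12 * s ^ 3)" by (intro mult_left_mono diff) (use \<open>M \<ge> 1\<close> in auto)
    also have "M ^ n = exp (13 * x)" using n s(3) by (simp add: M_def flip: exp_of_nat_mult)
    also have "n * exp (13 * x) * (12 * s ^ 3) = 12 * exp (13 * x) * (n * s\<^sup>2) * s"
      by (simp add: power3_eq_cube power2_eq_square)
    also have "\<dots> = K / sqrt n" using n unfolding s(3) by (simp add: K_def s_def real_sqrt_divide)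
    finally show ?thesis unfolding s_def[symmetric] c_def[symmetric] lhs rhs .
  qed
  ultimately show ?thesis by blast
qed

text \<open>Taking the real part removes the term linear in $t$, which would only give the relative error
  $O(n^{-1/4})$ in Laplace's method.\<close>

lemma Re_exp_cis_approx:
  fixes x t :: real
  assumes "x > 0"
  shows "\<bar>Re (exp (- of_real (x / 2) * cis (- 2 * t))) - exp (- x / 2)\<bar> \<le> (x + x\<^sup>2 * exp x) * t\<^sup>2"
proof -
  \<comment> \<open>The exponent relative to its value at t = 0. Its modulus
    \<open>x * \<bar>sin t\<bar>\<close> is of first order in t, but its real part
    \<open>x * (sin t)\<^sup>2\<close> is of second order.\<close>
  define w where "w = complex_of_real (x / 2) * (1 - cis (- 2 * t))"
  have Rew: "Re w = x * (sin t)\<^sup>2"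
    by (simp add: w_def cos_double_sin)
  have "norm (1 - cis (- 2 * t)) = 2 * \<bar>sin t\<bar>"
  proof -
    have "(norm (1 - cis (- 2 * t)))\<^sup>2 = (1 - cos (2 * t))\<^sup>2 + (sin (2 * t))\<^sup>2"
      by (simp add: cmod_power2)
    also have "\<dots> = 2 - 2 * cos (2 * t)"
      using sin_cos_squared_add[of "2 * t"] by (simp add: power2_diff)
    also have "\<dots> = (2 * \<bar>sin t\<bar>)\<^sup>2" by (simp add: cos_double_sin power_mult_distrib)
    finally have "(norm (1 - cis (- 2 * t)))\<^sup>2 = (2 * \<bar>sin t\<bar>)\<^sup>2" .
    then show ?thesis by (rule power2_eq_imp_eq) auto
  qed
  then have nw: "norm w = x * \<bar>sin t\<bar>" using assms by (simp add: w_def norm_mult)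
  have sin2: "(sin t)\<^sup>2 \<le> t\<^sup>2" using abs_sin_x_le_abs_x[of t] by (simp add: abs_le_square_iff)
  have "norm w \<le> x" using assms nw by (simp add: mult_left_le)
  have eq: "exp (- of_real (x / 2) * cis (- 2 * t)) = of_real (exp (- x / 2)) * exp w"
    by (simp add: w_def algebra_simps flip: exp_add exp_of_real)
  have "norm (exp w - (1 + w)) \<le> exp (norm w) * norm w ^ 2"
    using Taylor_exp_field[of w 1] by (simp add: numeral_2_eq_2)
  also have "\<dots> \<le> exp x * (x\<^sup>2 * t\<^sup>2)"
    using \<open>norm w \<le> x\<close> sin2 by (intro mult_mono) (auto simp: nw power_mult_distrib intro!: mult_left_mono)
  finally have "\<bar>Re (exp w - (1 + w))\<bar> \<le> exp x * (x\<^sup>2 * t\<^sup>2)" using abs_Re_le_cmod order_trans by blast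
  moreover have "\<bar>Re w\<bar> \<le> x * t\<^sup>2" using assms sin2 by (simp add: Rew abs_mult)
  ultimately have "\<bar>Re (exp w) - 1\<bar> \<le> exp x * (x\<^sup>2 * t\<^sup>2) + x * t\<^sup>2" by simp
  moreover have "Re (exp (- of_real (x / 2) * cis (- 2 * t))) - exp (- x / 2) = exp (- x / 2) * (Re (exp w) - 1)"
    unfolding eq by (simp add: right_diff_distrib)
  then have "\<bar>Re (exp (- of_real (x / 2) * cis (- 2 * t))) - exp (- x / 2)\<bar> = exp (- x / 2) * \<bar>Re (exp w) - 1\<bar>"
    by (simp only: abs_mult abs_exp_cancel)
  moreover have "exp (- x / 2) * \<bar>Re (exp w) - 1\<bar> \<le> 1 * \<bar>Re (exp w) - 1\<bar>"
    using assms by (intro mult_right_mono) auto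
  ultimately show ?thesis by (simp add: algebra_simps)
qed

section \<open>Laplace's method\<close>

lemma gauss_half_moment:
  assumes "s > 0"
  shows "has_bochner_integral lborel (\<lambda>x::real. indicator {0..} x * (x ^ (2 * k) * exp (- s * x\<^sup>2)))
     (sqrt pi / 2 * (fact (2 * k) / (2 ^ (2 * k) * fact k)) / sqrt s ^ (2 * k + 1))"
proof -
  let ?f = "\<lambda>x::real. indicator {0..} x *\<^sub>R (exp (-x\<^sup>2)*x^(2 * k))"
  let ?I = "sqrt pi / 2 * (fact (2 * k) / (2 ^ (2 * k) * fact k))"
  have "has_bochner_integral lborel (\<lambda>x. ?f (0 + sqrt s * x)) (?I /\<^sub>R \<bar>sqrt s\<bar>)"
    using lborel_has_bochner_integral_real_affine_iff[of "sqrt s" ?f ?I 0] gaussian_moment_even_pos[of k] assms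
    by (simp del: scaleR_conv_of_real)
  from has_bochner_integral_mult_right[OF this, of "1 / sqrt s ^ (2 * k)"]
  have "has_bochner_integral lborel (\<lambda>x. 1 / sqrt s ^ (2 * k) * ?f (0 + sqrt s * x)) (1 / sqrt s ^ (2 * k) * (?I /\<^sub>R \<bar>sqrt s\<bar>))"
    by simp
  also have "(\<lambda>x. 1 / sqrt s ^ (2 * k) * ?f (0 + sqrt s * x)) = (\<lambda>x. indicator {0..} x * (x ^ (2 * k) * exp (- s * x\<^sup>2)))"
    using assms by (intro ext) (auto simp: indicator_def power_mult_distrib zero_le_mult_iff)
  also have "1 / sqrt s ^ (2 * k) * (?I /\<^sub>R \<bar>sqrt s\<bar>) = ?I / sqrt s ^ (2 * k + 1)"
    using assms by (simp add: field_simps)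
  finally show ?thesis .
qed

lemma sin_ge_cubic:
  fixes u :: real assumes "u \<ge> 0" shows "u - u ^ 3 / 6 \<le> sin u"
proof -
  have "(\<lambda>u. sin u - u + u ^ 3 / 6) 0 \<le> (\<lambda>u. sin u - u + u ^ 3 / 6) u"
  proof (rule DERIV_nonneg_imp_nondecreasing[OF assms])
    fix x :: real
    have "((\<lambda>u. sin u - u + u ^ 3 / 6) has_real_derivative cos x - 1 + x\<^sup>2 / 2) (at x)"
      by (auto intro!: derivative_eq_intros)
    moreover have "cos x - 1 + x\<^sup>2 / 2 \<ge> 0"
    proof -
      have "(sin (x / 2))\<^sup>2 \<le> (x / 2)\<^sup>2"
        by (rule abs_le_square_iff[THEN iffD1, OF abs_sin_x_le_abs_x])
      then show ?thesis using cos_double_sin[of "x / 2"] by (simp add: power_divide)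
    qed
    ultimately show "\<exists>y. ((\<lambda>u. sin u - u + u ^ 3 / 6) has_real_derivative y) (at x) \<and> 0 \<le> y" by blast
  qed
  then show ?thesis by simp
qed

text \<open>The first two bounds give the quadratic approximation at the saddle point. The third
  provides one dominating Gaussian on all of [0, pi]: u = t/2 is below 2 there, so sin u is at least
  u/3, and 2 (t/6)^2 = t^2/18.\<close>

lemma one_minus_cos_bounds:
  fixes t :: real assumes "0 \<le> t"
  shows "1 - cos t \<le> t\<^sup>2 / 2" "t\<^sup>2 / 2 - t ^ 4 \<le> 1 - cos t" "t \<le> pi \<Longrightarrow> t\<^sup>2 / 18 \<le> 1 - cos t"
proof -
  define u where "u = t / 2"
  have u: "u \<ge> 0" "t = 2 * u" using assms by (auto simp: u_def)
  have c: "1 - cos t = 2 * (sin u)\<^sup>2" using cos_double_sin[of u] by (simp add: u)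
  have su: "\<bar>sin u\<bar> \<le> u" using abs_sin_x_le_abs_x[of u] u by simp
  have s2: "(sin u)\<^sup>2 \<le> u\<^sup>2"
    by (rule abs_le_square_iff[THEN iffD1, OF abs_sin_x_le_abs_x])
  have "t\<^sup>2 / 2 = 2 * u\<^sup>2" by (simp add: u(2) power_mult_distrib)
  then show "1 - cos t \<le> t\<^sup>2 / 2" using s2 c by linarith
  have "(u - sin u) * (u + sin u) \<le> u ^ 3 / 6 * (2 * u)"
    using sin_ge_cubic[OF u(1)] su u by (intro mult_mono) auto
  then have "u\<^sup>2 - (sin u)\<^sup>2 \<le> u ^ 4 / 3" by (simp add: algebra_simps power2_eq_square power4_eq_xxxx power3_eq_cube)
  moreover have "u ^ 4 / 3 \<le> 8 * u ^ 4" by simp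
  ultimately have "2 * u\<^sup>2 - 16 * u ^ 4 \<le> 2 * (sin u)\<^sup>2" by linarith
  then show "t\<^sup>2 / 2 - t ^ 4 \<le> 1 - cos t" unfolding c by (simp add: u power_mult_distrib)
  show "t\<^sup>2 / 18 \<le> 1 - cos t" if "t \<le> pi"
  proof -
    have "u \<le> 2" using that pi_less_4 by (simp add: u_def)
    then have "u\<^sup>2 \<le> 2\<^sup>2" using u by (intro power_mono) auto
    then have "u * u\<^sup>2 \<le> u * 4" using u by (intro mult_left_mono) auto
    then have "u / 3 \<le> sin u" using sin_ge_cubic[OF u(1)] by (simp add: power3_eq_cube power2_eq_square)
    then have "(u / 3)\<^sup>2 \<le> (sin u)\<^sup>2" using u by (intro power_mono) auto
    then show ?thesis unfolding c by (simp add: u power_mult_distrib power_divide)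
  qed
qed

lemma abs_exp_minus_diff_le:
  fixes A B m :: real
  assumes "m \<le> A" "m \<le> B"
  shows "\<bar>exp (- A) - exp (- B)\<bar> \<le> \<bar>A - B\<bar> * exp (- m)"
proof -
  have *: "exp (- p) - exp (- q) \<le> (q - p) * exp (- m)" if "m \<le> p" "p \<le> q" for p q :: real
  proof -
    have "exp (- p) - exp (- q) = exp (- p) * (1 - exp (- (q - p)))" by (simp add: algebra_simps flip: exp_add)
    also have "\<dots> \<le> exp (- m) * (q - p)"
    proof (rule mult_mono)
      show "1 - exp (- (q - p)) \<le> q - p" using exp_ge_add_one_self[of "- (q - p)"] by linarith
    qed (use that in auto)
    finally show ?thesis by (simp add: mult.commute)
  qed
  show ?thesis
  proof (cases "A \<le> B")
    case True
    then have "exp (- B) \<le> exp (- A)" by simp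
    then show ?thesis using *[OF assms(1) True] True by simp
  next
    case False
    then have "exp (- A) \<le> exp (- B)" by simp
    then show ?thesis using *[OF assms(2), of A] False by simp
  qed
qed

text \<open>Beyond pi the integrand is 0 and only the Gaussian tail remains; there t is at least 1,
  and the term \<open>Y * t ^ 4\<close> already covers it. This gives one bound on the whole half
  line, ready to be integrated.\<close>

lemma laplace_pointwise:
  fixes g :: "real \<Rightarrow> real"
  assumes Y: "Y \<ge> 1" and g0: "0 \<le> g0" "g0 \<le> 1" and K: "K \<ge> 0" "d \<ge> 0" and t: "t \<ge> 0"
    and g: "t \<le> pi \<Longrightarrow> \<bar>g t - g0\<bar> \<le> K * (t\<^sup>2 + d)"
  shows "\<bar>indicator {0..pi} t * (exp (- Y * (1 - cos t)) * g t) - g0 * exp (- (Y / 2) * t\<^sup>2)\<bar>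
     \<le> (K * (t\<^sup>2 + d) + Y * t ^ 4) * exp (- (Y / 18) * t\<^sup>2)"
proof (cases "t \<le> pi")
  case True
  note cb = one_minus_cos_bounds[OF t]
  let ?e = "exp (- (Y / 18) * t\<^sup>2)"
  have e1: "exp (- Y * (1 - cos t)) \<le> ?e" using cb(3)[OF True] Y by simp
  have "\<bar>exp (- (Y * (1 - cos t))) - exp (- (Y / 2 * t\<^sup>2))\<bar> \<le> \<bar>Y * (1 - cos t) - Y / 2 * t\<^sup>2\<bar> * exp (- (Y / 18 * t\<^sup>2))"
    using cb(3)[OF True] Y by (intro abs_exp_minus_diff_le) (auto intro!: mult_right_mono)
  also have "Y * (1 - cos t) - Y / 2 * t\<^sup>2 = Y * ((1 - cos t) - t\<^sup>2 / 2)"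
    by (simp add: algebra_simps)
  also have "\<bar>\<dots>\<bar> = Y * \<bar>(1 - cos t) - t\<^sup>2 / 2\<bar>"
    using Y by (simp add: abs_mult)
  also have "\<dots> \<le> Y * t ^ 4" using cb(1,2) Y by (intro mult_left_mono) auto
  finally have e2: "\<bar>exp (- Y * (1 - cos t)) - exp (- (Y / 2) * t\<^sup>2)\<bar> \<le> Y * t ^ 4 * ?e"
    by (simp add: mult_right_mono)
  have "exp (- Y * (1 - cos t)) * g t - g0 * exp (- (Y / 2) * t\<^sup>2)
     = exp (- Y * (1 - cos t)) * (g t - g0) + g0 * (exp (- Y * (1 - cos t)) - exp (- (Y / 2) * t\<^sup>2))"
    by (simp add: algebra_simps)
  also have "\<bar>\<dots>\<bar> \<le> exp (- Y * (1 - cos t)) * \<bar>g t - g0\<bar> + g0 * \<bar>exp (- Y * (1 - cos t)) - exp (- (Y / 2) * t\<^sup>2)\<bar>"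
    using g0 by (intro order_trans[OF abs_triangle_ineq]) (simp add: abs_mult)
  also have "\<dots> \<le> ?e * (K * (t\<^sup>2 + d)) + 1 * (Y * t ^ 4 * ?e)"
    using e1 e2 g[OF True] g0 K Y by (intro add_mono mult_mono) auto
  finally show ?thesis using True t by (simp add: algebra_simps)
next
  case False
  then have "t \<ge> 1" using pi_ge_two by linarith
  then have "1 \<le> Y * t ^ 4" using Y mult_mono[of 1 Y 1 "t ^ 4"] by simp
  have "g0 * exp (- (Y / 2) * t\<^sup>2) \<le> 1 * exp (- (Y / 18) * t\<^sup>2)"
    using g0 Y by (intro mult_mono) (auto intro!: mult_right_mono)
  also have "\<dots> \<le> (K * (t\<^sup>2 + d) + Y * t ^ 4) * exp (- (Y / 18) * t\<^sup>2)"
    using \<open>1 \<le> Y * t ^ 4\<close> K by (intro mult_right_mono) (auto intro: add_increasing)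
  finally show ?thesis using False g0 by (simp add: abs_mult)
qed

text \<open>The constant \<open>A\<close> precedes all other quantifiers because \<open>g\<close>,
  \<open>d\<close> and \<open>Y\<close> will vary with n. After scaling by \<open>sqrt Y\<close>,
  the errors \<open>K * t\<^sup>2\<close> and \<open>Y * t ^ 4\<close> contribute order 1/Y, while
  the uniform error \<open>K * d\<close> keeps its size.\<close>

lemma laplace_estimate:
  "\<exists>A\<ge>0. \<forall>Y (g::real \<Rightarrow> real) g0 K d I. Y \<ge> 1 \<longrightarrow> 0 \<le> g0 \<longrightarrow> g0 \<le> 1 \<longrightarrow> K \<ge> 0 \<longrightarrow> d \<ge> 0
    \<longrightarrow> continuous_on {0..pi} g \<longrightarrow> (\<forall>t\<in>{0..pi}. \<bar>g t - g0\<bar> \<le> K * (t\<^sup>2 + d))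
    \<longrightarrow> ((\<lambda>t. exp (- Y * (1 - cos t)) * g t) has_integral I) {0..pi}
    \<longrightarrow> \<bar>sqrt Y * I - g0 * sqrt (pi / 2)\<bar> \<le> A * ((K + 1) / Y + K * d)"
proof -
  \<comment> \<open>The moment of order \<open>2 * k\<close> of
    \<open>exp (- x\<^sup>2 / 18)\<close> on the half line.\<close>
  define m where "m k = sqrt pi / 2 * (fact (2 * k) / (2 ^ (2 * k) * fact k)) * sqrt 18 ^ (2 * k + 1)" for k
  have m_nn: "m k \<ge> 0" for k by (simp add: m_def)
  define A where "A = m 0 + m 1 + m 2"
  have A: "A \<ge> 0" "m 0 \<le> A" "m 1 \<le> A" "m 2 \<le> A" using m_nn[of 0] m_nn[of 1] m_nn[of 2] by (auto simp: A_def)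
  have main: "\<bar>sqrt Y * I - g0 * sqrt (pi / 2)\<bar> \<le> A * ((K + 1) / Y + K * d)"
    if Y: "Y \<ge> 1" and g0: "0 \<le> g0" "g0 \<le> 1" and K: "K \<ge> 0" "d \<ge> 0"
      and cont: "continuous_on {0..pi} g" and g: "\<And>t. t \<in> {0..pi} \<Longrightarrow> \<bar>g t - g0\<bar> \<le> K * (t\<^sup>2 + d)"
      and I: "((\<lambda>t. exp (- Y * (1 - cos t)) * g t) has_integral I) {0..pi}"
    for Y g0 K d I and g :: "real \<Rightarrow> real"
  proof -
    have mom: "has_bochner_integral lborel (\<lambda>x::real. indicator {0..} x * (x ^ j * exp (- (Y / 18) * x\<^sup>2))) (m k / sqrt Y ^ l)"
      if "j = 2 * k" "l = 2 * k + 1" for j k l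
      using gauss_half_moment[of "Y / 18" k] Y unfolding that by (simp add: m_def real_sqrt_divide power_divide)
    let ?h = "\<lambda>t. indicator {0..pi} t * (exp (- Y * (1 - cos t)) * g t)"
    let ?G = "\<lambda>t. indicator {0..} t * (g0 * exp (- (Y / 2) * t\<^sup>2))"
    let ?R = "\<lambda>t::real. indicator {0..} t * ((K * (t\<^sup>2 + d) + Y * t ^ 4) * exp (- (Y / 18) * t\<^sup>2))"
    have set_int: "set_integrable lborel {0..pi} (\<lambda>t. exp (- Y * (1 - cos t)) * g t)"
      by (intro borel_integrable_atLeastAtMost' continuous_intros cont)
    have h: "has_bochner_integral lborel ?h I"
    proof -
      have "(LINT t:{0..pi}|lborel. exp (- Y * (1 - cos t)) * g t) = I"
        using set_borel_integral_eq_integral(2)[OF set_int] I by (simp add: integral_unique)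
      then show ?thesis using set_int
        by (simp add: has_bochner_integral_iff set_integrable_def set_lebesgue_integral_def)
    qed
    have G: "has_bochner_integral lborel ?G (g0 * (sqrt pi / 2 / sqrt (Y / 2)))"
      using has_bochner_integral_mult_right[OF gauss_half_moment[of "Y / 2" 0], of g0] Y by (simp add: mult_ac)
    have Rint: "has_bochner_integral lborel ?R (K * (m 1 / sqrt Y ^ 3) + K * d * (m 0 / sqrt Y) + Y * (m 2 / sqrt Y ^ 5))"
    proof -
      have "has_bochner_integral lborel (\<lambda>t. K * (indicator {0..} t * (t\<^sup>2 * exp (- (Y / 18) * t\<^sup>2)))
           + K * d * (indicator {0..} t * (t ^ 0 * exp (- (Y / 18) * t\<^sup>2)))
           + Y * (indicator {0..} t * (t ^ 4 * exp (- (Y / 18) * t\<^sup>2))))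
        (K * (m 1 / sqrt Y ^ 3) + K * d * (m 0 / sqrt Y ^ 1) + Y * (m 2 / sqrt Y ^ 5))"
        by (intro has_bochner_integral_add has_bochner_integral_mult_right mom) auto
      also have "(\<lambda>t. K * (indicator {0..} t * (t\<^sup>2 * exp (- (Y / 18) * t\<^sup>2)))
           + K * d * (indicator {0..} t * (t ^ 0 * exp (- (Y / 18) * t\<^sup>2)))
           + Y * (indicator {0..} t * (t ^ 4 * exp (- (Y / 18) * t\<^sup>2)))) = ?R"
        by (intro ext) (simp add: algebra_simps)
      finally show ?thesis by (simp only: power_one_right)
    qed
    have "\<bar>I - g0 * (sqrt pi / 2 / sqrt (Y / 2))\<bar> = \<bar>\<integral>t. ?h t - ?G t \<partial>lborel\<bar>"
      using has_bochner_integral_diff[OF h G] by (simp add: has_bochner_integral_iff)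
    also have "\<dots> \<le> (\<integral>t. ?R t \<partial>lborel)"
    proof (rule integral_abs_bound_integral)
      show "integrable lborel (\<lambda>t. ?h t - ?G t)" using has_bochner_integral_diff[OF h G] by (simp add: has_bochner_integral_iff)
      show "integrable lborel ?R" using Rint by (simp add: has_bochner_integral_iff)
      fix t :: real
      show "\<bar>?h t - ?G t\<bar> \<le> ?R t"
        using laplace_pointwise[OF Y g0 K, of t g] g[of t] by (cases "t \<ge> 0") auto
    qed
    also have "\<dots> = K * (m 1 / sqrt Y ^ 3) + K * d * (m 0 / sqrt Y) + Y * (m 2 / sqrt Y ^ 5)"
      using Rint by (simp add: has_bochner_integral_iff)
    finally have bound: "\<bar>I - g0 * (sqrt pi / 2 / sqrt (Y / 2))\<bar> \<le> K * (m 1 / sqrt Y ^ 3) + K * d * (m 0 / sqrt Y) + Y * (m 2 / sqrt Y ^ 5)" .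
    have sY: "sqrt Y > 0" "sqrt Y * sqrt Y = Y" using Y by auto
    have "sqrt Y * (g0 * (sqrt pi / 2 / sqrt (Y / 2))) = g0 * sqrt (pi / 2)"
    proof -
      have "sqrt 2 * sqrt 2 = (2::real)" by simp
      then have "2 / sqrt 2 = (sqrt 2 :: real)" by (metis nonzero_mult_div_cancel_right real_sqrt_eq_zero_cancel_iff zero_neq_numeral)
      have "sqrt Y * (sqrt pi / 2 / sqrt (Y / 2)) = sqrt pi * (sqrt 2 / 2)"
        using sY(1) by (simp add: real_sqrt_divide)
      also have "sqrt 2 / 2 = 1 / sqrt 2"
        using \<open>2 / sqrt 2 = sqrt 2\<close> by (simp add: field_simps)
      also have "sqrt pi * (1 / sqrt 2) = sqrt (pi / 2)" by (simp add: real_sqrt_divide)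
      finally have Q: "sqrt Y * (sqrt pi / 2 / sqrt (Y / 2)) = sqrt (pi / 2)" .
      show ?thesis by (subst mult.left_commute) (simp only: Q)
    qed
    then have "sqrt Y * I - g0 * sqrt (pi / 2) = sqrt Y * (I - g0 * (sqrt pi / 2 / sqrt (Y / 2)))"
      by (simp only: right_diff_distrib)
    then have "\<bar>sqrt Y * I - g0 * sqrt (pi / 2)\<bar> = sqrt Y * \<bar>I - g0 * (sqrt pi / 2 / sqrt (Y / 2))\<bar>"
      using sY(1) by (simp only: abs_mult abs_of_pos)
    also have "\<dots> \<le> sqrt Y * (K * (m 1 / sqrt Y ^ 3) + K * d * (m 0 / sqrt Y) + Y * (m 2 / sqrt Y ^ 5))"
      using sY by (intro mult_left_mono bound) auto
    also have "\<dots> = K * m 1 / Y + K * d * m 0 + m 2 / Y"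
    proof -
      have p: "sqrt Y ^ 3 = sqrt Y * Y" "sqrt Y ^ 5 = sqrt Y * (Y * Y)"
        using sY(2) by (simp_all add: eval_nat_numeral mult.assoc)
      have "sqrt Y * (K * (m 1 / sqrt Y ^ 3)) = K * m 1 / Y" "sqrt Y * (K * d * (m 0 / sqrt Y)) = K * d * m 0"
        using sY(1) unfolding p by simp_all
      moreover have "sqrt Y * (Y * (m 2 / sqrt Y ^ 5)) = m 2 / Y"
        using sY(1) Y unfolding p by simp
      ultimately show ?thesis by (simp only: distrib_left)
    qed
    also have "\<dots> \<le> K * A / Y + K * d * A + A / Y"
      using A K Y by (intro add_mono divide_right_mono mult_left_mono) auto
    also have "\<dots> = A * ((K + 1) / Y + K * d)" by (simp only: add_divide_distrib distrib_left times_divide_eq_right mult_1_right) (simp add: mult_ac)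
    finally show ?thesis .
  qed
  show ?thesis
    by (intro exI[of _ A] conjI A(1) allI impI) (rule main; (assumption | erule bspec; assumption))
qed

section \<open>Asymptotics of the projection norms\<close>

definition projection_norm_leading_term :: "real \<Rightarrow> nat \<Rightarrow> real" where
  "projection_norm_leading_term a k = 1 / (2 * (2 * real k) powr (1/4) * sqrt (\<bar>a\<bar> * pi))
              * exp (2 powr (3/2) * \<bar>a\<bar> * sqrt (real k))"

text \<open>Laplace's method with \<open>Y = 2 * sqrt (x * n)\<close>, the height of the saddle. The
  remaining factor \<open>g\<close> equals exp(-x/2) up to O(t^2 + n^(-1/2)). As \<open>Y\<close> is
  of order sqrt n, the error 1/Y of the method and the error of the integrand are of the same
  size.\<close>

lemma laguerre_neg_asymp:
  fixes x :: real
  assumes x: "x > 0"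
  shows "\<exists>C. \<forall>\<^sub>F n in sequentially.
     \<bar>exp (x / 2) * laguerre_neg n x * sqrt (2 * pi * (2 * sqrt (x * n))) / exp (2 * sqrt (x * n)) - 1\<bar> \<le> C / sqrt n"
proof -
  obtain K1 where K1: "K1 \<ge> 0" "\<And>n t. n \<ge> 1 \<Longrightarrow> real n \<ge> x \<Longrightarrow>
     norm (lag_integrand n (sqrt (x / n)) (sqrt (x * n)) t * exp (- of_real (2 * sqrt (x * n) * cos t)) - exp (- of_real (x / 2) * cis (- 2 * t)))
       \<le> K1 / sqrt n"
    using lag_integrand_approx[OF x] by blast
  obtain A where A: "A \<ge> 0" "\<And>Y (g::real \<Rightarrow> real) g0 K d I. Y \<ge> 1 \<Longrightarrow> 0 \<le> g0 \<Longrightarrow> g0 \<le> 1 \<Longrightarrow> K \<ge> 0 \<Longrightarrow> d \<ge> 0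
    \<Longrightarrow> continuous_on {0..pi} g \<Longrightarrow> (\<forall>t\<in>{0..pi}. \<bar>g t - g0\<bar> \<le> K * (t\<^sup>2 + d))
    \<Longrightarrow> ((\<lambda>t. exp (- Y * (1 - cos t)) * g t) has_integral I) {0..pi}
    \<Longrightarrow> \<bar>sqrt Y * I - g0 * sqrt (pi / 2)\<bar> \<le> A * ((K + 1) / Y + K * d)"
    using laplace_estimate by blast
  define K where "K = K1 + x + x\<^sup>2 * exp x"
  have "K \<ge> 0" using K1(1) x by (simp add: K_def)
  define C where "C = exp (x / 2) * sqrt (2 / pi) * (A * ((K + 1) / (2 * sqrt x) + K))"
  have "\<bar>exp (x / 2) * laguerre_neg n x * sqrt (2 * pi * (2 * sqrt (x * n))) / exp (2 * sqrt (x * n)) - 1\<bar> \<le> C / sqrt n"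
    if n: "n \<ge> 1" "real n \<ge> x" "2 * sqrt (x * n) \<ge> 1" for n
  proof -
    define Y where "Y = 2 * sqrt (x * n)"
    define g where "g t = Re (lag_integrand n (sqrt (x / n)) (sqrt (x * n)) t * exp (- of_real (Y * cos t)))" for t
    have "sqrt (x / n) * sqrt (x * n) = x" using n x by (simp add: real_sqrt_mult[symmetric])
    then have int: "((\<lambda>t. Re (lag_integrand n (sqrt (x / n)) (sqrt (x * n)) t)) has_integral pi * laguerre_neg n x) {0..pi}"
      using laguerre_neg_integral_half[of n "sqrt (x / n)" "sqrt (x * n)"] by simp
    have "\<bar>sqrt Y * (exp (- Y) * (pi * laguerre_neg n x)) - exp (- x / 2) * sqrt (pi / 2)\<bar> \<le> A * ((K + 1) / Y + K * (1 / sqrt n))"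
    proof (rule A(2))
      show "continuous_on {0..pi} g" unfolding g_def lag_integrand_def by (intro continuous_intros)
      show "\<forall>t\<in>{0..pi}. \<bar>g t - exp (- x / 2)\<bar> \<le> K * (t\<^sup>2 + 1 / sqrt n)"
      proof
        fix t :: real
        have "\<bar>g t - Re (exp (- of_real (x / 2) * cis (- 2 * t)))\<bar> \<le> K1 / sqrt n"
          using order_trans[OF abs_Re_le_cmod K1(2)[OF n(1,2), of t]] by (simp add: g_def Y_def)
        then have "\<bar>g t - exp (- x / 2)\<bar> \<le> K1 / sqrt n + (x + x\<^sup>2 * exp x) * t\<^sup>2"
          using Re_exp_cis_approx[OF x, of t] by linarith
        also have "\<dots> \<le> K * (1 / sqrt n) + K * t\<^sup>2"
          using K1(1) x by (intro add_mono mult_right_mono) (auto simp: K_def divide_right_mono)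
        finally show "\<bar>g t - exp (- x / 2)\<bar> \<le> K * (t\<^sup>2 + 1 / sqrt n)" by (simp add: algebra_simps)
      qed
      have "exp (- Y) * Re (lag_integrand n (sqrt (x / n)) (sqrt (x * n)) t) = exp (- Y * (1 - cos t)) * g t" for t
      proof -
        have "g t = Re (lag_integrand n (sqrt (x / n)) (sqrt (x * n)) t * of_real (exp (- (Y * cos t))))"
          unfolding g_def by (simp flip: exp_of_real)
        then have "g t = Re (lag_integrand n (sqrt (x / n)) (sqrt (x * n)) t) * exp (- (Y * cos t))" by simp
        moreover have "exp (- Y * (1 - cos t)) * exp (- (Y * cos t)) = exp (- Y)" by (simp add: algebra_simps flip: exp_add)
        ultimately show ?thesis by simp
      qed
      then show "((\<lambda>t. exp (- Y * (1 - cos t)) * g t) has_integral exp (- Y) * (pi * laguerre_neg n x)) {0..pi}"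
        using has_integral_mult_right[OF int, of "exp (- Y)"] by simp
    qed (use n x \<open>K \<ge> 0\<close> in \<open>auto simp: Y_def\<close>)
    also have "A * ((K + 1) / Y + K * (1 / sqrt n)) = A * ((K + 1) / (2 * sqrt x) + K) / sqrt n"
    proof -
      have "(K + 1) / Y = (K + 1) / (2 * sqrt x) / sqrt n" by (simp add: Y_def real_sqrt_mult)
      then show ?thesis by (simp only: add_divide_distrib distrib_left times_divide_eq_right mult_1_right)
    qed
    finally have b: "\<bar>sqrt Y * (exp (- Y) * (pi * laguerre_neg n x)) - exp (- x / 2) * sqrt (pi / 2)\<bar>
       \<le> A * ((K + 1) / (2 * sqrt x) + K) / sqrt n" .
    \<comment> \<open>The reciprocal of the limit \<open>exp (- x / 2) * sqrt (pi / 2)\<close>,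
      turning the absolute error into a relative one.\<close>
    define F where "F = exp (x / 2) * sqrt (2 / pi)"
    have "F \<ge> 0" by (simp add: F_def)
    have "sqrt (2 / pi) * sqrt (pi / 2) = 1" by (simp add: real_sqrt_mult[symmetric])
    then have F1: "F * (exp (- x / 2) * sqrt (pi / 2)) = 1"
      unfolding F_def by (simp add: exp_minus field_simps)
    have "sqrt (2 * pi * Y) = sqrt (2 / pi) * pi * sqrt Y"
    proof -
      have "2 * pi * Y = 2 / pi * (pi * pi) * Y" by (simp add: field_simps)
      then show ?thesis by (simp only: real_sqrt_mult real_sqrt_mult_self) simp
    qed
    then have "exp (x / 2) * laguerre_neg n x * sqrt (2 * pi * Y) / exp Y - 1 = F * (sqrt Y * (exp (- Y) * (pi * laguerre_neg n x)) - exp (- x / 2) * sqrt (pi / 2))"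
      unfolding right_diff_distrib F1 by (simp add: F_def exp_minus field_simps)
    then have "\<bar>exp (x / 2) * laguerre_neg n x * sqrt (2 * pi * Y) / exp Y - 1\<bar> = F * \<bar>sqrt Y * (exp (- Y) * (pi * laguerre_neg n x)) - exp (- x / 2) * sqrt (pi / 2)\<bar>"
      using \<open>F \<ge> 0\<close> by (simp add: abs_mult)
    also have "\<dots> \<le> F * (A * ((K + 1) / (2 * sqrt x) + K) / sqrt n)" using b \<open>F \<ge> 0\<close> by (rule mult_left_mono)
    also have "\<dots> = C / sqrt n" by (simp add: C_def F_def)
    finally show ?thesis unfolding Y_def .
  qed
  moreover have "\<forall>\<^sub>F n in sequentially. n \<ge> 1 \<and> real n \<ge> x \<and> 2 * sqrt (x * real n) \<ge> 1"
    using x by (intro eventually_conj eventually_ge_at_top) real_asymp+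
  ultimately show ?thesis by (intro exI[of _ C]) (auto elim!: eventually_mono)
qed

text \<open>At x = 2 a^2 the height of the saddle is 2^(3/2) |a| sqrt k, so the normalisation from
  Laplace's method is exactly the reciprocal of the leading term.\<close>

lemma leading_term_eq:
  assumes "a \<noteq> 0" "k \<ge> 1"
  shows "sqrt (2 * pi * (2 * sqrt (2 * a\<^sup>2 * k))) / exp (2 * sqrt (2 * a\<^sup>2 * k)) * projection_norm_leading_term a k = 1"
proof -
  have p: "(2::real) powr (3/2) = 2 * sqrt 2"
    using powr_add[of "2::real" 1 "1/2"] by (simp add: powr_half_sqrt)
  have e: "2 * sqrt (2 * a\<^sup>2 * k) = 2 powr (3/2) * \<bar>a\<bar> * sqrt (real k)"
    unfolding p by (simp add: real_sqrt_mult)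
  have s1: "2 * pi * (2 * sqrt (2 * a\<^sup>2 * k)) = 4 * sqrt (2 * k) * (\<bar>a\<bar> * pi)"
    by (simp add: real_sqrt_mult)
  have s2: "sqrt (4 * sqrt (2 * k) * (\<bar>a\<bar> * pi)) = sqrt 4 * sqrt (sqrt (2 * k)) * sqrt (\<bar>a\<bar> * pi)"
    by (simp only: real_sqrt_mult)
  have s3: "sqrt (sqrt (2 * real k)) = (2 * real k) powr (1/4)"
    by (simp add: powr_half_sqrt[symmetric] powr_powr)
  have s: "sqrt (2 * pi * (2 * sqrt (2 * a\<^sup>2 * k))) = 2 * (2 * real k) powr (1/4) * sqrt (\<bar>a\<bar> * pi)"
    unfolding s1 s2 by (simp add: s3)
  then show ?thesis unfolding projection_norm_leading_term_def s e using assms by simp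
qed

lemma leading_term_pos: "a \<noteq> 0 \<Longrightarrow> k \<ge> 1 \<Longrightarrow> projection_norm_leading_term a k > 0"
  by (simp add: projection_norm_leading_term_def)

lemma leading_term_log_limit:
  assumes "a \<noteq> 0"
  shows "(\<lambda>k. 1 / sqrt (real k) * ln (projection_norm_leading_term a k)) \<longlonglongrightarrow> 2 powr (3/2) * \<bar>a\<bar>"
proof -
  define b where "b = \<bar>a\<bar>"
  have "b > 0" using assms by (simp add: b_def)
  then show ?thesis unfolding projection_norm_leading_term_def b_def[symmetric] by real_asymp
qed

lemma asymptotics_from_laguerre:
  fixes N :: "nat \<Rightarrow> real"
  assumes a: "a \<noteq> 0" and N: "\<And>k. N k = exp (a\<^sup>2) * laguerre_neg k (2 * a\<^sup>2)"
  shows "(\<exists>E. E \<in> O(\<lambda>k. real k powr (-1/2)) \<and>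
           (\<forall>k\<ge>1. N k = projection_norm_leading_term a k * (1 + E k))) \<and>
         (\<lambda>k. 1 / sqrt (real k) * ln (N k)) \<longlonglongrightarrow> 2 powr (3/2) * \<bar>a\<bar>"
proof -
  define x where "x = 2 * a\<^sup>2"
  have "x > 0" using a by (simp add: x_def)
  \<comment> \<open>At \<open>k = 0\<close> the leading term is 0 by the conventions for
    \<open>powr\<close> and division, so \<open>E 0 = -1\<close>; the product formula is therefore
    claimed from \<open>k = 1\<close> on.\<close>
  define E where "E k = N k / projection_norm_leading_term a k - 1" for k
  have NE: "N k = projection_norm_leading_term a k * (1 + E k)" if "k \<ge> 1" for k
    using leading_term_pos[OF a that] by (simp add: E_def)
  obtain C where C: "\<forall>\<^sub>F n in sequentially.
     \<bar>exp (x / 2) * laguerre_neg n x * sqrt (2 * pi * (2 * sqrt (x * n))) / exp (2 * sqrt (x * n)) - 1\<bar> \<le> C / sqrt n"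
    using laguerre_neg_asymp[OF \<open>x > 0\<close>] by blast
  have Eb: "\<forall>\<^sub>F n in sequentially. norm (E n) \<le> C * norm (real n powr (-1/2))"
    using C eventually_ge_at_top[of 1]
  proof eventually_elim
    case (elim n)
    define r where "r = sqrt (2 * pi * (2 * sqrt (x * n))) / exp (2 * sqrt (x * n))"
    have "r * projection_norm_leading_term a n = 1" by (simp only: r_def x_def leading_term_eq[OF a elim(2)])
    then have inv: "1 / projection_norm_leading_term a n = r"
      using leading_term_pos[OF a elim(2)] by (simp add: field_simps)
    have "E n = exp (a\<^sup>2) * laguerre_neg n (2 * a\<^sup>2) * (1 / projection_norm_leading_term a n) - 1"
      by (simp add: E_def N)
    then have "E n = exp (x / 2) * laguerre_neg n x * r - 1" unfolding inv by (simp add: x_def)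
    then have "\<bar>E n\<bar> \<le> C / sqrt n" using elim(1) by (simp add: r_def)
    moreover have "real n powr (-1/2) = 1 / sqrt n"
      using powr_minus[of "real n" "1/2"] by (simp add: powr_half_sqrt inverse_eq_divide)
    ultimately show ?case by simp
  qed
  then have EO: "E \<in> O(\<lambda>k. real k powr (-1/2))" by (rule bigoI)
  have "E \<longlonglongrightarrow> 0"
  proof (rule Lim_null_comparison[OF Eb])
    have "(\<lambda>n. C * (real n powr (-1/2))) \<longlonglongrightarrow> 0" by real_asymp
    then show "(\<lambda>n. C * norm (real n powr (-1/2))) \<longlonglongrightarrow> 0" by simp
  qed
  have "(\<lambda>k. 1 / sqrt (real k) * ln (projection_norm_leading_term a k) + 1 / sqrt (real k) * ln (1 + E k))
     \<longlonglongrightarrow> 2 powr (3/2) * \<bar>a\<bar> + 0 * ln (1 + 0)"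
  proof (intro tendsto_add leading_term_log_limit[OF a] tendsto_mult)
    show "(\<lambda>k. 1 / sqrt (real k)) \<longlonglongrightarrow> 0" by real_asymp
    show "(\<lambda>k. ln (1 + E k)) \<longlonglongrightarrow> ln (1 + 0)"
      by (intro tendsto_ln tendsto_intros \<open>E \<longlonglongrightarrow> 0\<close>) simp
  qed
  \<comment> \<open>Eventually \<open>E k\<close> exceeds -1, so the logarithm of the product
    splits.\<close>
  moreover have "\<forall>\<^sub>F k in sequentially. 1 / sqrt (real k) * ln (projection_norm_leading_term a k) + 1 / sqrt (real k) * ln (1 + E k)
      = 1 / sqrt (real k) * ln (N k)"
    using eventually_ge_at_top[of 1] order_tendstoD(1)[OF \<open>E \<longlonglongrightarrow> 0\<close>, of "-1", simplified]
  proof eventually_elim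
    case (elim k)
    then show ?case using leading_term_pos[OF a elim(1)] unfolding NE[OF elim(1)]
      by (subst ln_mult) (auto simp: distrib_left)
  qed
  ultimately have "(\<lambda>k. 1 / sqrt (real k) * ln (N k)) \<longlonglongrightarrow> 2 powr (3/2) * \<bar>a\<bar> + 0 * ln (1 + 0)"
    by (rule Lim_transform_eventually)
  then show ?thesis using EO NE by auto
qed

theorem theorem2p6:
  fixes a :: real and A :: l2_operator and P :: "nat \<Rightarrow> (l2 \<Rightarrow>\<^sub>L l2)"
  assumes "a \<noteq> 0"
    and "A \<in> {op_L a, op_L_tilde a}"
    and "\<And>k. P k = spectral_projection A (complex_of_real (2 * real k + 1 + a\<^sup>2))"
  shows "(\<exists>E. E \<in> O(\<lambda>k. real k powr (-1/2)) \<and>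
           (\<forall>k\<ge>1. norm (P k) =
              1 / (2 * (2 * real k) powr (1/4) * sqrt (\<bar>a\<bar> * pi))
              * exp (2 powr (3/2) * \<bar>a\<bar> * sqrt (real k)) * (1 + E k))) \<and>
         (\<lambda>k. 1 / sqrt (real k) * ln (norm (P k))) \<longlonglongrightarrow> 2 powr (3/2) * \<bar>a\<bar>"
proof -
  \<comment> \<open>The parameter pairs (a, 0) and (0, a) have the same sum of squares, hence the
    same eigenvalues and the same projection norms.\<close>
  have "norm (P k) = exp (a\<^sup>2) * laguerre_neg k (2 * a\<^sup>2)" for k
    using assms(2) norm_spectral_projection[of a 0 k] norm_spectral_projection[of 0 a k]
    by (auto simp: assms(3) op_L_eq op_L_tilde_eq eigval_def)
  from asymptotics_from_laguerre[OF assms(1) this] show ?thesis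
    unfolding projection_norm_leading_term_def .
qed

end
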